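(* Let $k\ge 1$ and let $G$ be a finite simple graph that contains neither $K_{k+2}$ nor $K_{k+3}^{-3}$ as a minor. Then $G$ admits a conflict-free $k$-coloring, and such a coloring can be found in polynomial time by iterated elimination of distance-3 sets.
   Context: For a vertex $v$ of a simple graph $G$, $N[v]$ is the set consisting of $v$ and its neighbors, and for a vertex set $D$, $N[D]=\bigcup_{v\in D}N[v]$. A conflict-free $k$-coloring of $G$ is a map $\chi: V'\to\{1,\dots,k\}$ defined on a subset $V'\subseteq V(G)$ (other vertices uncolored) such that for every $v\in V(G)$ there is $w\in N[v]\cap V'$ whose color is different from the colors of all other vertices in $N[v]\cap V'$. $K_n$ is the complete graph on $n$ vertices and $K_n^{-3}$ is the graph obtained from $K_n$ by deleting the three edges of one triangle. Iterated elimination of distance-3 sets is the following procedure: set $i\leftarrow 1$; remove all connected components of $G$ that are paths; while $G$ is nonempty: start with $D$ containing one arbitrary vertex from each component of $G$; while some vertex is at distance at least $3$ from all vertices of $D$, add to $D$ such a vertex that is at distance exactly $3$ from some vertex of $D$; give all vertices of $D$ color $i$; set $i\leftarrow i+1$; delete $N[D]$ from $G$ and remove all components that are paths. Finally, color all removed path components with color $i$, coloring in each path a set of vertices so that every path vertex has exactly one colored vertex in its closed neighborhood (every third vertex). *)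

theory Defs
  imports "Graph_Theory.Graph_Theory"
begin

section \<open>Graphs and minors\<close>

text \<open>A finite simple graph is a symmetric loop-free digraph without parallel arcs, i.e. the
  locale predicate \<^term>\<open>graph\<close>; each undirected edge is a pair of opposite arcs. For such graphs the
  strongly connected components are the connected components.\<close>

definition complete_graph :: "nat \<Rightarrow> (nat, nat \<times> nat) pre_digraph" where
  "complete_graph n =
     with_proj \<lparr> pverts = {..<n}, parcs = {(i, j). i < n \<and> j < n \<and> i \<noteq> j} \<rparr>"

text \<open>The deleted triangle is the one on 0, 1, 2; only meaningful for \<open>n \<ge> 3\<close>.\<close>

definition complete_graph_minus_triangle :: "nat \<Rightarrow> (nat, nat \<times> nat) pre_digraph" where
  "complete_graph_minus_triangle n =
     with_proj \<lparr> pverts = {..<n},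
       parcs = {(i, j). i < n \<and> j < n \<and> i \<noteq> j} - {0, 1, 2} \<times> {0, 1, 2} \<rparr>"

lemma complete_digraph_complete_graph: "complete_digraph n (complete_graph n)"
  by (auto simp: complete_graph_def complete_digraph_pair_def)

lemma graph_complete_graph_minus_triangle: "graph (complete_graph_minus_triangle n)"
proof -
  define E :: "nat rel" where
    "E = {(i, j). i < n \<and> j < n \<and> i \<noteq> j} - {0, 1, 2} \<times> {0, 1, 2}"
  have E: "E \<subseteq> {..<n} \<times> {..<n}" "sym E" "irrefl E"
    unfolding E_def sym_def irrefl_def by blast+
  then have "finite E"
    using finite_subset[of E "{..<n} \<times> {..<n}"] by blast
  with E interpret pair_graph "\<lparr> pverts = {..<n}, parcs = E \<rparr>"
    by unfold_locales (auto simp: symmetric_def irrefl_def)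
  show ?thesis
    unfolding complete_graph_minus_triangle_def E_def[symmetric] by (rule pair_graphD_graph)
qed

text \<open>\<open>H\<close> is a minor of \<open>G\<close>: contracting the connected, pairwise disjoint branch sets \<open>B x\<close> and
  deleting the superfluous vertices and edges of \<open>G\<close> yields \<open>H\<close>. Branch sets are nonempty since
  \<^const>\<open>connected\<close> excludes the null graph.\<close>

definition is_minor :: "('w, 'f) pre_digraph \<Rightarrow> ('v, 'e) pre_digraph \<Rightarrow> bool" where
  "is_minor H G \<longleftrightarrow> (\<exists>B :: 'w \<Rightarrow> 'v set.
     (\<forall>x \<in> verts H. B x \<subseteq> verts G \<and> connected (G \<restriction> B x)) \<and>
     (\<forall>x \<in> verts H. \<forall>y \<in> verts H. x \<noteq> y \<longrightarrow> B x \<inter> B y = {}) \<and>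
     (\<forall>x y. x \<rightarrow>\<^bsub>H\<^esub> y \<longrightarrow> (\<exists>u \<in> B x. \<exists>v \<in> B y. u \<rightarrow>\<^bsub>G\<^esub> v)))"


section \<open>Conflict-free colorings\<close>

definition closed_nbhd :: "('v, 'e) pre_digraph \<Rightarrow> 'v \<Rightarrow> 'v set" where
  "closed_nbhd G v = insert v {u. v \<rightarrow>\<^bsub>G\<^esub> u}"

definition conflict_free_coloring :: "nat \<Rightarrow> ('v, 'e) pre_digraph \<Rightarrow> ('v \<rightharpoonup> nat) \<Rightarrow> bool" where
  "conflict_free_coloring k G \<chi> \<longleftrightarrow>
     dom \<chi> \<subseteq> verts G \<and> ran \<chi> \<subseteq> {1..k} \<and>
     (\<forall>v \<in> verts G. \<exists>w \<in> closed_nbhd G v \<inter> dom \<chi>.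
        \<forall>u \<in> closed_nbhd G v \<inter> dom \<chi>. u \<noteq> w \<longrightarrow> \<chi> u \<noteq> \<chi> w)"


section \<open>Iterated elimination of distance-3 sets\<close>

text \<open>Number of edges of a shortest walk, \<open>\<infinity>\<close> between different components.\<close>

definition gdist :: "('v, 'e) pre_digraph \<Rightarrow> 'v \<Rightarrow> 'v \<Rightarrow> ereal" where
  "gdist H u v = wf_digraph.\<mu> H (\<lambda>_. 1) u v"

definition is_path_graph :: "('v, 'e) pre_digraph \<Rightarrow> bool" where
  "is_path_graph H \<longleftrightarrow> (\<exists>p. p \<noteq> [] \<and> distinct p \<and> set p = verts H \<and>
     (\<forall>i < length p. \<forall>j < length p. p ! i \<rightarrow>\<^bsub>H\<^esub> p ! j \<longleftrightarrow> j = Suc i \<or> i = Suc j))"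

definition path_components :: "('v, 'e) pre_digraph \<Rightarrow> 'v set set" where
  "path_components H = {S \<in> pre_digraph.sccs_verts H. is_path_graph (H \<restriction> S)}"

text \<open>The sets \<open>D\<close> that can arise while a distance-3 set of \<open>H\<close> is being built.\<close>

inductive dist3_partial :: "('v, 'e) pre_digraph \<Rightarrow> 'v set \<Rightarrow> bool" for H where
  init: "\<lbrakk> D \<subseteq> verts H; \<forall>S \<in> pre_digraph.sccs_verts H. \<exists>!v. v \<in> D \<inter> S \<rbrakk> \<Longrightarrow> dist3_partial H D"
| add: "\<lbrakk> dist3_partial H D; v \<in> verts H; \<forall>u \<in> D. gdist H u v \<ge> 3; \<exists>u \<in> D. gdist H u v = 3 \<rbrakk>
    \<Longrightarrow> dist3_partial H (insert v D)"

definition dist3_set :: "('v, 'e) pre_digraph \<Rightarrow> 'v set \<Rightarrow> bool" where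
  "dist3_set H D \<longleftrightarrow> dist3_partial H D \<and> \<not> (\<exists>v \<in> verts H. \<forall>u \<in> D. gdist H u v \<ge> 3)"

text \<open>Configurations at the head of the outer loop: \<open>W\<close> is the vertex set of the remaining graph,
  \<open>i\<close> the next color, \<open>\<chi>\<close> the coloring so far, and \<open>P\<close> the set of (vertex sets of) all path
  components removed so far.\<close>

inductive elim_reach ::
  "('v, 'e) pre_digraph \<Rightarrow> 'v set \<Rightarrow> nat \<Rightarrow> ('v \<rightharpoonup> nat) \<Rightarrow> 'v set set \<Rightarrow> bool" for G where
  init: "elim_reach G (verts G - \<Union> (path_components G)) 1 Map.empty (path_components G)"
| round: "\<lbrakk> elim_reach G W i \<chi> P; W \<noteq> {}; dist3_set (G \<restriction> W) D;
      W' = W - (\<Union>v \<in> D. closed_nbhd (G \<restriction> W) v) \<rbrakk>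
    \<Longrightarrow> elim_reach G (W' - \<Union> (path_components (G \<restriction> W'))) (i + 1)
          (\<lambda>v. if v \<in> D then Some i else \<chi> v) (P \<union> path_components (G \<restriction> W'))"

text \<open>The possible results of the procedure. \<open>C\<close> is the set of vertices selected on the removed
  paths, all of which get the final value of the color counter.\<close>

inductive elim_coloring :: "('v, 'e) pre_digraph \<Rightarrow> ('v \<rightharpoonup> nat) \<Rightarrow> bool" for G where
  "\<lbrakk> elim_reach G {} i \<chi> P; C \<subseteq> \<Union> P;
     \<forall>S \<in> P. \<forall>v \<in> S. \<exists>!w. w \<in> closed_nbhd (G \<restriction> S) v \<inter> C \<rbrakk>
    \<Longrightarrow> elim_coloring G (\<lambda>v. if v \<in> C then Some i else \<chi> v)"


section \<open>Programs and their running time\<close>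

text \<open>A structured random access machine. The memory consists of named two-dimensional tables of
  natural numbers; a scalar lives in cell \<open>(0, 0)\<close>. Every operation, including each node of an
  expression, takes one time unit. There is no multiplication: a time unit at most doubles the
  largest number in use, so numbers have at most linearly many bits in the running time and
  polynomial time here agrees with polynomial time on Turing machines.\<close>

type_synonym memory = "string \<Rightarrow> nat \<Rightarrow> nat \<Rightarrow> nat"

datatype exp =
    Lit nat
  | Cell string exp exp
  | Plus exp exp
  | Minus exp exp

datatype com =
    Skip
  | Assign string exp exp exp \<comment> \<open>\<open>Assign x a b e\<close> is \<open>x[a, b] := e\<close>\<close>
  | Seq com com
  | Cond exp com com \<comment> \<open>conditions hold iff their value is nonzero\<close>
  | While exp com

primrec eval_exp :: "exp \<Rightarrow> memory \<Rightarrow> nat" where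
  "eval_exp (Lit n) s = n"
| "eval_exp (Cell x a b) s = s x (eval_exp a s) (eval_exp b s)"
| "eval_exp (Plus a b) s = eval_exp a s + eval_exp b s"
| "eval_exp (Minus a b) s = eval_exp a s - eval_exp b s"

primrec exp_time :: "exp \<Rightarrow> nat" where
  "exp_time (Lit n) = 1"
| "exp_time (Cell x a b) = 1 + exp_time a + exp_time b"
| "exp_time (Plus a b) = 1 + exp_time a + exp_time b"
| "exp_time (Minus a b) = 1 + exp_time a + exp_time b"

text \<open>\<open>exec c s t s'\<close>: started in memory \<open>s\<close>, the program \<open>c\<close> halts after exactly \<open>t\<close> time units with
  memory \<open>s'\<close>.\<close>

inductive exec :: "com \<Rightarrow> memory \<Rightarrow> nat \<Rightarrow> memory \<Rightarrow> bool" where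
  Skip: "exec Skip s 1 s"
| Assign: "exec (Assign x a b e) s (1 + exp_time a + exp_time b + exp_time e)
    (s(x := (s x)(eval_exp a s := (s x (eval_exp a s))(eval_exp b s := eval_exp e s))))"
| Seq: "\<lbrakk> exec c\<^sub>1 s t\<^sub>1 s'; exec c\<^sub>2 s' t\<^sub>2 s'' \<rbrakk> \<Longrightarrow> exec (Seq c\<^sub>1 c\<^sub>2) s (1 + t\<^sub>1 + t\<^sub>2) s''"
| CondTrue: "\<lbrakk> eval_exp e s \<noteq> 0; exec c\<^sub>1 s t s' \<rbrakk> \<Longrightarrow> exec (Cond e c\<^sub>1 c\<^sub>2) s (1 + exp_time e + t) s'"
| CondFalse: "\<lbrakk> eval_exp e s = 0; exec c\<^sub>2 s t s' \<rbrakk> \<Longrightarrow> exec (Cond e c\<^sub>1 c\<^sub>2) s (1 + exp_time e + t) s'"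
| WhileFalse: "eval_exp e s = 0 \<Longrightarrow> exec (While e c) s (1 + exp_time e) s"
| WhileTrue: "\<lbrakk> eval_exp e s \<noteq> 0; exec c s t\<^sub>1 s'; exec (While e c) s' t\<^sub>2 s'' \<rbrakk>
    \<Longrightarrow> exec (While e c) s (1 + exp_time e + t\<^sub>1 + t\<^sub>2) s''"

text \<open>Input: the number of vertices in \<open>n\<close> and the adjacency matrix in \<open>adj\<close>, with respect to a
  numbering \<open>f\<close> of the vertices by \<open>0, 1, \<dots>\<close>; all other cells are 0.
  Output: the color of vertex number \<open>i\<close> in cell \<open>(i, 0)\<close> of \<open>color\<close>, where 0 means uncolored.\<close>

definition graph_input :: "('v, 'e) pre_digraph \<Rightarrow> ('v \<Rightarrow> nat) \<Rightarrow> memory" where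
  "graph_input G f = (\<lambda>x i j.
     if x = ''n'' \<and> i = 0 \<and> j = 0 then card (verts G)
     else if x = ''adj'' \<and> (\<exists>u v. u \<rightarrow>\<^bsub>G\<^esub> v \<and> f u = i \<and> f v = j) then 1
     else 0)"

definition coloring_output :: "('v, 'e) pre_digraph \<Rightarrow> ('v \<Rightarrow> nat) \<Rightarrow> memory \<Rightarrow> ('v \<rightharpoonup> nat)" where
  "coloring_output G f s = (\<lambda>v.
     if v \<in> verts G \<and> s ''color'' (f v) 0 \<noteq> 0 then Some (s ''color'' (f v) 0) else None)"

end

theory Submission
  imports Defs
begin

text \<open>
  If \<open>D\<close> is a distance-3 set of \<open>G \<restriction> W\<close>, then in each component the closed neighborhood \<open>N[D]\<close> is
  connected, because every new vertex of \<open>D\<close> is joined to an old one by a path of length 3 inside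
  \<open>N[D]\<close>, and every remaining vertex has a neighbor in \<open>N[D]\<close>. Contracting \<open>N[D]\<close> adds a
  universal vertex to any connected minor of the remaining graph, so each round turns the excluded
  minors for \<open>k\<close> into those for \<open>k - 1\<close>. For \<open>k = 1\<close>, excluding a triangle and a claw leaves only
  paths. Conflict-freeness holds since the vertices of \<open>D\<close> have pairwise disjoint closed
  neighborhoods and the final color is used on the path components only.

  The program uses only loops over all vertex numbers, so it denotes a total function on memories and
  its running time is polynomial by construction. A component is recognized as a path by a vertex from
  which all distances in the component are distinct; on a path with \<open>m\<close> vertices numbered \<open>1, \<dots>, m\<close>
  it selects the numbers congruent to 1 modulo 3 if \<open>m mod 3 = 1\<close> and to 2 otherwise.
\<close>

section \<open>Induced subgraphs and distances\<close>

text \<open>Contracting \<open>N[D]\<close> gives a universal vertex only inside one component, so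
  the smaller minor has to be connected. This is why the induction carries a hub, a branch set
  adjacent to all others: any vertex of a complete graph, but only a vertex off the deleted triangle
  in the other family. The excluded minors are tracked for the graph before its path components are
  removed; the base case then states that nothing survives the removal, which is what limits the
  color counter to \<open>k\<close>. The procedure is nondeterministic. Conflict-freeness is shown
  for every run, and the program only has to realize one of them. Distances occur as infima over
  walks in the procedure, as relation powers in the proofs and as table entries in the program. The
  function \<open>level\<close> mediates: 0 for unreachable, distance plus one otherwise.\<close>

definition (in pre_digraph) edges_on :: "'a set \<Rightarrow> 'a rel" where
  "edges_on W = {(u, v). u \<in> W \<and> v \<in> W \<and> u \<rightarrow>\<^bsub>G\<^esub> v}"

context graph
begin

lemma edges_on_mono: "W \<subseteq> W' \<Longrightarrow> edges_on W \<subseteq> edges_on W'"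
  by (auto simp: edges_on_def)

lemma sym_edges_on: "sym (edges_on W)"
  using graph_symmetric by (auto simp: edges_on_def sym_def)

lemma edges_on_sym: "(u, v) \<in> edges_on W \<Longrightarrow> (v, u) \<in> edges_on W"
  using sym_edges_on by (auto dest: symD)

lemma irrefl_edges_on: "(u, u) \<notin> edges_on W"
  using adj_not_same by (auto simp: edges_on_def)

lemma edges_on_rtrancl_sym: "(u, v) \<in> (edges_on W)\<^sup>* \<Longrightarrow> (v, u) \<in> (edges_on W)\<^sup>*"
  by (metis sym_edges_on sym_rtrancl symD)

lemma edges_on_rtrancl_in: "(u, v) \<in> (edges_on W)\<^sup>* \<Longrightarrow> u \<in> W \<longleftrightarrow> v \<in> W"
  by (induction rule: rtrancl_induct) (auto simp: edges_on_def)

lemma edges_on_rtrancl_mono: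
  "(u, v) \<in> (edges_on W)\<^sup>* \<Longrightarrow> W \<subseteq> W' \<Longrightarrow> (u, v) \<in> (edges_on W')\<^sup>*"
  by (meson edges_on_mono rtrancl_mono subsetD)

lemma dominates_induce_iff: "u \<rightarrow>\<^bsub>G \<restriction> W\<^esub> v \<longleftrightarrow> (u, v) \<in> edges_on W"
  by (auto simp: edges_on_def arcs_ends_conv)

lemma arcs_ends_induce: "arcs_ends (G \<restriction> W) = edges_on W"
  using dominates_induce_iff by auto

lemma wf_induce: "W \<subseteq> verts G \<Longrightarrow> wf_digraph (G \<restriction> W)"
  by auto

lemma reachable_induce_iff:
  "u \<rightarrow>\<^sup>*\<^bsub>G \<restriction> W\<^esub> v \<longleftrightarrow> u \<in> W \<and> (u, v) \<in> (edges_on W)\<^sup>*" if "W \<subseteq> verts G"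
  using wf_digraph.reachable_conv[OF wf_induce[OF that]] edges_on_rtrancl_in
  by (auto simp: arcs_ends_induce)

text \<open>\<open>connected\<close> is strong connectivity of the symmetric closure, and
  \<open>edges_on B\<close> is symmetric already, so symmetrizing changes nothing.\<close>

lemma connected_induce_iff:
  "connected (G \<restriction> B) \<longleftrightarrow> B \<noteq> {} \<and> (\<forall>u \<in> B. \<forall>v \<in> B. (u, v) \<in> (edges_on B)\<^sup>*)" if "B \<subseteq> verts G"
proof -
  have arcs: "parcs (mk_symmetric (G \<restriction> B)) = edges_on B"
    using edges_on_sym[of _ _ B]
    by (auto simp: mk_symmetric_def arcs_ends_induce[symmetric] arcs_ends_conv)
  have v: "pverts (mk_symmetric (G \<restriction> B)) = B"
    by (auto simp: mk_symmetric_def)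
  have "wf_digraph (with_proj (mk_symmetric (G \<restriction> B)))"
    by unfold_locales (auto simp: arcs v, auto simp: edges_on_def)
  then show ?thesis
    unfolding connected_def strongly_connected_def
    by (auto simp: wf_digraph.reachable_conv v arcs_ends_conv arcs)
qed

text \<open>For \<open>u\<close> outside \<open>W\<close> this is \<open>{u}\<close>, because the
  closure is reflexive; hence the hypotheses of the form \<open>u \<in> W\<close> below.\<close>

definition comp_of :: "'a set \<Rightarrow> 'a \<Rightarrow> 'a set" where
  "comp_of W u = {v. (u, v) \<in> (edges_on W)\<^sup>*}"

lemma sccs_verts_induce: "pre_digraph.sccs_verts (G \<restriction> W) = comp_of W ` W" if "W \<subseteq> verts G"
proof -
  have "pre_digraph.scc_of (G \<restriction> W) u = comp_of W u" if "u \<in> W" for u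
    using \<open>W \<subseteq> verts G\<close> that edges_on_rtrancl_sym edges_on_rtrancl_in
    by (auto simp: pre_digraph.scc_of_def comp_of_def reachable_induce_iff)
  then show ?thesis
    using wf_digraph.sccs_verts_conv_scc_of[OF wf_induce[OF that]] by auto
qed

lemma comp_of_eqI: "v \<in> comp_of W u \<Longrightarrow> comp_of W v = comp_of W u"
  using edges_on_rtrancl_sym by (auto simp: comp_of_def intro: rtrancl_trans)

lemma comp_of_refl: "u \<in> comp_of W u"
  by (simp add: comp_of_def)

lemma comp_of_subset: "u \<in> W \<Longrightarrow> comp_of W u \<subseteq> W"
  using edges_on_rtrancl_in by (auto simp: comp_of_def)

lemma comp_of_edge: "(u, v) \<in> edges_on W \<Longrightarrow> comp_of W u = comp_of W v"
  by (rule comp_of_eqI[symmetric]) (auto simp: comp_of_def)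

lemma edges_on_comp_of:
  "(u, v) \<in> edges_on (comp_of W a) \<longleftrightarrow> (u, v) \<in> edges_on W \<and> u \<in> comp_of W a" if "a \<in> W"
  using comp_of_subset[OF that] comp_of_edge[of u v W] comp_of_eqI comp_of_refl
  by (fastforce simp: edges_on_def)

lemma induce_self: "G \<restriction> verts G = G"
  by (rule pre_digraph.equality) auto

lemma induce_induce: "W \<subseteq> W' \<Longrightarrow> (G \<restriction> W') \<restriction> W = G \<restriction> W"
  by (auto simp: induce_subgraph_def)

text \<open>\<open>gdist\<close> is an infimum over walks made of arcs. This lemma replaces such
  walks by powers of \<open>edges_on W\<close>, the form in which distances are handled from here
  on.\<close>

lemma awalk_relpow:
  "(u, v) \<in> edges_on W ^^ k \<longleftrightarrow> (\<exists>p. pre_digraph.awalk (G \<restriction> W) u p v \<and> length p = k)"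
  if "W \<subseteq> verts G" "u \<in> W"
proof -
  interpret H: wf_digraph "G \<restriction> W"
    using that by (intro wf_induce)
  show ?thesis
    using that(2)
  proof (induction k arbitrary: u)
    case 0
    then show ?case by (auto simp: H.awalk_Nil_iff)
  next
    case (Suc k)
    have "(u, v) \<in> edges_on W ^^ Suc k \<longleftrightarrow> (\<exists>w. (u, w) \<in> edges_on W \<and> (w, v) \<in> edges_on W ^^ k)"
      by (meson relpow_Suc_D2 relpow_Suc_I2)
    also have "\<dots> \<longleftrightarrow> (\<exists>w p. u \<rightarrow>\<^bsub>G \<restriction> W\<^esub> w \<and> H.awalk w p v \<and> length p = k)"
      using Suc.IH by (auto simp: dominates_induce_iff edges_on_def)
    also have "\<dots> \<longleftrightarrow> (\<exists>p. H.awalk u p v \<and> length p = Suc k)"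
    proof safe
      fix w p assume "u \<rightarrow>\<^bsub>G \<restriction> W\<^esub> w" "H.awalk w p v"
      then show "\<exists>q. H.awalk u q v \<and> length q = Suc (length p)"
        by (elim reachableE) (metis H.awalk_Cons_iff length_Cons)
    next
      fix p assume "H.awalk u p v" "length p = Suc k"
      then show "\<exists>w p. u \<rightarrow>\<^bsub>G \<restriction> W\<^esub> w \<and> H.awalk w p v \<and> length p = k"
        by (cases p) (auto simp: H.awalk_Cons_iff arcs_ends_conv)
    qed
    finally show ?case .
  qed
qed

text \<open>Infinite distance needs no separate case: if there is no walk at all, both sides
  hold.\<close>

lemma gdist_ge_iff:
  assumes "W \<subseteq> verts G" "u \<in> W"
  shows "gdist (G \<restriction> W) u v \<ge> real m \<longleftrightarrow> (\<forall>k < m. (u, v) \<notin> edges_on W ^^ k)"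
proof -
  interpret H: wf_digraph "G \<restriction> W"
    using assms by (intro wf_induce)
  have cost: "awalk_cost (\<lambda>_. 1) p = real (length p)" for p :: "'b list"
    by (induction p) auto
  show ?thesis
    unfolding gdist_def H.\<mu>_def le_INF_iff awalk_relpow[OF assms] by (auto simp: cost) (metis linorder_not_less)
qed

lemma gdist_eq_iff:
  assumes "W \<subseteq> verts G" "u \<in> W"
  shows "gdist (G \<restriction> W) u v = real m \<longleftrightarrow>
    (u, v) \<in> edges_on W ^^ m \<and> (\<forall>k < m. (u, v) \<notin> edges_on W ^^ k)"
proof -
  interpret H: wf_digraph "G \<restriction> W"
    using assms by (intro wf_induce)
  have cost: "awalk_cost (\<lambda>_. 1) p = real (length p)" for p :: "'b list"
    by (induction p) auto
  have lower: "gdist (G \<restriction> W) u v \<le> real m" if "(u, v) \<in> edges_on W ^^ m"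
    using that awalk_relpow[OF assms, of v m] H.min_cost_le_walk_cost[of u _ v "\<lambda>_. 1"]
    by (auto simp: gdist_def cost)
  show ?thesis
  proof
    assume eq: "gdist (G \<restriction> W) u v = real m"
    then have "\<forall>k < m. (u, v) \<notin> edges_on W ^^ k"
      using gdist_ge_iff[OF assms, of m v] by simp
    moreover have "\<not> real (Suc m) \<le> gdist (G \<restriction> W) u v"
      using eq by simp
    ultimately show "(u, v) \<in> edges_on W ^^ m \<and> (\<forall>k < m. (u, v) \<notin> edges_on W ^^ k)"
      unfolding gdist_ge_iff[OF assms] by (auto simp: less_Suc_eq)
  next
    assume "(u, v) \<in> edges_on W ^^ m \<and> (\<forall>k < m. (u, v) \<notin> edges_on W ^^ k)"
    then show "gdist (G \<restriction> W) u v = real m"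
      using lower gdist_ge_iff[OF assms, of m v] by (intro antisym) auto
  qed
qed

text \<open>Distances in \<open>G \<restriction> W\<close> shifted by one, so that \<open>0\<close> can stand for unreachable, as in the tables
  of the program.\<close>

definition level :: "'a set \<Rightarrow> 'a \<Rightarrow> 'a \<Rightarrow> nat" where
  "level W u v = (if u \<in> W \<and> (u, v) \<in> (edges_on W)\<^sup>*
     then Suc (LEAST k. (u, v) \<in> edges_on W ^^ k) else 0)"

lemma level_eq_0_iff: "level W u v = 0 \<longleftrightarrow> \<not> (u \<in> W \<and> v \<in> comp_of W u)"
  by (auto simp: level_def comp_of_def)

lemma level_le_iff:
  assumes "u \<in> W"
  shows "0 < level W u v \<and> level W u v \<le> Suc m \<longleftrightarrow> (\<exists>k \<le> m. (u, v) \<in> edges_on W ^^ k)"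
proof (cases "(u, v) \<in> (edges_on W)\<^sup>*")
  case True
  then obtain k where "(u, v) \<in> edges_on W ^^ k"
    by (auto simp: rtrancl_power)
  then show ?thesis
    using assms True LeastI[of "\<lambda>k. (u, v) \<in> edges_on W ^^ k"]
      Least_le[of "\<lambda>k. (u, v) \<in> edges_on W ^^ k"]
    by (auto simp: level_def intro: le_trans)
next
  case False
  then show ?thesis
    by (auto simp: level_def rtrancl_power)
qed

lemma level_Suc_iff:
  assumes "u \<in> W"
  shows "level W u v = Suc m \<longleftrightarrow> (u, v) \<in> edges_on W ^^ m \<and> (\<forall>k < m. (u, v) \<notin> edges_on W ^^ k)"
proof (cases m)
  case 0
  then show ?thesis
    using level_le_iff[OF assms, of v 0] by auto
next
  case (Suc j)
  have "level W u v = Suc m \<longleftrightarrow> (0 < level W u v \<and> level W u v \<le> Suc m) \<and>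
      \<not> (0 < level W u v \<and> level W u v \<le> Suc j)"
    using Suc by auto
  then show ?thesis
    unfolding level_le_iff[OF assms] using Suc
    by (auto simp: less_Suc_eq_le le_Suc_eq simp del: relpow.simps)
qed

lemma level_eq_1_iff: "level W u v = 1 \<longleftrightarrow> u \<in> W \<and> u = v"
  using level_Suc_iff[of u W v 0] by (auto simp: level_def)

lemma level_zero_if_notin: "v \<notin> W \<Longrightarrow> level W u v = 0" "u \<notin> W \<Longrightarrow> level W u v = 0"
  using edges_on_rtrancl_in[of u v W] by (auto simp: level_def)

lemma level_eq_2_iff: "level W u v = 2 \<longleftrightarrow> (u, v) \<in> edges_on W"
proof (cases "u \<in> W")
  case True
  then show ?thesis
    using level_Suc_iff[OF True, of v 1] irrefl_edges_on[of v W] by (auto simp: numeral_2_eq_2)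
next
  case False
  then show ?thesis by (auto simp: level_def edges_on_def)
qed

lemma level_step:
  assumes "(v, w) \<in> edges_on W" "level W u v \<noteq> 0"
  shows "level W u w \<noteq> 0" "level W u w \<le> Suc (level W u v)"
proof -
  have u: "u \<in> W" using assms(2) level_zero_if_notin by metis
  obtain m where "level W u v = Suc m"
    using assms(2) not0_implies_Suc by blast
  moreover from this have "(u, w) \<in> edges_on W ^^ Suc m"
    using assms(1) level_Suc_iff[OF u, of v] by auto
  ultimately show "level W u w \<noteq> 0" "level W u w \<le> Suc (level W u v)"
    using level_le_iff[OF u, of w "Suc m"] by (auto simp del: relpow.simps)
qed

lemma level_pred:
  assumes "level W u v = Suc (Suc m)"
  obtains w where "(w, v) \<in> edges_on W" "level W u w = Suc m"
proof -
  have u: "u \<in> W" using assms level_zero_if_notin by (metis nat.distinct(1))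
  from assms obtain w where w: "(u, w) \<in> edges_on W ^^ m" "(w, v) \<in> edges_on W"
    using level_Suc_iff[OF u] by auto
  then have "0 < level W u w" "level W u w \<le> Suc m"
    using level_le_iff[OF u, of w m] by auto
  moreover have "Suc (Suc m) \<le> Suc (level W u w)"
    using level_step[OF w(2), of u] assms calculation by auto
  ultimately show ?thesis using that w by auto
qed

text \<open>The recursion of breadth-first search. It is exactly the rule by which the program fills
  its distance table, so the correctness of that table reduces to it.\<close>

lemma level_Suc_Suc_iff:
  "level W u v = Suc (Suc m) \<longleftrightarrow>
    \<not> (0 < level W u v \<and> level W u v \<le> Suc m) \<and> (\<exists>w. level W u w = Suc m \<and> (w, v) \<in> edges_on W)"
proof (intro iffI conjI, goal_cases)
  case 1
  then show ?case by simp
next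
  case 2
  then show ?case by (metis level_pred)
next
  case 3
  then obtain w where "level W u w = Suc m" "(w, v) \<in> edges_on W" by blast
  then show ?case using 3 level_step[of w v W u] by auto
qed

lemma level_sym: "level W u v = level W v u"
proof -
  have pow: "(u, v) \<in> edges_on W ^^ k \<Longrightarrow> (v, u) \<in> edges_on W ^^ k" for k u v
  proof (induction k arbitrary: u)
    case (Suc k)
    then show ?case
      using edges_on_sym by (metis relpow_Suc_D2 relpow_Suc_I)
  qed auto
  then have "(\<lambda>k. (u, v) \<in> edges_on W ^^ k) = (\<lambda>k. (v, u) \<in> edges_on W ^^ k)"
    by blast
  then show ?thesis
    using edges_on_rtrancl_sym[of u v W] edges_on_rtrancl_sym[of v u W] edges_on_rtrancl_in
    unfolding level_def by auto
qed

text \<open>A shortest walk passes through every smaller distance; the induction on the gap to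
  \<open>j\<close> steps back along \<open>level_pred\<close>.\<close>

lemma level_onto:
  assumes "0 < j" "j \<le> level W u v"
  shows "\<exists>w. level W u w = j"
  using assms
proof (induction "level W u v - j" arbitrary: v)
  case (Suc d)
  then obtain m where "level W u v = Suc (Suc m)"
    by (metis Suc_pred' diff_is_0_eq gr0_conv_Suc less_le_trans nat.distinct(1) not_less_eq_eq zero_less_Suc leI le_0_eq)
  then obtain w where "level W u w = Suc m"
    by (metis level_pred)
  then show ?case
    using Suc \<open>level W u v = Suc (Suc m)\<close> by (intro Suc.hyps(1)[of w]) auto
qed auto

text \<open>The values from 1 up to the level all occur, necessarily at different vertices. The
  bound shows that \<open>n\<close> passes of breadth-first search suffice.\<close>

lemma level_le_card:
  assumes "W \<subseteq> verts G"
  shows "level W u v \<le> card (verts G)"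
proof -
  have "{1..level W u v} \<subseteq> level W u ` verts G"
  proof
    fix j assume "j \<in> {1..level W u v}"
    then obtain w where "level W u w = j" "j \<noteq> 0"
      using level_onto[of j W u v] by auto
    moreover from this have "w \<in> verts G"
      using level_zero_if_notin(1)[of w W u] assms by auto
    ultimately show "j \<in> level W u ` verts G" by auto
  qed
  then have "card {1..level W u v} \<le> card (level W u ` verts G)"
    by (intro card_mono) auto
  then show ?thesis
    using card_image_le[of "verts G" "level W u"] by simp
qed

lemma closed_nbhd_induce:
  "closed_nbhd (G \<restriction> W) v = insert v {u. (v, u) \<in> edges_on W}"
  by (auto simp: closed_nbhd_def dominates_induce_iff)

lemma closed_nbhd_level: "v \<in> W \<Longrightarrow> u \<in> closed_nbhd (G \<restriction> W) v \<longleftrightarrow> 0 < level W v u \<and> level W v u \<le> 2"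
proof -
  assume v: "v \<in> W"
  have "0 < level W v u \<and> level W v u \<le> 2 \<longleftrightarrow> level W v u = 1 \<or> level W v u = 2" by linarith
  then show ?thesis
    using v unfolding level_eq_1_iff level_eq_2_iff closed_nbhd_induce by auto
qed

text \<open>The shift by one turns distance at most 2 into the levels 1 to 3; level 0 stands for
  infinite distance and therefore counts as far.\<close>

lemma gdist_ge_3_level:
  assumes "W \<subseteq> verts G" "u \<in> W"
  shows "gdist (G \<restriction> W) u v \<ge> 3 \<longleftrightarrow> \<not> (0 < level W u v \<and> level W u v \<le> 3)"
  using gdist_ge_iff[OF assms, of 3 v] level_le_iff[OF assms(2), of v 2]
  by (auto simp: less_Suc_eq_le numeral_3_eq_3 numeral_2_eq_2)

lemma gdist_eq_3_level:
  assumes "W \<subseteq> verts G" "u \<in> W"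
  shows "gdist (G \<restriction> W) u v = 3 \<longleftrightarrow> level W u v = 4"
  using gdist_eq_iff[OF assms, of v 3] level_Suc_iff[OF assms(2), of v 3] by auto

end

section \<open>Auxiliary facts on closures and on residues modulo 3\<close>

lemma rtrancl_leaves_set:
  assumes "(u, v) \<in> R\<^sup>*" "u \<in> A" "v \<notin> A"
  obtains x y where "x \<in> A" "y \<notin> A" "(x, y) \<in> R" "(u, y) \<in> R\<^sup>*"
proof -
  have "(u, v) \<in> R\<^sup>* \<Longrightarrow> v \<notin> A \<Longrightarrow> \<exists>x y. x \<in> A \<and> y \<notin> A \<and> (x, y) \<in> R \<and> (u, y) \<in> R\<^sup>*"
  proof (induction rule: rtrancl_induct)
    case base
    then show ?case using assms by blast
  next
    case (step y z)
    then show ?case by (meson rtrancl.rtrancl_into_rtrancl)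
  qed
  with assms that show ?thesis by blast
qed

text \<open>Of three consecutive numbers exactly one has the residue \<open>r\<close>. The choice of
  \<open>r\<close> makes sure that it is never one of the missing neighbors 0 and
  \<open>m + 1\<close> of the two ends: \<open>r\<close> is not 0, and \<open>m + 1\<close> has
  residue 2, 1 or 0 when \<open>m\<close> has residue 1, 0 or 2, which differs from \<open>r\<close>
  each time.\<close>

lemma ex1_mod_3_neighbor:
  fixes l m :: nat
  assumes "0 < l" "l \<le> m"
  shows "\<exists>!j. 0 < j \<and> j \<le> m \<and> (j = l \<or> j = Suc l \<or> l = Suc j) \<and>
    j mod 3 = (if m mod 3 = 1 then 1 else 2)"
proof -
  define r :: nat where "r = (if m mod 3 = 1 then 1 else 2)"
  obtain l' where l: "l = Suc l'"
    using assms(1) gr0_implies_Suc by blast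
  have r: "r = 1 \<or> r = 2"
    by (simp add: r_def)
  define x where "x = l' mod 3"
  have x: "l' mod 3 = x" "x = 0 \<or> x = 1 \<or> x = 2"
    unfolding x_def by linarith+
  then have sx: "Suc l' mod 3 = (if x = 2 then 0 else Suc x)"
      "Suc (Suc l') mod 3 = (if x = 2 then 1 else if x = 1 then 0 else Suc (Suc x))"
    by (auto simp: mod_Suc)
  obtain j where j: "j = l' \<or> j = Suc l' \<or> j = Suc (Suc l')" "j mod 3 = r"
    using r x(2)
  proof (elim disjE)
  qed (use x(1) sx that[of l'] that[of "Suc l'"] that[of "Suc (Suc l')"] in simp_all)
  have "0 < j"
    using j(2) by (cases j) (auto simp: r_def split: if_splits)
  moreover have "j \<le> m"
  proof (rule ccontr)
    assume "\<not> j \<le> m"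
    then have "j = Suc m"
      using j(1) l assms(2) by auto
    then show False
      using j(2) by (auto simp: r_def mod_Suc split: if_splits)
  qed
  moreover have "j' = j" if "j' = l' \<or> j' = Suc l' \<or> j' = Suc (Suc l')" "j' mod 3 = r" for j'
    using that j x sx by (elim disjE) simp_all
  ultimately show ?thesis
    unfolding l r_def[symmetric] using j by (metis nat.inject)
qed

context graph
begin

section \<open>Path components\<close>

text \<open>In contrast to \<open>is_path_graph\<close>, the list need not fill its component, so
  that one can speak of a longest induced path and of extending it.\<close>

definition induced_path :: "'a set \<Rightarrow> 'a list \<Rightarrow> bool" where
  "induced_path W p \<longleftrightarrow> p \<noteq> [] \<and> distinct p \<and> set p \<subseteq> W \<and>
     (\<forall>i < length p. \<forall>j < length p. (p ! i, p ! j) \<in> edges_on W \<longleftrightarrow> j = Suc i \<or> i = Suc j)"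

lemma is_path_graph_comp_of:
  assumes "a \<in> W"
  shows "is_path_graph (G \<restriction> comp_of W a) \<longleftrightarrow> (\<exists>p. induced_path W p \<and> set p = comp_of W a)"
proof -
  have "(p ! i, p ! j) \<in> edges_on (comp_of W a) \<longleftrightarrow> (p ! i, p ! j) \<in> edges_on W"
    if "set p = comp_of W a" "i < length p" "j < length p" for p i j
    using edges_on_comp_of[OF assms] that by (metis nth_mem)
  then show ?thesis
    using comp_of_subset[OF assms]
    unfolding is_path_graph_def induced_path_def dominates_induce_iff induce_subgraph_verts
    by (intro ex_cong1) auto
qed

text \<open>Each edge moves the position on the path by one, so \<open>k\<close> edges reach at most
  position \<open>k\<close>, while the path itself is a walk of the right length.\<close>

lemma level_induced_path:
  assumes p: "induced_path W p" "set p = comp_of W (p ! 0)" and i: "i < length p"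
  shows "level W (p ! 0) (p ! i) = Suc i"
proof -
  have adj: "(p ! i, p ! j) \<in> edges_on W \<longleftrightarrow> j = Suc i \<or> i = Suc j"
    if "i < length p" "j < length p" for i j
    using p that by (auto simp: induced_path_def)
  have in_W: "p ! 0 \<in> W"
    using p by (auto simp: induced_path_def)
  have "(p ! 0, p ! j) \<in> edges_on W ^^ j" if "j < length p" for j
    using that
  proof (induction j)
    case (Suc j)
    then show ?case using adj[of j "Suc j"] by (auto intro: relpow_Suc_I)
  qed auto
  moreover have "\<exists>j \<le> k. j < length p \<and> x = p ! j" if "(p ! 0, x) \<in> edges_on W ^^ k" for k x
    using that
  proof (induction k arbitrary: x)
    case 0
    then show ?case using i by auto
  next
    case (Suc k)
    then obtain y where y: "(p ! 0, y) \<in> edges_on W ^^ k" "(y, x) \<in> edges_on W"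
      by auto
    then obtain j where j: "j \<le> k" "j < length p" "y = p ! j"
      using Suc.IH by blast
    have "(p ! 0, x) \<in> (edges_on W)\<^sup>*"
      using y by (meson relpow_imp_rtrancl rtrancl.rtrancl_into_rtrancl)
    then have "x \<in> set p"
      using p(2) by (simp add: comp_of_def)
    then obtain j' where "j' < length p" "x = p ! j'"
      by (metis in_set_conv_nth)
    then have "j' \<le> Suc k"
      using adj[of j j'] j y(2) by auto
    then show ?case
      using \<open>j' < length p\<close> \<open>x = p ! j'\<close> by blast
  qed
  ultimately show ?thesis
    using i p(1) unfolding level_Suc_iff[OF in_W]
    by (metis induced_path_def leD nth_eq_iff_index_eq)
qed

lemma level_pos: "u \<in> W \<Longrightarrow> v \<in> comp_of W u \<Longrightarrow> 0 < level W u v"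
  using level_eq_0_iff[of W u v] by auto

text \<open>Levels differ by at most one along an edge, and by injectivity they do differ.
  Conversely a vertex has a predecessor one level lower, and injectivity identifies it with the
  given vertex.\<close>

lemma adjacent_iff_level:
  assumes "a \<in> W" "inj_on (level W a) (comp_of W a)" "u \<in> comp_of W a" "v \<in> comp_of W a"
  shows "(u, v) \<in> edges_on W \<longleftrightarrow>
    level W a v = Suc (level W a u) \<or> level W a u = Suc (level W a v)"
proof -
  have "level W a v = Suc (level W a u) \<or> level W a u = Suc (level W a v)"
    if "(u, v) \<in> edges_on W"
  proof -
    have "level W a u \<noteq> level W a v"
      using assms that irrefl_edges_on by (metis inj_onD)
    then show ?thesis
      using level_step(2)[OF that, of a] level_step(2)[OF edges_on_sym[OF that], of a]
        assms level_pos by fastforce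
  qed
  moreover have "(x, y) \<in> edges_on W"
    if y: "level W a y = Suc (level W a x)" and x: "x \<in> comp_of W a" for x y
  proof -
    obtain m where m: "level W a x = Suc m"
      using level_pos[OF assms(1) x] by (metis gr0_implies_Suc)
    with y obtain w where "(w, y) \<in> edges_on W" "level W a w = Suc m"
      by (metis level_pred)
    then show ?thesis
      using m x assms level_eq_0_iff by (metis inj_onD nat.distinct(1))
  qed
  ultimately show ?thesis
    using assms edges_on_sym by metis
qed

text \<open>The levels in a component fill an interval starting at 1; listing the vertices by level
  gives the path, with edges determined by \<open>adjacent_iff_level\<close>.\<close>

lemma inj_level_induced_path:
  assumes W: "W \<subseteq> verts G" and a: "a \<in> W" and inj: "inj_on (level W a) (comp_of W a)"
  shows "\<exists>p. induced_path W p \<and> set p = comp_of W a"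
proof -
  let ?S = "comp_of W a" and ?l = "level W a"
  have fin: "finite ?S"
    using comp_of_subset[OF a] W finite_verts by (meson finite_subset)
  define m where "m = Max (?l ` ?S)"
  have "m \<in> ?l ` ?S"
    unfolding m_def using fin comp_of_refl by (intro Max_in) auto
  then obtain t where t: "t \<in> ?S" "?l t = m" by auto
  have img: "?l ` ?S = {1..m}"
  proof
    show "?l ` ?S \<subseteq> {1..m}"
      using level_pos[OF a] fin by (auto simp: m_def Suc_le_eq)
    show "{1..m} \<subseteq> ?l ` ?S"
    proof
      fix j assume j: "j \<in> {1..m}"
      then obtain w where "?l w = j"
        using level_onto[of j W a t] t by auto
      then show "j \<in> ?l ` ?S"
        using j level_eq_0_iff[of W a w] by auto
    qed
  qed
  have "m \<noteq> 0"
    using t level_pos[OF a] by fastforce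
  define g where "g = inv_into ?S ?l"
  define p where "p = map (\<lambda>j. g (Suc j)) [0..<m]"
  have g: "g j \<in> ?S" "?l (g j) = j" if "0 < j" "j \<le> m" for j
    using that img unfolding g_def
    by (metis Suc_le_eq One_nat_def atLeastAtMost_iff inv_into_into,
        metis Suc_le_eq One_nat_def atLeastAtMost_iff f_inv_into_f)
  have p: "length p = m" "\<And>i. i < m \<Longrightarrow> p ! i = g (Suc i)"
    by (auto simp: p_def)
  have "distinct p"
    unfolding distinct_conv_nth using p g by (metis Suc_leI nat.inject zero_less_Suc)
  moreover have "set p = ?S"
  proof
    show "set p \<subseteq> ?S"
      using g by (auto simp: p_def)
    show "?S \<subseteq> set p"
    proof
      fix v assume v: "v \<in> ?S"
      then have "?l v \<in> {1..m}" using img by blast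
      then obtain j where j: "?l v = Suc j" "j < m"
        by (cases "?l v") auto
      then have "g (Suc j) = v"
        using g[of "Suc j"] v inj by (metis Suc_leI inj_onD zero_less_Suc)
      then show "v \<in> set p"
        using j p by (metis nth_mem)
    qed
  qed
  moreover have "p \<noteq> []"
    using \<open>m \<noteq> 0\<close> p by auto
  moreover have "(p ! i, p ! j) \<in> edges_on W \<longleftrightarrow> j = Suc i \<or> i = Suc j"
    if "i < length p" "j < length p" for i j
    using that g p adjacent_iff_level[OF a inj, of "p ! i" "p ! j"] by auto
  ultimately show ?thesis
    using comp_of_subset[OF a] unfolding induced_path_def by blast
qed

text \<open>A criterion that a program can test: instead of a list of vertices only a start vertex
  \<open>a\<close> is guessed, which will be an end of the path.\<close>

lemma path_components_induce:
  assumes W: "W \<subseteq> verts G"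
  shows "path_components (G \<restriction> W) = {comp_of W a |a. a \<in> W \<and> inj_on (level W a) (comp_of W a)}"
proof -
  have "is_path_graph ((G \<restriction> W) \<restriction> comp_of W a) \<longleftrightarrow> (\<exists>p. induced_path W p \<and> set p = comp_of W a)"
    if "a \<in> W" for a
    using is_path_graph_comp_of[OF that] induce_induce[OF comp_of_subset[OF that]] by simp
  then have eq: "path_components (G \<restriction> W) =
      {comp_of W a |a. a \<in> W \<and> (\<exists>p. induced_path W p \<and> set p = comp_of W a)}"
    using sccs_verts_induce[OF W] unfolding path_components_def by auto
  have "\<exists>b \<in> W. comp_of W a = comp_of W b \<and> inj_on (level W b) (comp_of W b)"
    if "a \<in> W" "induced_path W p" "set p = comp_of W a" for a p
  proof -
    \<comment> \<open>The given \<open>a\<close> may be an inner vertex of the path, from which two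
      vertices can have equal distance; the witness is the end \<open>p ! 0\<close> instead.\<close>
    have "p ! 0 \<in> comp_of W a"
      using that by (metis induced_path_def length_greater_0_conv nth_mem)
    then have comp: "comp_of W (p ! 0) = comp_of W a"
      by (rule comp_of_eqI)
    have "inj_on (level W (p ! 0)) (set p)"
      using level_induced_path[OF that(2)] that comp
      by (intro inj_onI) (metis in_set_conv_nth nat.inject)
    then show ?thesis
      using that comp comp_of_subset[OF that(1)] \<open>p ! 0 \<in> comp_of W a\<close> by auto
  qed
  then show ?thesis
    unfolding eq using inj_level_induced_path[OF W] by blast
qed

text \<open>Levels serve as positions on the path, so a closed neighborhood becomes a set of up to
  three consecutive numbers and \<open>ex1_mod_3_neighbor\<close> applies. The vertex
  \<open>t\<close> guarantees that every position up to \<open>m\<close> is occupied.\<close>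

lemma path_component_selection:
  assumes a: "a \<in> W" and inj: "inj_on (level W a) (comp_of W a)"
    and m: "\<And>v. level W a v \<le> m" "level W a t = m"
    and C: "\<And>v. v \<in> comp_of W a \<Longrightarrow>
      v \<in> C \<longleftrightarrow> level W a v mod 3 = (if m mod 3 = 1 then 1 else 2)"
    and v: "v \<in> comp_of W a"
  shows "\<exists>!w. w \<in> closed_nbhd (G \<restriction> comp_of W a) v \<inter> C"
proof -
  let ?l = "level W a"
  have nbhd: "w \<in> closed_nbhd (G \<restriction> comp_of W a) v \<longleftrightarrow>
      w \<in> comp_of W a \<and> (?l w = ?l v \<or> ?l w = Suc (?l v) \<or> ?l v = Suc (?l w))" for w
  proof -
    have "w \<in> closed_nbhd (G \<restriction> comp_of W a) v \<longleftrightarrow> w \<in> comp_of W a \<and> (w = v \<or> (v, w) \<in> edges_on W)"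
      using v edges_on_comp_of[OF a] comp_of_edge[of v w W]
        comp_of_eqI[OF v] comp_of_refl[of w W] by (auto simp: closed_nbhd_induce)
    then show ?thesis
      using adjacent_iff_level[OF a inj v] inj v by (metis inj_onD)
  qed
  have "0 < ?l v"
    using level_pos[OF a v] .
  define Q where "Q j \<longleftrightarrow> 0 < j \<and> j \<le> m \<and> (j = ?l v \<or> j = Suc (?l v) \<or> ?l v = Suc j) \<and>
    j mod 3 = (if m mod 3 = 1 then 1 else 2)" for j
  have "\<exists>!j. Q j"
    using ex1_mod_3_neighbor[of "?l v" m] m(1)[of v] \<open>0 < ?l v\<close> unfolding Q_def by blast
  then obtain j where "Q j" and uniq: "\<forall>j'. Q j' \<longrightarrow> j' = j"
    unfolding Ex1_def by auto
  from \<open>Q j\<close> have j: "0 < j" "j \<le> m" "j = ?l v \<or> j = Suc (?l v) \<or> ?l v = Suc j"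
      "j mod 3 = (if m mod 3 = 1 then 1 else 2)"
    unfolding Q_def by blast+
  obtain w where w: "?l w = j"
    using level_onto[of j W a t] j m(2) by auto
  then have w_in: "w \<in> comp_of W a"
    using level_eq_0_iff[of W a w] j(1) by auto
  show ?thesis
  proof (rule ex1I[of _ w])
    show "w \<in> closed_nbhd (G \<restriction> comp_of W a) v \<inter> C"
      using nbhd C w w_in j by auto
  next
    fix w' assume "w' \<in> closed_nbhd (G \<restriction> comp_of W a) v \<inter> C"
    then have "w' \<in> comp_of W a" "Q (?l w')"
      using nbhd[of w'] C[of w'] level_pos[OF a, of w'] m(1)[of w'] unfolding Q_def by blast+
    then have "w' \<in> comp_of W a" "?l w' = j"
      using uniq by blast+
    then show "w' = w"
      using w w_in inj by (metis inj_onD)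
  qed
qed

section \<open>Distance-3 sets\<close>

abbreviation nbhd_of_set :: "'a set \<Rightarrow> 'a set \<Rightarrow> 'a set" where
  "nbhd_of_set W D \<equiv> \<Union>v \<in> D. closed_nbhd (G \<restriction> W) v"

text \<open>One induction proves all four facts, since \<open>D \<subseteq> W\<close> is needed to
  translate \<open>gdist\<close> into levels in the step. The second fact makes the closed
  neighborhoods of \<open>D\<close> disjoint, for conflict-freeness; the fourth connects
  \<open>D\<close> inside \<open>N[D]\<close> within each component, for the contraction.\<close>

lemma dist3_partial_props:
  assumes "dist3_partial (G \<restriction> W) D" and W: "W \<subseteq> verts G"
  shows "D \<subseteq> W"
    and "u \<in> D \<Longrightarrow> v \<in> D \<Longrightarrow> u \<noteq> v \<Longrightarrow> \<not> (0 < level W u v \<and> level W u v \<le> 3)"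
    and "w \<in> W \<Longrightarrow> \<exists>u \<in> D. w \<in> comp_of W u"
    and "x \<in> D \<Longrightarrow> y \<in> D \<Longrightarrow> y \<in> comp_of W x \<Longrightarrow> (x, y) \<in> (edges_on (nbhd_of_set W D))\<^sup>*"
proof -
  have "D \<subseteq> W \<and>
    (\<forall>u \<in> D. \<forall>v \<in> D. u \<noteq> v \<longrightarrow> \<not> (0 < level W u v \<and> level W u v \<le> 3)) \<and>
    (\<forall>w \<in> W. \<exists>u \<in> D. w \<in> comp_of W u) \<and>
    (\<forall>x \<in> D. \<forall>y \<in> D. y \<in> comp_of W x \<longrightarrow> (x, y) \<in> (edges_on (nbhd_of_set W D))\<^sup>*)"
    using assms(1)
  proof induction
    case (init D)
    have D: "D \<subseteq> W" using init by simp
    have ex1: "\<exists>!v. v \<in> D \<inter> comp_of W w" if "w \<in> W" for w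
      using init that sccs_verts_induce[OF W] by auto
    have eq: "u = v" if "u \<in> D" "v \<in> D" "v \<in> comp_of W u" for u v
      using ex1[of u] that D comp_of_refl[of u W] by auto
    have "\<exists>u \<in> D. w \<in> comp_of W u" if "w \<in> W" for w
      using ex1[OF that] comp_of_eqI comp_of_refl by (metis Int_iff)
    moreover have "\<not> (0 < level W u v \<and> level W u v \<le> 3)" if "u \<in> D" "v \<in> D" "u \<noteq> v" for u v
      using eq[of u v] that level_eq_0_iff[of W u v] by auto
    ultimately show ?case
      using D eq by blast
  next
    case (add D v)
    have D: "D \<subseteq> W" using add.IH by blast
    have v: "v \<in> W" using add.hyps by simp
    have far: "\<not> (0 < level W u v \<and> level W u v \<le> 3)" if "u \<in> D" for u
      using add.hyps(3) that D gdist_ge_3_level[OF W] by blast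
    obtain u where u: "u \<in> D" "level W u v = 4"
      using add.hyps(4) D gdist_eq_3_level[OF W] by blast
    let ?N = "nbhd_of_set W (insert v D)"
    have NW: "nbhd_of_set W D \<subseteq> ?N" by auto
    have old: "(x, y) \<in> (edges_on ?N)\<^sup>*" if "x \<in> D" "y \<in> D" "y \<in> comp_of W x" for x y
      using add.IH that edges_on_rtrancl_mono[OF _ NW] by blast
    have uv: "(u, v) \<in> (edges_on ?N)\<^sup>*"
    proof -
      \<comment> \<open>Level 4 means distance 3. On a shortest path \<open>u\<close>,
        \<open>a\<close>, \<open>b\<close>, \<open>v\<close> the vertex \<open>a\<close> belongs to
        the closed neighborhood of \<open>u\<close> and \<open>b\<close> to that of
        \<open>v\<close>, so the path stays inside \<open>?N\<close>.\<close>
      obtain b where b: "(b, v) \<in> edges_on W" "level W u b = Suc 2"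
        using level_pred[of W u v 2] u by auto
      then obtain a where a: "(a, b) \<in> edges_on W" "level W u a = Suc 1"
        using level_pred[of W u b 1] by (metis Suc_1)
      have ua: "(u, a) \<in> edges_on W"
        using a level_eq_2_iff by (simp add: numeral_2_eq_2)
      have "a \<in> ?N" "b \<in> ?N" "u \<in> ?N" "v \<in> ?N"
        using u ua edges_on_sym[OF b(1)] by (auto simp: closed_nbhd_induce)
      then have "(u, a) \<in> edges_on ?N" "(a, b) \<in> edges_on ?N" "(b, v) \<in> edges_on ?N"
        using ua a b unfolding edges_on_def by auto
      then show ?thesis
        by (meson converse_rtrancl_into_rtrancl r_into_rtrancl)
    qed
    have v_u: "v \<in> comp_of W u"
      using u level_eq_0_iff[of W u v] by auto
    have to_v: "(x, v) \<in> (edges_on ?N)\<^sup>*" if "x \<in> D" "v \<in> comp_of W x" for x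
    proof -
      have "u \<in> comp_of W x"
        using v_u that comp_of_eqI comp_of_refl by metis
      then show ?thesis
        using old[of x u] that u uv by (meson rtrancl_trans)
    qed
    have "(x, y) \<in> (edges_on ?N)\<^sup>*"
      if "x \<in> insert v D" "y \<in> insert v D" "y \<in> comp_of W x" for x y
    proof -
      have "x \<in> comp_of W y"
        using that comp_of_eqI comp_of_refl by metis
      then show ?thesis
        using that old to_v edges_on_rtrancl_sym by blast
    qed
    moreover have "\<not> (0 < level W x y \<and> level W x y \<le> 3)"
      if "x \<in> insert v D" "y \<in> insert v D" "x \<noteq> y" for x y
      using that add.IH far level_sym[of W x y] by (metis insertE)
    moreover have "\<exists>u \<in> insert v D. w \<in> comp_of W u" if "w \<in> W" for w
      using add.IH that by blast
    ultimately show ?case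
      using D v by blast
  qed
  then show "D \<subseteq> W"
    and "u \<in> D \<Longrightarrow> v \<in> D \<Longrightarrow> u \<noteq> v \<Longrightarrow> \<not> (0 < level W u v \<and> level W u v \<le> 3)"
    and "w \<in> W \<Longrightarrow> \<exists>u \<in> D. w \<in> comp_of W u"
    and "x \<in> D \<Longrightarrow> y \<in> D \<Longrightarrow> y \<in> comp_of W x \<Longrightarrow> (x, y) \<in> (edges_on (nbhd_of_set W D))\<^sup>*"
    by blast+
qed

lemma dist3_set_level:
  assumes "dist3_set (G \<restriction> W) D" and W: "W \<subseteq> verts G" and "w \<in> W"
  shows "\<exists>u \<in> D. 0 < level W u w \<and> level W u w \<le> 3"
proof -
  have "D \<subseteq> W"
    using dist3_partial_props(1) assms by (auto simp: dist3_set_def)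
  moreover obtain u where "u \<in> D" "\<not> gdist (G \<restriction> W) u w \<ge> 3"
    using assms unfolding dist3_set_def by auto
  ultimately show ?thesis
    using gdist_ge_3_level[OF W] by blast
qed

section \<open>Minors\<close>

text \<open>The pattern \<open>H\<close> is a relation on all numbers of which the part below
  \<open>n\<close> counts. Thus a single relation describes the complete graphs of all sizes, and
  adding a vertex to the pattern changes only \<open>n\<close>. Connectivity refers to the branch
  set alone, which makes monotonicity in \<open>W\<close> immediate.\<close>

definition minor_in :: "nat \<Rightarrow> nat rel \<Rightarrow> 'a set \<Rightarrow> bool" where
  "minor_in n H W \<longleftrightarrow> (\<exists>B.
     (\<forall>x < n. B x \<subseteq> W \<and> B x \<noteq> {} \<and> (\<forall>u \<in> B x. \<forall>v \<in> B x. (u, v) \<in> (edges_on (B x))\<^sup>*)) \<and>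
     (\<forall>x < n. \<forall>y < n. x \<noteq> y \<longrightarrow> B x \<inter> B y = {}) \<and>
     (\<forall>x < n. \<forall>y < n. (x, y) \<in> H \<longrightarrow> (\<exists>u \<in> B x. \<exists>v \<in> B y. u \<rightarrow>\<^bsub>G\<^esub> v)))"

lemma is_minor_iff_minor_in:
  assumes "verts K = {..<n}" "\<And>x y. x \<rightarrow>\<^bsub>K\<^esub> y \<longleftrightarrow> x < n \<and> y < n \<and> (x, y) \<in> H"
  shows "is_minor K G \<longleftrightarrow> minor_in n H (verts G)"
proof -
  have conn: "B \<subseteq> verts G \<and> connected (G \<restriction> B) \<longleftrightarrow>
      B \<subseteq> verts G \<and> B \<noteq> {} \<and> (\<forall>u \<in> B. \<forall>v \<in> B. (u, v) \<in> (edges_on B)\<^sup>*)" for B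
    using connected_induce_iff by blast
  have "(\<forall>x y. x \<rightarrow>\<^bsub>K\<^esub> y \<longrightarrow> R x y) \<longleftrightarrow> (\<forall>x < n. \<forall>y < n. (x, y) \<in> H \<longrightarrow> R x y)" for R
    unfolding assms by blast
  then show ?thesis
    unfolding is_minor_def minor_in_def assms(1) conn by (simp only: Ball_def lessThan_iff)
qed

lemma minor_in_mono:
  assumes "minor_in n H W" "W \<subseteq> W'"
  shows "minor_in n H W'"
proof -
  obtain B where
     "(\<forall>x < n. B x \<subseteq> W \<and> B x \<noteq> {} \<and> (\<forall>u \<in> B x. \<forall>v \<in> B x. (u, v) \<in> (edges_on (B x))\<^sup>*)) \<and>
      (\<forall>x < n. \<forall>y < n. x \<noteq> y \<longrightarrow> B x \<inter> B y = {}) \<and>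
      (\<forall>x < n. \<forall>y < n. (x, y) \<in> H \<longrightarrow> (\<exists>u \<in> B x. \<exists>v \<in> B y. u \<rightarrow>\<^bsub>G\<^esub> v))"
    using assms(1) unfolding minor_in_def by (rule exE)
  then show ?thesis
    unfolding minor_in_def using order_trans[OF _ assms(2)] by (intro exI[of _ B]) simp
qed

lemma is_minor_complete_graph:
  "is_minor (complete_graph n) G \<longleftrightarrow> minor_in n {(i, j). i \<noteq> j} (verts G)"
  by (rule is_minor_iff_minor_in) (auto simp: complete_graph_def arcs_ends_conv)

lemma is_minor_complete_graph_minus_triangle:
  "is_minor (complete_graph_minus_triangle n) G \<longleftrightarrow>
    minor_in n ({(i, j). i \<noteq> j} - {0, 1, 2} \<times> {0, 1, 2}) (verts G)"
  by (rule is_minor_iff_minor_in) (auto simp: complete_graph_minus_triangle_def arcs_ends_conv)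

text \<open>The new branch set is the part of \<open>N[D]\<close> in the component containing the old branch sets,
  which all meet the branch set of the hub \<open>c\<close>.\<close>

lemma minor_in_apex:
  assumes W: "W \<subseteq> verts G" and D: "dist3_set (G \<restriction> W) D"
    and minor: "minor_in n H (W - nbhd_of_set W D)"
    and hub: "c < n" "\<And>x. x < n \<Longrightarrow> x \<noteq> c \<Longrightarrow> (c, x) \<in> H"
    and H': "\<And>x y. x < n \<Longrightarrow> y < n \<Longrightarrow> (x, y) \<in> H' \<Longrightarrow> (x, y) \<in> H" "(n, n) \<notin> H'"
  shows "minor_in (Suc n) H' W"
proof -
  let ?N = "nbhd_of_set W D"
  have partial: "dist3_partial (G \<restriction> W) D"
    using D by (simp add: dist3_set_def)
  note props = dist3_partial_props[OF partial W]
  have NW: "?N \<subseteq> W"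
    using props(1) by (auto simp: closed_nbhd_induce edges_on_def)
  obtain B where raw:
     "(\<forall>x < n. B x \<subseteq> W - ?N \<and> B x \<noteq> {} \<and> (\<forall>u \<in> B x. \<forall>v \<in> B x. (u, v) \<in> (edges_on (B x))\<^sup>*)) \<and>
      (\<forall>x < n. \<forall>y < n. x \<noteq> y \<longrightarrow> B x \<inter> B y = {}) \<and>
      (\<forall>x < n. \<forall>y < n. (x, y) \<in> H \<longrightarrow> (\<exists>u \<in> B x. \<exists>v \<in> B y. u \<rightarrow>\<^bsub>G\<^esub> v))"
    using minor unfolding minor_in_def by (rule exE)
  then have B: "\<And>x. x < n \<Longrightarrow> B x \<subseteq> W - ?N" "\<And>x. x < n \<Longrightarrow> B x \<noteq> {}"
      "\<And>x u v. x < n \<Longrightarrow> u \<in> B x \<Longrightarrow> v \<in> B x \<Longrightarrow> (u, v) \<in> (edges_on (B x))\<^sup>*"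
    and disj: "\<And>x y. x < n \<Longrightarrow> y < n \<Longrightarrow> x \<noteq> y \<Longrightarrow> B x \<inter> B y = {}"
    and adj: "\<And>x y. x < n \<Longrightarrow> y < n \<Longrightarrow> (x, y) \<in> H \<Longrightarrow> \<exists>u \<in> B x. \<exists>v \<in> B y. u \<rightarrow>\<^bsub>G\<^esub> v"
    by simp_all
  obtain a where a: "a \<in> B c"
    using B(2) hub(1) by blast
  have a_W: "a \<in> W" using a B(1) hub(1) by blast
  define S where "S = comp_of W a"
  have in_comp: "v \<in> comp_of W u" if "x < n" "u \<in> B x" "v \<in> B x" for u v x
    using B(3)[OF that] edges_on_rtrancl_mono[of u v "B x" W] B(1)[OF that(1)]
    by (auto simp: comp_of_def)
  have B_S: "B x \<subseteq> S" if x: "x < n" for x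
  proof (cases "x = c")
    case True
    then show ?thesis using in_comp[OF hub(1) a] by (auto simp: S_def)
  next
    case False
    then obtain u v where uv: "u \<in> B c" "v \<in> B x" "u \<rightarrow>\<^bsub>G\<^esub> v"
      using adj[OF hub(1) x] hub(2)[OF x] by blast
    then have "(u, v) \<in> edges_on W"
      using B(1)[OF x] B(1)[OF hub(1)] by (auto simp: edges_on_def)
    then have "comp_of W v = comp_of W u"
      using comp_of_edge by metis
    also have "\<dots> = S"
      using comp_of_eqI[OF in_comp[OF hub(1) a uv(1)]] by (simp add: S_def)
    finally show ?thesis using in_comp[OF x uv(2)] by blast
  qed
  define A where "A = ?N \<inter> S"
  have D_N: "D \<subseteq> ?N" by (auto simp: closed_nbhd_def)
  have S_closed: "v \<in> S" if "u \<in> S" "(u, v) \<in> edges_on W" for u v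
    using that by (auto simp: S_def comp_of_def intro: rtrancl_into_rtrancl)
  \<comment> \<open>\<open>S\<close> is closed under the edges of \<open>W\<close>, so a walk in
    \<open>N[D]\<close> that starts in \<open>S\<close> stays in \<open>A\<close>.\<close>
  have lift: "(u, v) \<in> (edges_on A)\<^sup>*" if "(u, v) \<in> (edges_on ?N)\<^sup>*" "u \<in> S" for u v
  proof -
    from that(1) have "(u, v) \<in> (edges_on A)\<^sup>* \<and> v \<in> S"
    proof (induction rule: rtrancl_induct)
      case base
      then show ?case using that(2) by simp
    next
      case (step y z)
      then have "z \<in> S"
        using S_closed edges_on_mono[OF NW] by blast
      then have "(y, z) \<in> edges_on A"
        using step by (simp add: edges_on_def A_def)
      then show ?case using step.IH \<open>z \<in> S\<close> by (auto intro: rtrancl_into_rtrancl)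
    qed
    then show ?thesis by blast
  qed
  have to_D: "\<exists>d \<in> D. d \<in> S \<and> (d, u) \<in> (edges_on A)\<^sup>*" if u: "u \<in> A" for u
  proof -
    obtain d where d: "d \<in> D" "u = d \<or> (d, u) \<in> edges_on W"
      using u by (auto simp: A_def closed_nbhd_induce)
    then have dS: "d \<in> S"
      using that S_closed edges_on_sym by (auto simp: A_def)
    then have "u = d \<or> (d, u) \<in> edges_on A"
      using d that D_N by (auto simp: A_def edges_on_def)
    then show ?thesis using d dS by auto
  qed
  have A_conn: "(u, v) \<in> (edges_on A)\<^sup>*" if uv: "u \<in> A" "v \<in> A" for u v
  proof -
    obtain d e where d: "d \<in> D" "d \<in> S" "(d, u) \<in> (edges_on A)\<^sup>*"
      and e: "e \<in> D" "e \<in> S" "(e, v) \<in> (edges_on A)\<^sup>*"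
      using to_D uv by metis
    have "e \<in> comp_of W d"
      using d(2) e(2) comp_of_eqI by (metis S_def)
    then have "(d, e) \<in> (edges_on A)\<^sup>*"
      using props(4)[of d e] lift d e by blast
    then show ?thesis
      using d e edges_on_rtrancl_sym by (meson rtrancl_trans)
  qed
  \<comment> \<open>A vertex outside \<open>N[D]\<close> has level exactly 3 from some
    \<open>d\<close>, that is, distance 2; its predecessor on a shortest path is then a neighbor of
    \<open>d\<close>.\<close>
  have A_adj: "\<exists>u \<in> A. \<exists>v \<in> B x. u \<rightarrow>\<^bsub>G\<^esub> v" if x: "x < n" for x
  proof -
    obtain v where v: "v \<in> B x" using B(2)[OF x] by blast
    then have v': "v \<in> W" "v \<notin> ?N" "v \<in> S"
      using B(1)[OF x] B_S[OF x] by blast+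
    obtain d where d: "d \<in> D" "0 < level W d v" "level W d v \<le> 3"
      using dist3_set_level[OF D W v'(1)] by blast
    moreover have "\<not> (0 < level W d v \<and> level W d v \<le> 2)"
      using v'(2) d(1) closed_nbhd_level[of d W v] props(1) by blast
    ultimately have "level W d v = Suc (Suc 1)" by simp
    then obtain w where w: "(w, v) \<in> edges_on W" "level W d w = Suc 1"
      using level_pred by blast
    then have "(d, w) \<in> edges_on W"
      using level_eq_2_iff by (simp add: numeral_2_eq_2)
    then have "w \<in> ?N"
      using d(1) by (auto simp: closed_nbhd_induce)
    moreover have "w \<in> S"
      using w v'(3) edges_on_sym S_closed by blast
    ultimately show ?thesis
      using w v by (auto simp: A_def edges_on_def)
  qed
  have A_ne: "A \<noteq> {}"
    using A_adj[OF hub(1)] by blast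
  \<comment> \<open>The new branch set gets the number \<open>n\<close>, so the old vertices, in
    particular the deleted triangle on 0, 1, 2, keep their numbers.\<close>
  show ?thesis
    unfolding minor_in_def
  proof (intro exI[of _ "B(n := A)"] conjI allI impI)
    fix x assume "x < Suc n"
    then show "(B(n := A)) x \<subseteq> W" "(B(n := A)) x \<noteq> {}"
      using B(1,2)[of x] A_ne NW by (auto simp: A_def less_Suc_eq)
  next
    fix x assume "x < Suc n"
    then show "\<forall>u \<in> (B(n := A)) x. \<forall>v \<in> (B(n := A)) x. (u, v) \<in> (edges_on ((B(n := A)) x))\<^sup>*"
      using B(3)[of x] A_conn by (auto simp: less_Suc_eq)
  next
    fix x y assume "x < Suc n" "y < Suc n" "x \<noteq> y"
    then show "(B(n := A)) x \<inter> (B(n := A)) y = {}"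
      using disj[of x y] B(1)[of x] B(1)[of y] by (auto simp: A_def less_Suc_eq)
  next
    fix x y assume xy: "x < Suc n" "y < Suc n" "(x, y) \<in> H'"
    then consider "x < n" "y < n" | "x = n" "y < n" | "x < n" "y = n"
      using H'(2) by (auto simp: less_Suc_eq)
    then show "\<exists>u \<in> (B(n := A)) x. \<exists>v \<in> (B(n := A)) y. u \<rightarrow>\<^bsub>G\<^esub> v"
    proof cases
      case 1
      then show ?thesis using adj H'(1) xy by auto
    next
      case 2
      then show ?thesis using A_adj by auto
    next
      case 3
      then show ?thesis using A_adj[of x] graph_symmetric by fastforce
    qed
  qed
qed

section \<open>The base case: excluding triangle and claw, and counting the rounds\<close>

abbreviation complete_minor :: "nat \<Rightarrow> 'a set \<Rightarrow> bool" where
  "complete_minor n \<equiv> minor_in n {(i, j). i \<noteq> j}"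

abbreviation complete_minus_triangle_minor :: "nat \<Rightarrow> 'a set \<Rightarrow> bool" where
  "complete_minus_triangle_minor n \<equiv> minor_in n ({(i, j). i \<noteq> j} - {0, 1, 2} \<times> {0, 1, 2})"

text \<open>A second neighbor \<open>p ! j\<close> of \<open>v\<close> on the path would close a
  cycle: \<open>{v}\<close>, \<open>{p ! 0}\<close> and the segment from \<open>p ! 1\<close> to
  \<open>p ! j\<close> would be the branch sets of a triangle.\<close>

lemma induced_path_extend_hd:
  assumes W: "W \<subseteq> verts G" and no_minor: "\<not> complete_minor 3 W"
    and p: "induced_path W p" and v: "v \<notin> set p" "(v, p ! 0) \<in> edges_on W"
  shows "induced_path W (v # p)"
proof -
  have adj: "(p ! i, p ! j) \<in> edges_on W \<longleftrightarrow> j = Suc i \<or> i = Suc j"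
    if "i < length p" "j < length p" for i j
    using p that by (auto simp: induced_path_def)
  have p_W: "p ! j \<in> W" if "j < length p" for j
    using p that nth_mem unfolding induced_path_def by blast
  have no_edge: "(v, p ! j) \<notin> edges_on W" if j: "0 < j" "j < length p" for j
  proof
    assume vj: "(v, p ! j) \<in> edges_on W"
    define A where "A = (\<lambda>i. p ! i) ` {1..j}"
    have conn1: "(p ! 1, p ! i) \<in> (edges_on A)\<^sup>*" if "1 \<le> i" "i \<le> j" for i
      using that
    proof (induction i rule: nat_induct_at_least)
      case (Suc i)
      then have "(p ! i, p ! Suc i) \<in> edges_on W"
        using adj j by simp
      then have "(p ! i, p ! Suc i) \<in> edges_on A"
        using Suc.prems Suc.hyps by (auto simp: edges_on_def A_def)
      then show ?case using Suc by (auto intro: rtrancl_into_rtrancl)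
    qed auto
    have conn: "(x, y) \<in> (edges_on A)\<^sup>*" if "x \<in> A" "y \<in> A" for x y
    proof -
      have "(p ! 1, z) \<in> (edges_on A)\<^sup>*" if "z \<in> A" for z
        using that conn1 by (auto simp: A_def)
      then show ?thesis
        using that edges_on_rtrancl_sym by (meson rtrancl_trans)
    qed
    have disj: "p ! 0 \<notin> A" "v \<notin> A" "v \<noteq> p ! 0"
      using p v j by (auto simp: A_def induced_path_def nth_eq_iff_index_eq)
    have A_in: "p ! 1 \<in> A" "p ! j \<in> A"
      using j by (auto simp: A_def)
    have e01: "(p ! 0, p ! 1) \<in> edges_on W"
      using adj[of 0 1] order.strict_trans2[of 0 j "length p"] j by (cases "length p") auto
    define B where "B x = (if x = 0 then {v} else if x = 1 then {p ! 0} else A)" for x :: nat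
    have "minor_in 3 {(i, j). i \<noteq> j} W"
      unfolding minor_in_def
    proof (intro exI[of _ B] conjI allI impI)
      fix x :: nat
      show "B x \<subseteq> W" "B x \<noteq> {}"
        using v p_W j A_in by (auto simp: B_def A_def edges_on_def)
      show "\<forall>u \<in> B x. \<forall>v \<in> B x. (u, v) \<in> (edges_on (B x))\<^sup>*"
        using conn by (auto simp: B_def)
    next
      fix x y :: nat assume "x < 3" "y < 3" "x \<noteq> y"
      then show "B x \<inter> B y = {}"
        using disj by (auto simp: B_def)
    next
      fix x y :: nat assume "x < 3" "y < 3" "(x, y) \<in> {(i, j). i \<noteq> j}"
      then consider "x = 0 \<and> y = 1 \<or> x = 1 \<and> y = 0" | "x = 0 \<and> y = 2 \<or> x = 2 \<and> y = 0"
        | "x = 1 \<and> y = 2 \<or> x = 2 \<and> y = 1" by force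
      then show "\<exists>u \<in> B x. \<exists>v \<in> B y. u \<rightarrow>\<^bsub>G\<^esub> v"
      proof cases
        case 1
        then show ?thesis using v graph_symmetric by (auto simp: B_def edges_on_def)
      next
        case 2
        then show ?thesis using vj A_in graph_symmetric by (auto simp: B_def edges_on_def)
      next
        case 3
        then show ?thesis using e01 A_in graph_symmetric by (auto simp: B_def edges_on_def)
      qed
    qed
    then show False using no_minor by simp
  qed
  have v_W: "v \<in> W" using v(2) by (simp add: edges_on_def)
  have "((v # p) ! i, (v # p) ! j) \<in> edges_on W \<longleftrightarrow> j = Suc i \<or> i = Suc j"
    if "i < length (v # p)" "j < length (v # p)" for i j
  proof (cases i; cases j)
    fix i' j' assume "i = Suc i'" "j = Suc j'"
    then show ?thesis using adj that by simp
  next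
    fix i' assume ij: "i = Suc i'" "j = 0"
    then show ?thesis
      using v(2) no_edge[of i'] edges_on_sym that by (cases i') auto
  next
    fix j' assume ij: "i = 0" "j = Suc j'"
    then show ?thesis
      using v(2) no_edge[of j'] that by (cases j') auto
  qed (use irrefl_edges_on in auto)
  then show ?thesis
    using p v v_W unfolding induced_path_def by auto
qed

lemma induced_path_rev: "induced_path W p \<Longrightarrow> induced_path W (rev p)"
  unfolding induced_path_def by (auto simp: rev_nth)

text \<open>The complete graph on four vertices without the triangle 0, 1, 2 is the claw with center
  3. An inner vertex of the path together with its two path neighbors and \<open>v\<close> is such a
  claw, with singletons as branch sets.\<close>

lemma no_star_minor_interior:
  assumes W: "W \<subseteq> verts G" and no_minor: "\<not> complete_minus_triangle_minor 4 W"
    and p: "induced_path W p" and v: "v \<notin> set p" "(v, p ! i) \<in> edges_on W"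
    and i: "0 < i" "Suc i < length p"
  shows False
proof -
  define B where "B x = (if x = 3 then {p ! i} else if x = 2 then {v} else
    if x = 1 then {p ! Suc i} else {p ! (i - 1)})" for x :: nat
  have edges: "(p ! i, p ! Suc i) \<in> edges_on W" "(p ! i, p ! (i - 1)) \<in> edges_on W"
    using p i by (auto simp: induced_path_def)
  have ne: "p ! i \<noteq> p ! Suc i" "p ! i \<noteq> p ! (i - 1)" "p ! Suc i \<noteq> p ! (i - 1)"
    "v \<noteq> p ! i" "v \<noteq> p ! Suc i" "v \<noteq> p ! (i - 1)"
    using p i v by (auto simp: induced_path_def nth_eq_iff_index_eq)
  have "minor_in 4 ({(i, j). i \<noteq> j} - {0, 1, 2} \<times> {0, 1, 2}) W"
    unfolding minor_in_def
  proof (intro exI[of _ B] conjI allI impI)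
    fix x :: nat
    show "B x \<subseteq> W" "B x \<noteq> {}" "\<forall>u \<in> B x. \<forall>v \<in> B x. (u, v) \<in> (edges_on (B x))\<^sup>*"
      using v edges by (auto simp: B_def edges_on_def)
  next
    fix x y :: nat assume "x < 4" "y < 4" "x \<noteq> y"
    then show "B x \<inter> B y = {}"
      using ne by (auto simp: B_def)
  next
    fix x y :: nat
    assume "x < 4" "y < 4" "(x, y) \<in> {(i, j). i \<noteq> j} - {0, 1, 2} \<times> {0, 1, 2}"
    then have "x = 3 \<and> (y = 0 \<or> y = 1 \<or> y = 2) \<or> y = 3 \<and> (x = 0 \<or> x = 1 \<or> x = 2)"
      by force
    then show "\<exists>u \<in> B x. \<exists>v \<in> B y. u \<rightarrow>\<^bsub>G\<^esub> v"
      using v edges graph_symmetric by (auto simp: B_def edges_on_def)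
  qed
  then show False using no_minor by simp
qed

text \<open>Take a longest induced path in the component. If it missed a vertex, some outside vertex
  would be adjacent to it: at an end this prolongs the path, at an inner vertex it produces a
  claw.\<close>

lemma no_small_minor_path_components:
  assumes W: "W \<subseteq> verts G" and no3: "\<not> complete_minor 3 W"
    and no4: "\<not> complete_minus_triangle_minor 4 W"
  shows "W - \<Union> (path_components (G \<restriction> W)) = {}"
proof -
  have "a \<in> \<Union> (path_components (G \<restriction> W))" if a: "a \<in> W" for a
  proof -
    let ?S = "comp_of W a"
    let ?Q = "\<lambda>p. induced_path W p \<and> set p \<subseteq> ?S"
    have fin: "finite ?S"
      using comp_of_subset[OF a] W finite_verts by (meson finite_subset)
    have bound: "length p \<le> card ?S" if "?Q p" for p
      using that fin by (metis card_mono distinct_card induced_path_def)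
    have "?Q [a]"
      using a irrefl_edges_on by (auto simp: induced_path_def comp_of_refl)
    moreover have "\<forall>q. ?Q q \<longrightarrow> length q < Suc (card ?S)"
      using bound by (auto simp: less_Suc_eq_le)
    ultimately have "\<exists>p. ?Q p \<and> (\<forall>q. ?Q q \<longrightarrow> length q \<le> length p)"
      by (rule ex_has_greatest_nat)
    then obtain p where p: "?Q p" and longest: "\<And>q. ?Q q \<Longrightarrow> length q \<le> length p"
      by (elim exE conjE) (rule that, auto)
    \<comment> \<open>Stated for every longest path rather than only for the chosen one, as it is
      applied to \<open>p\<close> and to \<open>rev p\<close> to cover both ends.\<close>
    have no_ext: "(v, p ! 0) \<notin> edges_on W" if "v \<in> ?S" "v \<notin> set p" "induced_path W p" "set p \<subseteq> ?S"
        "\<And>q. ?Q q \<Longrightarrow> length q \<le> length p" for v p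
    proof
      assume "(v, p ! 0) \<in> edges_on W"
      then have "?Q (v # p)"
        using induced_path_extend_hd[OF W no3 that(3,2)] that by auto
      then show False using that(5)[of "v # p"] by simp
    qed
    have "set p = ?S"
    proof (rule ccontr)
      assume "set p \<noteq> ?S"
      then obtain w where w: "w \<in> ?S" "w \<notin> set p" using p by blast
      have p0: "p ! 0 \<in> set p"
        using p by (simp add: induced_path_def)
      then have "(p ! 0, w) \<in> (edges_on W)\<^sup>*"
        using p w comp_of_eqI[of "p ! 0" W a] by (auto simp: comp_of_def)
      then obtain x v where xv: "x \<in> set p" "v \<notin> set p" "(x, v) \<in> edges_on W"
        using rtrancl_leaves_set[OF _ p0 w(2)] by metis
      then have v_S: "v \<in> ?S"
        using p comp_of_edge[of x v W] comp_of_eqI[of x W a] comp_of_refl[of v W] by auto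
      obtain i where i: "i < length p" "x = p ! i"
        using xv(1) by (metis in_set_conv_nth)
      have vi: "(v, p ! i) \<in> edges_on W"
        using xv(3) i edges_on_sym by blast
      consider "i = 0" | "Suc i = length p" | "0 < i" "Suc i < length p"
        using i by linarith
      then show False
      proof cases
        case 1
        then show ?thesis using no_ext[OF v_S xv(2)] p longest vi by blast
      next
        case 2
        then have "rev p ! 0 = p ! i" using i by (auto simp: rev_nth simp flip: 2)
        moreover have "(v, rev p ! 0) \<notin> edges_on W"
        proof (rule no_ext)
          show "v \<in> ?S" "v \<notin> set (rev p)" "induced_path W (rev p)" "set (rev p) \<subseteq> ?S"
            using v_S xv(2) p induced_path_rev by auto
          show "?Q q \<Longrightarrow> length q \<le> length (rev p)" for q
            using longest by simp
        qed
        ultimately show ?thesis using vi by simp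
      next
        case 3
        then show ?thesis using no_star_minor_interior[OF W no4 _ xv(2) vi] p by blast
      qed
    qed
    then have "is_path_graph ((G \<restriction> W) \<restriction> ?S)"
      using p is_path_graph_comp_of[OF a] induce_induce[OF comp_of_subset[OF a]] by auto
    then have "?S \<in> path_components (G \<restriction> W)"
      using a sccs_verts_induce[OF W] by (auto simp: path_components_def)
    then show ?thesis using comp_of_refl by blast
  qed
  then show ?thesis by blast
qed

text \<open>\<open>V\<close> is the remaining graph before its path components are removed and
  \<open>m\<close> the number of colors still available beyond \<open>i\<close>. At the start
  \<open>m = k - 1\<close>, which makes \<open>m + 3\<close> and \<open>m + 4\<close> the sizes
  \<open>k + 2\<close> and \<open>k + 3\<close>. For \<open>m = 0\<close> only paths remain, so
  \<open>W\<close> is empty and no further round is possible; hence \<open>i\<close> never exceeds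
  \<open>k\<close>.\<close>

lemma elim_reach_minors:
  assumes "elim_reach G W i \<chi> P" "1 \<le> k"
    "\<not> complete_minor (k + 2) (verts G)" "\<not> complete_minus_triangle_minor (k + 3) (verts G)"
  shows "\<exists>V m. V \<subseteq> verts G \<and> W = V - \<Union> (path_components (G \<restriction> V)) \<and> i + m = k \<and>
    \<not> complete_minor (m + 3) V \<and> \<not> complete_minus_triangle_minor (m + 4) V"
  using assms(1)
proof induction
  case init
  obtain m where "k = Suc m"
    using assms(2) by (metis Suc_le_D One_nat_def)
  then show ?case
    using assms(3,4) induce_self by (intro exI[of _ "verts G"] exI[of _ m]) (auto simp: numeral_eq_Suc)
next
  case (round W i \<chi> P D W')
  then obtain V m where V: "V \<subseteq> verts G" "W = V - \<Union> (path_components (G \<restriction> V))" "i + m = k"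
      "\<not> complete_minor (m + 3) V" "\<not> complete_minus_triangle_minor (m + 4) V"
    by blast
  have W: "W \<subseteq> verts G" "W \<subseteq> V" using V by auto
  have "m \<noteq> 0"
  proof
    assume "m = 0"
    then show False
      using V no_small_minor_path_components[OF V(1)] round.hyps by simp
  qed
  then obtain l where l: "m = Suc l"
    using not0_implies_Suc by blast
  have "\<not> complete_minor (l + 3) W'"
  proof
    assume "complete_minor (l + 3) W'"
    then have "complete_minor (Suc (l + 3)) W"
      using minor_in_apex[OF W(1) round.hyps(3), of "l + 3" "{(i, j). i \<noteq> j}" 0 "{(i, j). i \<noteq> j}"] round.hyps(4) by auto
    then show False
      using V(4) l minor_in_mono[OF _ W(2)] by auto
  qed
  moreover have "\<not> complete_minus_triangle_minor (l + 4) W'"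
  proof
    assume "complete_minus_triangle_minor (l + 4) W'"
    \<comment> \<open>The hub is 3, the first vertex off the deleted triangle; in the complete case
      above, 0 serves.\<close>
    then have "complete_minus_triangle_minor (Suc (l + 4)) W"
      using minor_in_apex[OF W(1) round.hyps(3),
          of "l + 4" "{(i, j). i \<noteq> j} - {0, 1, 2} \<times> {0, 1, 2}" 3
            "{(i, j). i \<noteq> j} - {0, 1, 2} \<times> {0, 1, 2}"] round.hyps(4) by auto
    then show False
      using V(5) l minor_in_mono[OF _ W(2)] by auto
  qed
  moreover have "W' \<subseteq> verts G" using W round.hyps(4) by blast
  ultimately show ?case
    using V(3) l by (intro exI[of _ W'] exI[of _ l]) auto
qed

section \<open>Conflict-freeness\<close>

definition uniquely_colored :: "('a \<rightharpoonup> nat) \<Rightarrow> 'a \<Rightarrow> bool" where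
  "uniquely_colored \<chi> v \<longleftrightarrow> (\<exists>w \<in> closed_nbhd G v \<inter> dom \<chi>.
     \<forall>u \<in> closed_nbhd G v \<inter> dom \<chi>. u \<noteq> w \<longrightarrow> \<chi> u \<noteq> \<chi> w)"

text \<open>The color \<open>i\<close> is new and goes to uncolored vertices only, so the old
  witness keeps its color and no other vertex acquires that color.\<close>

lemma uniquely_colored_extend:
  assumes "uniquely_colored \<chi> v" "ran \<chi> \<subseteq> {1..<i}" "D \<inter> dom \<chi> = {}"
  shows "uniquely_colored (\<lambda>v. if v \<in> D then Some i else \<chi> v) v"
proof -
  obtain w where w: "w \<in> closed_nbhd G v" "w \<in> dom \<chi>"
    and uniq: "\<And>u. u \<in> closed_nbhd G v \<Longrightarrow> u \<in> dom \<chi> \<Longrightarrow> u \<noteq> w \<Longrightarrow> \<chi> u \<noteq> \<chi> w"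
    using assms(1) unfolding uniquely_colored_def by blast
  have "w \<notin> D" using w assms(3) by blast
  moreover have "\<chi> w \<noteq> Some i" using assms(2) by (auto simp: ran_def)
  ultimately show ?thesis
    using w uniq unfolding uniquely_colored_def
    by (intro bexI[of _ w]) (auto split: if_splits, metis domI)
qed

lemma uniquely_colored_new:
  assumes "w \<in> closed_nbhd G v" "w \<in> D" "\<And>u. u \<in> closed_nbhd G v \<Longrightarrow> u \<in> D \<Longrightarrow> u = w"
    and "ran \<chi> \<subseteq> {1..<i}"
  shows "uniquely_colored (\<lambda>v. if v \<in> D then Some i else \<chi> v) v"
proof -
  have not_i: "\<chi> u \<noteq> Some i" for u using assms(4) by (auto simp: ran_def)
  show ?thesis
    unfolding uniquely_colored_def
  proof (intro bexI[of _ w] ballI impI)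
    fix u assume "u \<in> closed_nbhd G v \<inter> dom (\<lambda>v. if v \<in> D then Some i else \<chi> v)" "u \<noteq> w"
    then have "u \<notin> D" using assms(3) by blast
    then show "(if u \<in> D then Some i else \<chi> u) \<noteq> (if w \<in> D then Some i else \<chi> w)"
      using assms(2) not_i by simp
  qed (use assms(1,2) in auto)
qed

lemma path_components_props:
  assumes "W \<subseteq> verts G" "S \<in> path_components (G \<restriction> W)"
  shows "S \<subseteq> W" "x \<in> S \<Longrightarrow> y \<in> W \<Longrightarrow> x \<rightarrow>\<^bsub>G\<^esub> y \<Longrightarrow> y \<in> S"
proof -
  obtain a where a: "a \<in> W" "S = comp_of W a"
    using assms path_components_induce by auto
  then show S: "S \<subseteq> W" using comp_of_subset by blast
  show "y \<in> S" if "x \<in> S" "y \<in> W" "x \<rightarrow>\<^bsub>G\<^esub> y"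
    using that S a comp_of_edge[of x y W] comp_of_eqI[of x W a] comp_of_refl[of y W]
    by (auto simp: edges_on_def)
qed

text \<open>The last conjunct is what the final color relies on: a removed path has no edge to
  another removed path or to the remaining graph, so within the final color class a vertex of the
  path sees only vertices of the same path.\<close>

lemma elim_reach_props:
  assumes "elim_reach G W i \<chi> P"
  shows "W \<subseteq> verts G \<and> \<Union>P \<subseteq> verts G \<and> 1 \<le> i \<and> ran \<chi> \<subseteq> {1..<i} \<and> dom \<chi> \<subseteq> verts G \<and>
    dom \<chi> \<inter> W = {} \<and> dom \<chi> \<inter> \<Union>P = {} \<and> \<Union>P \<inter> W = {} \<and>
    (\<forall>v \<in> verts G - W - \<Union>P. uniquely_colored \<chi> v) \<and>
    (\<forall>S \<in> P. \<forall>x \<in> S. \<forall>y \<in> \<Union>P \<union> W. x \<rightarrow>\<^bsub>G\<^esub> y \<longrightarrow> y \<in> S)"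
  using assms
proof induction
  case init
  have sub: "\<Union> (path_components G) \<subseteq> verts G"
    using path_components_props(1)[of "verts G"] induce_self by auto
  have closed: "y \<in> S" if "S \<in> path_components G" "x \<in> S" "x \<rightarrow>\<^bsub>G\<^esub> y" for S x y
    using path_components_props(2)[of "verts G" S x y] that induce_self adj_in_verts by auto
  show ?case
  proof (intro conjI ballI impI)
    fix S x y assume "S \<in> path_components G" "x \<in> S" "x \<rightarrow>\<^bsub>G\<^esub> y"
    then show "y \<in> S" by (rule closed)
  qed (use sub in auto)
next
  case (round W i \<chi> P D W')
  let ?\<chi> = "\<lambda>v. if v \<in> D then Some i else \<chi> v"
  have IH: "W \<subseteq> verts G" "\<Union>P \<subseteq> verts G" "1 \<le> i" "ran \<chi> \<subseteq> {1..<i}" "dom \<chi> \<subseteq> verts G"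
    "dom \<chi> \<inter> W = {}" "dom \<chi> \<inter> \<Union>P = {}" "\<Union>P \<inter> W = {}"
    and IH_colored: "\<forall>v \<in> verts G - W - \<Union>P. uniquely_colored \<chi> v"
    and IH_closed: "\<forall>S \<in> P. \<forall>x \<in> S. \<forall>y \<in> \<Union>P \<union> W. x \<rightarrow>\<^bsub>G\<^esub> y \<longrightarrow> y \<in> S"
    using round.IH by - (elim conjE, assumption)+
  have covered: "uniquely_colored \<chi> v" if "v \<in> verts G - W - \<Union>P" for v
    using IH_colored that by simp
  have closed: "y \<in> S" if "S \<in> P" "x \<in> S" "y \<in> \<Union>P \<union> W" "x \<rightarrow>\<^bsub>G\<^esub> y" for S x y
    using IH_closed that by metis
  have partial: "dist3_partial (G \<restriction> W) D"
    using round.hyps(3) by (simp add: dist3_set_def)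
  note props = dist3_partial_props[OF partial IH(1)]
  have W': "W' \<subseteq> W" "W' \<subseteq> verts G" using round.hyps(4) IH(1) by auto
  note new = path_components_props[OF W'(2)]
  have D_W': "D \<inter> W' = {}"
    using round.hyps(4) by (auto simp: closed_nbhd_def)
  have dom: "dom ?\<chi> = D \<union> dom \<chi>" by (auto split: if_splits)
  have ran: "ran ?\<chi> \<subseteq> {1..<i + 1}"
  proof
    fix j assume "j \<in> ran ?\<chi>"
    then have "j = i \<or> j \<in> ran \<chi>" by (auto simp: ran_def split: if_splits)
    then show "j \<in> {1..<i + 1}" using IH(3,4) by auto
  qed
  have N: "uniquely_colored ?\<chi> v" if v: "v \<in> nbhd_of_set W D" for v
  proof -
    obtain w where w: "w \<in> D" "v \<in> closed_nbhd (G \<restriction> W) w"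
      using v by blast
    then have "v = w \<or> (w, v) \<in> edges_on W" by (auto simp: closed_nbhd_induce)
    then have wG: "w \<in> closed_nbhd G v" and v: "v \<in> W"
      using graph_symmetric w(1) props(1) by (auto simp: closed_nbhd_def edges_on_def)
    show ?thesis
    proof (rule uniquely_colored_new[OF wG w(1) _ IH(4)])
      fix u assume u: "u \<in> closed_nbhd G v" "u \<in> D"
      \<comment> \<open>Two members of \<open>D\<close> in one closed neighborhood would have
        distance at most 2, that is, level at most 3.\<close>
      show "u = w"
      proof (rule ccontr)
        assume ne: "u \<noteq> w"
        have lw: "0 < level W w v \<and> level W w v \<le> 2"
          using w closed_nbhd_level[of w W v] props(1) by blast
        have "v = u \<or> (v, u) \<in> edges_on W"
          using u v props(1) by (auto simp: closed_nbhd_def edges_on_def)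
        then have "0 < level W w u \<and> level W w u \<le> 3"
          using lw level_step[of v u W w] by auto
        then show False using props(2)[OF w(1) u(2)] ne by blast
      qed
    qed
  qed
  have old: "uniquely_colored ?\<chi> v" if "v \<in> verts G - W - \<Union>P" for v
    using uniquely_colored_extend[OF covered[OF that] IH(4)] props(1) IH(6) by blast
  have closed': "y \<in> S" 
    if S: "S \<in> path_components (G \<restriction> W')" "x \<in> S" and y: "y \<in> \<Union>P \<union> W'" and xy: "x \<rightarrow>\<^bsub>G\<^esub> y" for S x y
  proof (cases "y \<in> W'")
    case True
    then show ?thesis using new(2)[OF S _ xy] by blast
  next
    case False
    then obtain T where T: "T \<in> P" "y \<in> T" using y by blast
    \<comment> \<open>Seen from \<open>y\<close>, the edge leads from an older path component
      \<open>T\<close> into \<open>W\<close>; such an edge would put \<open>x\<close> into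
      \<open>T\<close>, which is disjoint from \<open>W\<close>.\<close>
    have "x \<in> W" using new(1)[OF S(1)] S(2) W'(1) by blast
    then have "x \<in> T" using closed[OF T, of x] graph_symmetric[OF xy] by blast
    then show ?thesis using T IH(8) \<open>x \<in> W\<close> by blast
  qed
  have PW: "\<Union> (path_components (G \<restriction> W')) \<subseteq> W'" using new(1) by blast
  let ?Q = "path_components (G \<restriction> W')"
  have "D \<union> dom \<chi> \<subseteq> verts G"
    using props(1) IH(1) IH(5) by (meson Un_least subset_trans)
  moreover have "dom \<chi> \<inter> W' = {}" "D \<inter> \<Union>P = {}"
    using IH(6) W'(1) IH(8) props(1) by (meson disjoint_iff subsetD)+
  ultimately have d1: "dom ?\<chi> \<subseteq> verts G" "dom ?\<chi> \<inter> W' = {}" "dom ?\<chi> \<inter> \<Union>P = {}"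
    unfolding dom Int_Un_distrib2 using D_W' IH(7) by simp_all
  have PW': "\<Union>P \<inter> W' = {}" using IH(8) W'(1) by blast
  show ?case
  proof (intro conjI)
    show "W' - \<Union>?Q \<subseteq> verts G" using W' by blast
    show "\<Union> (P \<union> ?Q) \<subseteq> verts G" using W' PW IH(2) by auto
    show "1 \<le> i + 1" by simp
    show "ran ?\<chi> \<subseteq> {1..<i + 1}" by (rule ran)
    show "dom ?\<chi> \<subseteq> verts G" by (rule d1)
    show "dom ?\<chi> \<inter> (W' - \<Union>?Q) = {}" using d1(2) by blast
    have "dom ?\<chi> \<inter> \<Union>?Q = {}" using d1(2) PW by blast
    then show "dom ?\<chi> \<inter> \<Union> (P \<union> ?Q) = {}"
      using d1(3) unfolding Union_Un_distrib Int_Un_distrib by simp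
    show "\<Union> (P \<union> ?Q) \<inter> (W' - \<Union>?Q) = {}"
      unfolding Union_Un_distrib using PW' by blast
    show "\<forall>v \<in> verts G - (W' - \<Union>?Q) - \<Union> (P \<union> ?Q). uniquely_colored ?\<chi> v"
    proof
      fix v assume "v \<in> verts G - (W' - \<Union>?Q) - \<Union> (P \<union> ?Q)"
      then have "v \<in> verts G" "v \<notin> W'" "v \<notin> \<Union>P" by auto
      then show "uniquely_colored ?\<chi> v"
        using N[of v] old[of v] round.hyps(4) by (cases "v \<in> W") auto
    qed
    show "\<forall>S \<in> P \<union> ?Q. \<forall>x \<in> S. \<forall>y \<in> \<Union> (P \<union> ?Q) \<union> (W' - \<Union>?Q). x \<rightarrow>\<^bsub>G\<^esub> y \<longrightarrow> y \<in> S"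
    proof (intro ballI impI)
      fix S x y
      assume S: "S \<in> P \<union> ?Q" and x: "x \<in> S" and xy: "x \<rightarrow>\<^bsub>G\<^esub> y"
        and "y \<in> \<Union> (P \<union> ?Q) \<union> (W' - \<Union>?Q)"
      then have y: "y \<in> \<Union>P \<union> W'" using PW by auto
      show "y \<in> S"
      proof (cases "S \<in> P")
        case True
        then show ?thesis using closed[OF True x _ xy] y W'(1) by blast
      next
        case False
        then show ?thesis using closed'[OF _ x y xy] S by blast
      qed
    qed
  qed
qed

theorem elim_coloring_conflict_free:
  assumes "elim_coloring G \<chi>" "1 \<le> k"
    "\<not> is_minor (complete_graph (k + 2)) G" "\<not> is_minor (complete_graph_minus_triangle (k + 3)) G"
  shows "conflict_free_coloring k G \<chi>"
  using assms(1)
proof cases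
  case (1 i \<chi>' P C)
  from elim_reach_props[OF 1(2)]
  have props: "\<Union>P \<subseteq> verts G" "1 \<le> i" "dom \<chi>' \<subseteq> verts G" "dom \<chi>' \<inter> \<Union>P = {}"
    and ran': "ran \<chi>' \<subseteq> {1..<i}"
    and old: "\<forall>v \<in> verts G - {} - \<Union>P. uniquely_colored \<chi>' v"
    and closed: "\<forall>S \<in> P. \<forall>x \<in> S. \<forall>y \<in> \<Union>P \<union> {}. x \<rightarrow>\<^bsub>G\<^esub> y \<longrightarrow> y \<in> S"
    by - (elim conjE, assumption)+
  have "\<exists>V m. V \<subseteq> verts G \<and> {} = V - \<Union> (path_components (G \<restriction> V)) \<and> i + m = k \<and>
      \<not> complete_minor (m + 3) V \<and> \<not> complete_minus_triangle_minor (m + 4) V"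
    using elim_reach_minors[OF 1(2) assms(2)] assms(3,4)
    unfolding is_minor_complete_graph is_minor_complete_graph_minus_triangle by blast
  then have "i \<le> k" by (elim exE conjE) simp
  have dom: "dom \<chi> = C \<union> dom \<chi>'"
    unfolding 1(1) by (auto split: if_splits)
  have "ran \<chi> \<subseteq> {1..k}"
  proof
    fix j assume "j \<in> ran \<chi>"
    then have "j = i \<or> j \<in> ran \<chi>'" by (auto simp: 1(1) ran_def split: if_splits)
    then show "j \<in> {1..k}" using ran' props \<open>i \<le> k\<close> by auto
  qed
  moreover have "uniquely_colored \<chi> v" if v: "v \<in> verts G" for v
  proof (cases "v \<in> \<Union>P")
    case False
    then have "uniquely_colored \<chi>' v" using old v by blast
    moreover have "C \<inter> dom \<chi>' = {}" using props 1(3) by blast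
    ultimately show ?thesis
      unfolding 1(1) using ran' by (intro uniquely_colored_extend)
  next
    case True
    then obtain S where S: "S \<in> P" "v \<in> S" by blast
    \<comment> \<open>In \<open>G\<close> the vertex \<open>v\<close> may have further neighbors,
      deleted in earlier rounds, but none of them belongs to \<open>C\<close>; so the unique choice
      inside the path remains unique in \<open>G\<close>.\<close>
    have eq: "closed_nbhd G v \<inter> C = closed_nbhd (G \<restriction> S) v \<inter> C"
    proof -
      have "u \<in> S" if vu: "v \<rightarrow>\<^bsub>G\<^esub> u" and u: "u \<in> C" for u
      proof -
        have "u \<in> \<Union>P \<union> {}" using u 1(3) by blast
        then show ?thesis using closed[rule_format, OF S _ vu] by blast
      qed
      then show ?thesis
        using S by (auto simp: closed_nbhd_def dominates_induce_iff edges_on_def)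
    qed
    have "\<exists>!w. w \<in> closed_nbhd G v \<inter> C"
      using 1(4) S unfolding eq by blast
    then obtain w where w: "w \<in> closed_nbhd G v \<inter> C" "\<forall>u. u \<in> closed_nbhd G v \<inter> C \<longrightarrow> u = w"
      unfolding Ex1_def by (elim exE conjE)
    show ?thesis
      unfolding 1(1)
    proof (rule uniquely_colored_new[OF _ _ _ ran'])
      show "w \<in> closed_nbhd G v" "w \<in> C" using w(1) by blast+
      show "u = w" if "u \<in> closed_nbhd G v" "u \<in> C" for u
        using w(2) that by blast
    qed
  qed
  moreover have "dom \<chi> \<subseteq> verts G"
    unfolding dom using props 1(3) by blast
  ultimately show ?thesis
    unfolding conflict_free_coloring_def uniquely_colored_def by blast
qed

end

section \<open>Loop programs\<close>

text \<open>\<open>LFor x c\<close> runs \<open>c\<close> for all values of the scalar \<open>x\<close> below the number of vertices.\<close>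

datatype lp =
    LSkip
  | LAsg string exp exp exp
  | LSeq lp lp
  | LCond exp lp lp
  | LFor string lp

definition upd :: "memory \<Rightarrow> string \<Rightarrow> nat \<Rightarrow> nat \<Rightarrow> nat \<Rightarrow> memory" where
  "upd s x i j v = s(x := (s x)(i := (s x i)(j := v)))"

lemma upd_apply: "upd s x i j v y a b = (if y = x \<and> a = i \<and> b = j then v else s y a b)"
  by (simp add: upd_def)

lemma upd_apply_table: "y \<noteq> x \<Longrightarrow> upd s x i j v y = s y"
  by (simp add: upd_def)

abbreviation Var :: "string \<Rightarrow> exp" where
  "Var x \<equiv> Cell x (Lit 0) (Lit 0)"

primrec iter :: "nat \<Rightarrow> (memory \<Rightarrow> memory) \<Rightarrow> string \<Rightarrow> memory \<Rightarrow> memory" where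
  "iter 0 c x s = s"
| "iter (Suc n) c x s = c (upd (iter n c x s) x 0 0 n)"

text \<open>A loop leaves its variable at \<open>n\<close>, just as the compiled while loop does, so
  that \<open>den\<close> gives the exact final memory and not only its relevant part.\<close>

primrec den :: "nat \<Rightarrow> lp \<Rightarrow> memory \<Rightarrow> memory" where
  "den n LSkip s = s"
| "den n (LAsg x a b e) s = upd s x (eval_exp a s) (eval_exp b s) (eval_exp e s)"
| "den n (LSeq c1 c2) s = den n c2 (den n c1 s)"
| "den n (LCond e c1 c2) s = (if eval_exp e s \<noteq> 0 then den n c1 s else den n c2 s)"
| "den n (LFor x c) s = upd (iter n (den n c) x s) x 0 0 n"

primrec compile :: "lp \<Rightarrow> com" where
  "compile LSkip = Skip"
| "compile (LAsg x a b e) = Assign x a b e"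
| "compile (LSeq c1 c2) = Seq (compile c1) (compile c2)"
| "compile (LCond e c1 c2) = Cond e (compile c1) (compile c2)"
| "compile (LFor x c) = Seq (Assign x (Lit 0) (Lit 0) (Lit 0))
     (While (Minus (Var ''n'') (Var x))
       (Seq (compile c) (Assign x (Lit 0) (Lit 0) (Plus (Var x) (Lit 1)))))"

primrec writes :: "lp \<Rightarrow> string set" where
  "writes LSkip = {}"
| "writes (LAsg x a b e) = {x}"
| "writes (LSeq c1 c2) = writes c1 \<union> writes c2"
| "writes (LCond e c1 c2) = writes c1 \<union> writes c2"
| "writes (LFor x c) = insert x (writes c)"

text \<open>Loop bound and loop variable are protected from the body, so that the compiled while
  loop makes exactly \<open>n\<close> iterations.\<close>

primrec wf_lp :: "lp \<Rightarrow> bool" where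
  "wf_lp LSkip \<longleftrightarrow> True"
| "wf_lp (LAsg x a b e) \<longleftrightarrow> x \<noteq> ''n''"
| "wf_lp (LSeq c1 c2) \<longleftrightarrow> wf_lp c1 \<and> wf_lp c2"
| "wf_lp (LCond e c1 c2) \<longleftrightarrow> wf_lp c1 \<and> wf_lp c2"
| "wf_lp (LFor x c) \<longleftrightarrow> x \<noteq> ''n'' \<and> x \<notin> writes c \<and> wf_lp c"

text \<open>The 13 of a loop is 1 for the sequence, 4 for the initial assignment and 8 for the final
  test. An iteration adds 8 for the test, 8 for the increment and 1 for the inner sequence, which
  the 18 covers.\<close>

primrec time_bound :: "nat \<Rightarrow> lp \<Rightarrow> nat" where
  "time_bound n LSkip = 1"
| "time_bound n (LAsg x a b e) = 1 + exp_time a + exp_time b + exp_time e"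
| "time_bound n (LSeq c1 c2) = 1 + time_bound n c1 + time_bound n c2"
| "time_bound n (LCond e c1 c2) = 1 + exp_time e + time_bound n c1 + time_bound n c2"
| "time_bound n (LFor x c) = 13 + n * (18 + time_bound n c)"

lemma iter_unchanged:
  assumes "\<And>s. c s y = s y" "y \<noteq> x"
  shows "iter n c x s y = s y"
  using assms by (induction n) (auto simp: upd_apply_table)

lemma den_unchanged: "y \<notin> writes c \<Longrightarrow> den n c s y = s y"
proof (induction c arbitrary: s)
  case (LFor x c)
  then have "iter n (den n c) x s y = s y"
    by (intro iter_unchanged) auto
  then show ?case using LFor.prems by (simp add: upd_apply_table)
qed (auto simp: upd_apply_table)

lemma wf_lp_writes: "wf_lp c \<Longrightarrow> ''n'' \<notin> writes c"
  by (induction c) auto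

lemma exec_Assign_upd:
  "t = 1 + exp_time a + exp_time b + exp_time e \<Longrightarrow>
    exec (Assign x a b e) s t (upd s x (eval_exp a s) (eval_exp b s) (eval_exp e s))"
  unfolding upd_def using exec.Assign by metis

lemma exec_compile:
  assumes "wf_lp c" "s ''n'' 0 0 = n"
  shows "\<exists>t \<le> time_bound n c. exec (compile c) s t (den n c s)"
  using assms
proof (induction c arbitrary: s)
  case LSkip
  then show ?case using exec.Skip by (intro exI[of _ 1]) simp
next
  case (LAsg x a b e)
  then show ?case using exec_Assign_upd[OF refl, of x a b e s] by auto
next
  case (LSeq c1 c2)
  then obtain t1 where t1: "t1 \<le> time_bound n c1" "exec (compile c1) s t1 (den n c1 s)"
    by auto
  have "den n c1 s ''n'' 0 0 = n"
    using LSeq.prems den_unchanged wf_lp_writes by auto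
  then obtain t2 where "t2 \<le> time_bound n c2" "exec (compile c2) (den n c1 s) t2 (den n c2 (den n c1 s))"
    using LSeq by auto
  then show ?case
    using t1 exec.Seq by (intro exI[of _ "1 + t1 + t2"]) auto
next
  case (LCond e c1 c2)
  show ?case
  proof (cases "eval_exp e s = 0")
    case True
    obtain t where "t \<le> time_bound n c2" "exec (compile c2) s t (den n c2 s)"
      using LCond by auto
    then show ?thesis
      using True exec.CondFalse by (intro exI[of _ "1 + exp_time e + t"]) auto
  next
    case False
    obtain t where "t \<le> time_bound n c1" "exec (compile c1) s t (den n c1 s)"
      using LCond by auto
    then show ?thesis
      using False exec.CondTrue by (intro exI[of _ "1 + exp_time e + t"]) auto
  qed
next
  case (LFor x c)
  have wf: "x \<noteq> ''n''" "x \<notin> writes c" "wf_lp c" "''n'' \<notin> writes c"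
    using LFor.prems wf_lp_writes by auto
  let ?e = "Minus (Var ''n'') (Var x)"
  let ?inc = "Assign x (Lit 0) (Lit 0) (Plus (Var x) (Lit 1))"
  \<comment> \<open>\<open>?st i\<close> is the memory at the loop head after \<open>i\<close>
    iterations: for 0 the result of the initial assignment, for \<open>n\<close> the final memory of
    the loop.\<close>
  let ?st = "\<lambda>i. upd (iter i (den n c) x s) x 0 0 i"
  have st_n: "?st i ''n'' 0 0 = n" for i
    using iter_unchanged[of "den n c" "''n''" x i s] den_unchanged[OF wf(4)] wf LFor.prems
    by (auto simp: upd_apply_table)
  have st_x: "?st i x 0 0 = i" for i
    by (simp add: upd_apply)
  \<comment> \<open>Downward induction on \<open>i\<close>, since the execution of a while loop is
    built up from its last test, whose cost is the 8.\<close>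
  have "\<exists>t \<le> 8 + (n - i) * (18 + time_bound n c).
      exec (While ?e (Seq (compile c) ?inc)) (?st i) t (?st n)" if "i \<le> n" for i
    using that
  proof (induction i rule: inc_induct)
    case base
    have "exec (While ?e (Seq (compile c) ?inc)) (?st n) (1 + exp_time ?e) (?st n)"
      using st_n[of n] st_x[of n] by (intro exec.WhileFalse) simp
    then show ?case by (intro exI[of _ "1 + exp_time ?e"]) simp
  next
    case (step i)
    then obtain t2 where t2: "t2 \<le> 8 + (n - Suc i) * (18 + time_bound n c)"
        "exec (While ?e (Seq (compile c) ?inc)) (?st (Suc i)) t2 (?st n)"
      by blast
    obtain t1 where t1: "t1 \<le> time_bound n c" "exec (compile c) (?st i) t1 (den n c (?st i))"
      using LFor.IH[of "?st i"] wf(3) st_n[of i] by blast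
    have "den n c (?st i) x 0 0 = i"
      using den_unchanged[OF wf(2)] st_x by simp
    then have "?st (Suc i) = upd (den n c (?st i)) x (eval_exp (Lit 0) (den n c (?st i)))
        (eval_exp (Lit 0) (den n c (?st i))) (eval_exp (Plus (Var x) (Lit 1)) (den n c (?st i)))"
      by simp
    then have "exec ?inc (den n c (?st i)) 8 (?st (Suc i))"
      by (simp only:) (rule exec_Assign_upd, simp)
    then have body: "exec (Seq (compile c) ?inc) (?st i) (1 + t1 + 8) (?st (Suc i))"
      using exec.Seq t1(2) by blast
    have "eval_exp ?e (?st i) \<noteq> 0"
      using st_n[of i] st_x[of i] step.hyps by simp
    then have "exec (While ?e (Seq (compile c) ?inc)) (?st i)
        (1 + exp_time ?e + (1 + t1 + 8) + t2) (?st n)"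
      by (rule exec.WhileTrue) (fact body, fact t2(2))
    moreover have "1 + exp_time ?e + (1 + t1 + 8) + t2 \<le> 8 + (n - i) * (18 + time_bound n c)"
    proof -
      have "n - i = Suc (n - Suc i)" using step.hyps by simp
      then show ?thesis using t1(1) t2(1) by simp
    qed
    ultimately show ?case by blast
  qed
  from this[of 0] obtain t where t: "t \<le> 8 + n * (18 + time_bound n c)"
      "exec (While ?e (Seq (compile c) ?inc)) (?st 0) t (?st n)"
    by auto
  have start: "exec (Assign x (Lit 0) (Lit 0) (Lit 0)) s 4 (?st 0)"
    using exec_Assign_upd[of 4 "Lit 0" "Lit 0" "Lit 0" x s] by simp
  have "exec (compile (LFor x c)) s (1 + 4 + t) (den n (LFor x c) s)"
    unfolding compile.simps den.simps by (rule exec.Seq[OF start t(2)])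
  then show ?case using t(1) by (intro exI[of _ "1 + 4 + t"]) simp
qed

section \<open>Polynomial bounds\<close>

definition poly_bounded :: "(nat \<Rightarrow> nat) \<Rightarrow> bool" where
  "poly_bounded f \<longleftrightarrow> (\<exists>a d. \<forall>n. f n \<le> a * (n + 1) ^ d)"

lemma poly_bounded_const: "poly_bounded (\<lambda>n. c)"
  unfolding poly_bounded_def by (intro exI[of _ c] exI[of _ 0]) simp

lemma poly_bounded_id: "poly_bounded (\<lambda>n. n)"
  unfolding poly_bounded_def by (intro exI[of _ 1]) simp

lemma poly_bounded_add:
  assumes "poly_bounded f" "poly_bounded g"
  shows "poly_bounded (\<lambda>n. f n + g n)"
proof -
  obtain a d b e where f: "\<And>n. f n \<le> a * (n + 1) ^ d" and g: "\<And>n. g n \<le> b * (n + 1) ^ e"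
    using assms unfolding poly_bounded_def by blast
  have "f n + g n \<le> (a + b) * (n + 1) ^ (d + e)" for n
  proof -
    have "a * (n + 1) ^ d \<le> a * (n + 1) ^ (d + e)" "b * (n + 1) ^ e \<le> b * (n + 1) ^ (d + e)"
      by (intro mult_le_mono2 power_increasing; simp)+
    with f[of n] g[of n] show ?thesis
      unfolding add_mult_distrib by linarith
  qed
  then show ?thesis
    unfolding poly_bounded_def by blast
qed

lemma poly_bounded_mult:
  assumes "poly_bounded f" "poly_bounded g"
  shows "poly_bounded (\<lambda>n. f n * g n)"
proof -
  obtain a d b e where f: "\<And>n. f n \<le> a * (n + 1) ^ d" and g: "\<And>n. g n \<le> b * (n + 1) ^ e"
    using assms unfolding poly_bounded_def by blast
  have "f n * g n \<le> (a * b) * (n + 1) ^ (d + e)" for n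
    using mult_le_mono[OF f[of n] g[of n]] by (simp add: power_add ac_simps)
  then show ?thesis
    unfolding poly_bounded_def by blast
qed

text \<open>For a fixed program, \<open>time_bound\<close> is composed of constants,
  \<open>n\<close>, sums and products only.\<close>

lemma poly_bounded_time_bound: "poly_bounded (\<lambda>n. time_bound n c)"
  by (induction c) (simp_all add: poly_bounded_const poly_bounded_id poly_bounded_add
      poly_bounded_mult del: add_Suc add_Suc_right)

section \<open>Reasoning about loops\<close>

text \<open>The rule for loop invariants. Each iteration is told that tables which the loop does not
  write still have their initial contents, so invariants can be restricted to what changes.\<close>

lemma den_LFor_rule:
  assumes "I 0 s"
    and "\<And>i s'. i < n \<Longrightarrow> I i s' \<Longrightarrow> (\<And>y. y \<notin> insert x (writes c) \<Longrightarrow> s' y = s y) \<Longrightarrow>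
      I (Suc i) (den n c (upd s' x 0 0 i))"
    and "\<And>s'. I n s' \<Longrightarrow> (\<And>y. y \<notin> insert x (writes c) \<Longrightarrow> s' y = s y) \<Longrightarrow> Q (upd s' x 0 0 n)"
  shows "Q (den n (LFor x c) s)"
proof -
  have frame: "iter i (den n c) x s y = s y" if "y \<notin> insert x (writes c)" for i y
    using that by (intro iter_unchanged) (auto simp: den_unchanged)
  have "I i (iter i (den n c) x s)" if "i \<le> n" for i
    using that
  proof (induction i)
    case (Suc i)
    then show ?case using assms(2)[of i] frame by simp
  qed (use assms(1) in simp)
  then show ?thesis
    using assms(3) frame by simp
qed

lemma den_LFor_flag:
  assumes "x \<noteq> b"
    and "\<And>i s'. i < n \<Longrightarrow> s' x 0 0 = i \<Longrightarrow> (\<And>y. y \<notin> insert x (writes c) \<Longrightarrow> s' y = s y) \<Longrightarrow>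
      den n c s' b 0 0 \<noteq> 0 \<longleftrightarrow> s' b 0 0 \<noteq> 0 \<or> R i"
  shows "den n (LFor x c) s b 0 0 \<noteq> 0 \<longleftrightarrow> s b 0 0 \<noteq> 0 \<or> (\<exists>i < n. R i)"
proof (rule den_LFor_rule[where I = "\<lambda>i s'. s' b 0 0 \<noteq> 0 \<longleftrightarrow> s b 0 0 \<noteq> 0 \<or> (\<exists>j < i. R j)"])
  fix i s' assume i: "i < n" and IH: "s' b 0 0 \<noteq> 0 \<longleftrightarrow> s b 0 0 \<noteq> 0 \<or> (\<exists>j < i. R j)"
    and frame: "\<And>y. y \<notin> insert x (writes c) \<Longrightarrow> s' y = s y"
  have "den n c (upd s' x 0 0 i) b 0 0 \<noteq> 0 \<longleftrightarrow> upd s' x 0 0 i b 0 0 \<noteq> 0 \<or> R i"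
    using i frame by (intro assms(2)) (auto simp: upd_apply upd_apply_table)
  then show "den n c (upd s' x 0 0 i) b 0 0 \<noteq> 0 \<longleftrightarrow> s b 0 0 \<noteq> 0 \<or> (\<exists>j < Suc i. R j)"
    using IH assms(1) by (auto simp: upd_apply less_Suc_eq)
qed (use assms(1) in \<open>auto simp: upd_apply\<close>)

text \<open>For loops whose pass \<open>i\<close> fills cell \<open>(i, 0)\<close> of a table. The
  shape of the partly filled table is available in the pass, so a body that leaves its cell alone is
  covered too, with the old entry as \<open>F i\<close>.\<close>

lemma den_LFor_map:
  assumes "x \<noteq> z"
    and "\<And>i s' a b. i < n \<Longrightarrow> s' x 0 0 = i \<Longrightarrow> (\<And>y. y \<notin> insert x (writes c) \<Longrightarrow> s' y = s y) \<Longrightarrow>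
      (\<And>a b. s' z a b = (if a < i \<and> b = 0 then F a else s z a b)) \<Longrightarrow>
      den n c s' z a b = (if a = i \<and> b = 0 then F i else s' z a b)"
  shows "den n (LFor x c) s z a b = (if a < n \<and> b = 0 then F a else s z a b)"
proof (rule den_LFor_rule[where I = "\<lambda>i s'. \<forall>a b. s' z a b = (if a < i \<and> b = 0 then F a else s z a b)"])
  fix i s' assume i: "i < n" and IH: "\<forall>a b. s' z a b = (if a < i \<and> b = 0 then F a else s z a b)"
    and frame: "\<And>y. y \<notin> insert x (writes c) \<Longrightarrow> s' y = s y"
  have "den n c (upd s' x 0 0 i) z a b =
      (if a = i \<and> b = 0 then F i else upd s' x 0 0 i z a b)" for a b
    using i IH frame assms(1) by (intro assms(2)) (auto simp: upd_apply upd_apply_table)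
  then show "\<forall>a b. den n c (upd s' x 0 0 i) z a b = (if a < Suc i \<and> b = 0 then F a else s z a b)"
    using IH assms(1) by (auto simp: upd_apply_table less_Suc_eq)
qed (use assms(1) in \<open>auto simp: upd_apply_table\<close>)

text \<open>Truncated subtraction is the only means of comparison: \<open>1 - a\<close> is 1 exactly
  if \<open>a\<close> is 0, and equality of \<open>a\<close> and \<open>b\<close> means that both
  truncated differences vanish.\<close>

definition Not_e :: "exp \<Rightarrow> exp" where
  "Not_e a = Minus (Lit 1) a"

definition And_e :: "exp \<Rightarrow> exp \<Rightarrow> exp" where
  "And_e a b = Minus (Lit 1) (Plus (Not_e a) (Not_e b))"

definition Eq_e :: "exp \<Rightarrow> exp \<Rightarrow> exp" where
  "Eq_e a b = Not_e (Plus (Minus a b) (Minus b a))"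

definition Le_e :: "exp \<Rightarrow> exp \<Rightarrow> exp" where
  "Le_e a b = Not_e (Minus a b)"

lemma eval_exp_bool:
  "eval_exp (Not_e a) s = (if eval_exp a s = 0 then 1 else 0)"
  "eval_exp (And_e a b) s = (if eval_exp a s \<noteq> 0 \<and> eval_exp b s \<noteq> 0 then 1 else 0)"
  "eval_exp (Eq_e a b) s = (if eval_exp a s = eval_exp b s then 1 else 0)"
  "eval_exp (Le_e a b) s = (if eval_exp a s \<le> eval_exp b s then 1 else 0)"
  by (auto simp: Not_e_def And_e_def Eq_e_def Le_e_def)

abbreviation Set_var :: "string \<Rightarrow> exp \<Rightarrow> lp" where
  "Set_var x e \<equiv> LAsg x (Lit 0) (Lit 0) e"

abbreviation Vec :: "string \<Rightarrow> string \<Rightarrow> exp" where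
  "Vec x i \<equiv> Cell x (Var i) (Lit 0)"

abbreviation Mat :: "string \<Rightarrow> string \<Rightarrow> string \<Rightarrow> exp" where
  "Mat x i j \<equiv> Cell x (Var i) (Var j)"

definition Exists :: "string \<Rightarrow> string \<Rightarrow> exp \<Rightarrow> lp" where
  "Exists b x e = LSeq (Set_var b (Lit 0)) (LFor x (LCond e (Set_var b (Lit 1)) LSkip))"

lemma writes_Exists: "writes (Exists b x e) = {b, x}"
  by (auto simp: Exists_def)

lemma wf_lp_Exists: "wf_lp (Exists b x e) \<longleftrightarrow> x \<noteq> ''n'' \<and> b \<noteq> ''n'' \<and> x \<noteq> b"
  by (auto simp: Exists_def)

lemma den_Exists:
  assumes "x \<noteq> b"
    and "\<And>i s'. i < n \<Longrightarrow> s' x 0 0 = i \<Longrightarrow> (\<And>y. y \<notin> {x, b} \<Longrightarrow> s' y = s y) \<Longrightarrow> eval_exp e s' \<noteq> 0 \<longleftrightarrow> R i"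
  shows "den n (Exists b x e) s b 0 0 = 0 \<longleftrightarrow> (\<forall>i < n. \<not> R i)"
proof -
  let ?s = "upd s b 0 0 0" and ?c = "LCond e (Set_var b (Lit 1)) LSkip"
  have "den n (LFor x ?c) ?s b 0 0 \<noteq> 0 \<longleftrightarrow> ?s b 0 0 \<noteq> 0 \<or> (\<exists>i < n. R i)"
  proof (rule den_LFor_flag[OF assms(1)])
    fix i s' assume "i < n" "s' x 0 0 = i" "\<And>y. y \<notin> insert x (writes ?c) \<Longrightarrow> s' y = ?s y"
    then have "eval_exp e s' \<noteq> 0 \<longleftrightarrow> R i"
      by (intro assms(2)) (auto simp: upd_apply_table)
    then show "den n ?c s' b 0 0 \<noteq> 0 \<longleftrightarrow> s' b 0 0 \<noteq> 0 \<or> R i"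
      by (auto simp: upd_apply)
  qed
  then show ?thesis
    by (auto simp: Exists_def upd_apply)
qed

section \<open>The program\<close>

text \<open>Breadth-first search from all vertices at once. Pass \<open>e\<close> reads entries
  equal to \<open>e + 1\<close> and writes only \<open>e + 2\<close> into empty cells, so updating
  the table in place does no harm.\<close>

definition levels_prog :: lp where
  "levels_prog =
    LSeq (LFor ''u'' (LFor ''v''
      (LAsg ''d'' (Var ''u'') (Var ''v'') (And_e (Vec ''W'' ''u'') (Eq_e (Var ''u'') (Var ''v''))))))
    (LFor ''e'' (LFor ''u'' (LFor ''v''
      (LSeq (Exists ''b'' ''w''
        (And_e (Eq_e (Mat ''d'' ''u'' ''w'') (Plus (Var ''e'') (Lit 1))) (Mat ''adj'' ''w'' ''v'')))
      (LCond (And_e (Var ''b'') (And_e (Vec ''W'' ''v'') (Not_e (Mat ''d'' ''u'' ''v''))))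
        (LAsg ''d'' (Var ''u'') (Var ''v'') (Plus (Var ''e'') (Lit 2))) LSkip)))))"

text \<open>\<open>E\<close> collects the ends of path components: \<open>b\<close> reports a
  collision between the levels of two different vertices reachable from \<open>u\<close>.\<close>

definition ends_prog :: lp where
  "ends_prog =
    LFor ''u''
      (LSeq (Set_var ''b'' (Lit 0))
      (LSeq (LFor ''v'' (LSeq (Exists ''h'' ''w''
          (And_e (Mat ''d'' ''u'' ''v'') (And_e (Eq_e (Mat ''d'' ''u'' ''v'') (Mat ''d'' ''u'' ''w''))
            (Not_e (Eq_e (Var ''v'') (Var ''w''))))))
          (LCond (Var ''h'') (Set_var ''b'' (Lit 1)) LSkip)))
        (LAsg ''E'' (Var ''u'') (Lit 0) (And_e (Vec ''W'' ''u'') (Not_e (Var ''b''))))))"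

text \<open>The machine has no remainder operation, so residues are tabulated by counting; the three
  equality tests subtract 3 when the counter would wrap. Writing at \<open>u + 1\<close> covers the
  indices up to and including \<open>n\<close>.\<close>

definition mod3_prog :: lp where
  "mod3_prog =
    LFor ''u'' (LAsg ''M'' (Plus (Var ''u'') (Lit 1)) (Lit 0)
      (Minus (Plus (Vec ''M'' ''u'') (Lit 1))
        (Plus (Eq_e (Vec ''M'' ''u'') (Lit 2))
          (Plus (Eq_e (Vec ''M'' ''u'') (Lit 2)) (Eq_e (Vec ''M'' ''u'') (Lit 2))))))"

text \<open>Levels are 0 outside the component of \<open>u\<close>, so for an end \<open>u\<close>
  of a path the maximum over all vertices is the number of vertices on that path.\<close>

definition max_prog :: lp where
  "max_prog = LSeq (Set_var ''m'' (Lit 0)) (LFor ''v''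
    (LCond (Le_e (Var ''m'') (Mat ''d'' ''u'' ''v'')) (Set_var ''m'' (Mat ''d'' ''u'' ''v'')) LSkip))"

text \<open>The expression \<open>2 - (M[m] = 1)\<close> is the residue selected by
  \<open>ex1_mod_3_neighbor\<close>. Deleting the path from \<open>W\<close> happens in the same
  sweep.\<close>

definition mark_prog :: lp where
  "mark_prog = LFor ''v'' (LCond (Mat ''d'' ''u'' ''v'')
    (LSeq (LAsg ''P'' (Var ''v'') (Lit 0) (Eq_e (Cell ''M'' (Mat ''d'' ''u'' ''v'') (Lit 0))
        (Minus (Lit 2) (Eq_e (Cell ''M'' (Var ''m'') (Lit 0)) (Lit 1)))))
      (LAsg ''W'' (Var ''v'') (Lit 0) (Lit 0)))
    LSkip)"

text \<open>A path with at least two vertices has two ends in \<open>E\<close>; the test of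
  \<open>W\<close> lets only the first of them act, since the path has left \<open>W\<close> by the
  time the second comes up.\<close>

definition paths_prog :: lp where
  "paths_prog = LFor ''u'' (LCond (And_e (Vec ''E'' ''u'') (Vec ''W'' ''u''))
    (LSeq max_prog mark_prog) LSkip)"

text \<open>The greedy choice takes the vertex with the smallest number in each component.\<close>

definition dist3_init_prog :: lp where
  "dist3_init_prog =
    LSeq (LFor ''v'' (LAsg ''D'' (Var ''v'') (Lit 0) (Lit 0)))
    (LFor ''v'' (LSeq (Exists ''b'' ''u'' (And_e (Vec ''D'' ''u'') (Mat ''d'' ''u'' ''v'')))
      (LCond (And_e (Vec ''W'' ''v'') (Not_e (Var ''b''))) (LAsg ''D'' (Var ''v'') (Lit 0) (Lit 1)) LSkip)))"

text \<open>The constants 3 and 4 are the distances 2 and 3 after the shift. Every vertex is tested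
  against the current \<open>D\<close>, including members added earlier in the same pass, so each
  single addition is a legal step of the procedure.\<close>

definition dist3_pass_prog :: lp where
  "dist3_pass_prog =
    LFor ''v''
      (LSeq (Exists ''b'' ''u'' (And_e (Vec ''D'' ''u'') (And_e (Mat ''d'' ''u'' ''v'') (Le_e (Mat ''d'' ''u'' ''v'') (Lit 3)))))
      (LSeq (Exists ''h'' ''u'' (And_e (Vec ''D'' ''u'') (Eq_e (Mat ''d'' ''u'' ''v'') (Lit 4))))
      (LCond (And_e (Vec ''W'' ''v'') (And_e (Not_e (Var ''b'')) (Var ''h'')))
        (LAsg ''D'' (Var ''v'') (Lit 0) (Lit 1)) LSkip)))"

definition color_prog :: "string \<Rightarrow> lp" where
  "color_prog x = LFor ''v'' (LCond (Vec x ''v'') (LAsg ''color'' (Var ''v'') (Lit 0) (Var ''i'')) LSkip)"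

definition remove_prog :: lp where
  "remove_prog =
    LFor ''v''
      (LSeq (Exists ''b'' ''u'' (And_e (Vec ''D'' ''u'') (And_e (Mat ''d'' ''u'' ''v'') (Le_e (Mat ''d'' ''u'' ''v'') (Lit 2)))))
      (LCond (Var ''b'') (LAsg ''W'' (Var ''v'') (Lit 0) (Lit 0)) LSkip))"

definition round_prog :: lp where
  "round_prog =
    LSeq (Exists ''b'' ''v'' (Vec ''W'' ''v''))
      (LCond (Var ''b'')
        (LSeq levels_prog (LSeq dist3_init_prog (LSeq (LFor ''r'' dist3_pass_prog)
          (LSeq (color_prog ''D'') (LSeq remove_prog (Set_var ''i'' (Plus (Var ''i'') (Lit 1)))))))) LSkip)"

definition body_prog :: lp where
  "body_prog = LSeq levels_prog (LSeq ends_prog (LSeq paths_prog round_prog))"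

definition init_prog :: lp where
  "init_prog = LSeq (Set_var ''i'' (Lit 1))
     (LSeq (LFor ''v'' (LAsg ''W'' (Var ''v'') (Lit 0) (Lit 1))) mod3_prog)"

definition elimination_prog :: lp where
  "elimination_prog = LSeq init_prog (LSeq (LFor ''q'' body_prog) (color_prog ''P''))"

lemmas prog_defs = levels_prog_def ends_prog_def mod3_prog_def max_prog_def mark_prog_def
  paths_prog_def dist3_init_prog_def dist3_pass_prog_def color_prog_def remove_prog_def
  round_prog_def body_prog_def init_prog_def elimination_prog_def

section \<open>Effects of the subprograms on tables of numbers\<close>

lemma wf_elimination_prog: "wf_lp elimination_prog"
  by (simp add: prog_defs wf_lp_Exists writes_Exists)

lemma writes_progs:
  "writes levels_prog = {''u'', ''v'', ''d'', ''e'', ''b'', ''w''}"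
  "writes ends_prog = {''u'', ''v'', ''E'', ''h'', ''b'', ''w''}"
  "writes max_prog = {''m'', ''v''}"
  "writes mark_prog = {''v'', ''P'', ''W''}"
  "writes paths_prog = {''u'', ''v'', ''P'', ''W'', ''m''}"
  "writes dist3_init_prog = {''D'', ''v'', ''u'', ''b''}"
  "writes dist3_pass_prog = {''D'', ''v'', ''u'', ''b'', ''h''}"
  "writes (color_prog x) = {''v'', ''color''}"
  "writes remove_prog = {''v'', ''u'', ''b'', ''W''}"
  "writes mod3_prog = {''u'', ''M''}"
  by (auto simp: prog_defs writes_Exists)

text \<open>Graphs are kept out of the loop analysis: any function \<open>L\<close> that satisfies
  the breadth-first recursion and is bounded by \<open>n\<close> is what the program
  computes.\<close>

lemma levels_prog_correct:
  fixes L :: "nat \<Rightarrow> nat \<Rightarrow> nat"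
  assumes L1: "\<And>i j. i < n \<Longrightarrow> j < n \<Longrightarrow> L i j = 1 \<longleftrightarrow> s ''W'' i 0 \<noteq> 0 \<and> i = j"
    and L2: "\<And>i j e. i < n \<Longrightarrow> j < n \<Longrightarrow> L i j = Suc (Suc e) \<longleftrightarrow>
      \<not> (0 < L i j \<and> L i j \<le> Suc e) \<and> s ''W'' j 0 \<noteq> 0 \<and> (\<exists>k < n. L i k = Suc e \<and> s ''adj'' k j \<noteq> 0)"
    and L3: "\<And>i j. i < n \<Longrightarrow> j < n \<Longrightarrow> L i j \<le> n"
    and ij: "i < n" "j < n"
  shows "den n levels_prog s ''d'' i j = L i j"
proof -
  \<comment> \<open>The table after \<open>e\<close> passes: values up to \<open>e + 1\<close> are
    final, larger ones are still 0.\<close>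
  define st where "st e i j = (if L i j \<le> Suc e then L i j else 0)" for e i j
  define c0 where "c0 = LFor ''v''
      (LAsg ''d'' (Var ''u'') (Var ''v'') (And_e (Vec ''W'' ''u'') (Eq_e (Var ''u'') (Var ''v''))))"
  define ex where "ex = Exists ''b'' ''w''
    (And_e (Eq_e (Mat ''d'' ''u'' ''w'') (Plus (Var ''e'') (Lit 1))) (Mat ''adj'' ''w'' ''v''))"
  define c3 where "c3 = LSeq ex
      (LCond (And_e (Var ''b'') (And_e (Vec ''W'' ''v'') (Not_e (Mat ''d'' ''u'' ''v''))))
        (LAsg ''d'' (Var ''u'') (Var ''v'') (Plus (Var ''e'') (Lit 2))) LSkip)"
  define I where "I e s' \<longleftrightarrow> (\<forall>i < n. \<forall>j < n. s' ''d'' i j = st e i j)" for e and s' :: memory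
  have w: "writes c0 = {''v'', ''d''}" "writes ex = {''b'', ''w''}" "writes c3 = {''d'', ''b'', ''w''}"
    by (auto simp: c0_def c3_def ex_def writes_Exists)
  have init: "I 0 (den n (LFor ''u'' c0) s)"
  proof (rule den_LFor_rule[where I = "\<lambda>k s'. \<forall>i < k. \<forall>j < n. s' ''d'' i j = st 0 i j"])
    fix k s' assume k: "k < n" and IH: "\<forall>i < k. \<forall>j < n. s' ''d'' i j = st 0 i j"
      and frame: "\<And>y. y \<notin> insert ''u'' (writes c0) \<Longrightarrow> s' y = s y"
    show "\<forall>i < Suc k. \<forall>j < n. den n c0 (upd s' ''u'' 0 0 k) ''d'' i j = st 0 i j"
      unfolding c0_def
    proof (rule den_LFor_rule[where I = "\<lambda>l s''. (\<forall>i < k. \<forall>j < n. s'' ''d'' i j = st 0 i j) \<and>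
          (\<forall>j < l. s'' ''d'' k j = st 0 k j)"], goal_cases)
      case 1
      then show ?case using IH by (simp add: upd_apply_table)
    next
      case (2 l s'')
      have "st 0 k l = (if s ''W'' k 0 \<noteq> 0 \<and> k = l then 1 else 0)"
        using L1[OF k 2(1)] by (auto simp: st_def le_Suc_eq)
      moreover have "s'' ''W'' = s ''W''" "s'' ''u'' 0 0 = k"
        using 2(3) frame by (auto simp: w upd_apply_table upd_apply)
      ultimately show ?case
        using 2(1,2) k by (auto simp: upd_apply eval_exp_bool less_Suc_eq)
    next
      case (3 s'')
      then show ?case by (auto simp: upd_apply_table less_Suc_eq)
    qed
  qed (auto simp: I_def upd_apply_table)
  have frame0: "den n (LFor ''u'' c0) s y = s y" if "y \<notin> {''u'', ''v'', ''d''}" for y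
    using that by (intro den_unchanged) (simp add: w)
  have cell: "den n c3 s' ''d'' a b = (if a = i \<and> b = j then st (Suc e) i j else s' ''d'' a b)"
    if ij: "i < n" "j < n" and u: "s' ''u'' 0 0 = i" "s' ''v'' 0 0 = j" "s' ''e'' 0 0 = e"
      and W: "s' ''W'' = s ''W''" "s' ''adj'' = s ''adj''"
      and row: "\<And>k. k < n \<Longrightarrow> s' ''d'' i k = st e i k \<or> s' ''d'' i k = st (Suc e) i k"
      and cur: "s' ''d'' i j = st e i j" for s' i j e a b
  proof -
    let ?s = "den n ex s'"
    have b: "?s ''b'' 0 0 = 0 \<longleftrightarrow> (\<forall>k < n. \<not> (L i k = Suc e \<and> s ''adj'' k j \<noteq> 0))"
      unfolding ex_def
    proof (rule den_Exists)
      fix k s'' assume k: "k < n" "s'' ''w'' 0 0 = k"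
        and frame: "\<And>y. y \<notin> {''w'', ''b''} \<Longrightarrow> s'' y = s' y"
      \<comment> \<open>In the middle of a pass an entry may be old or new, but the two versions
        agree on which entries equal \<open>e + 1\<close>.\<close>
      have "s' ''d'' i k = Suc e \<longleftrightarrow> L i k = Suc e"
        using row[OF k(1)] by (auto simp: st_def split: if_splits)
      then show "eval_exp (And_e (Eq_e (Mat ''d'' ''u'' ''w'') (Plus (Var ''e'') (Lit 1)))
          (Mat ''adj'' ''w'' ''v'')) s'' \<noteq> 0 \<longleftrightarrow> L i k = Suc e \<and> s ''adj'' k j \<noteq> 0"
        using k u W frame by (simp add: eval_exp_bool)
    qed simp
    have frame: "?s y = s' y" if "y \<notin> {''b'', ''w''}" for y
      using that by (intro den_unchanged) (simp add: w)
    have "st (Suc e) i j = (if st e i j = 0 \<and> s ''W'' j 0 \<noteq> 0 \<and> ?s ''b'' 0 0 \<noteq> 0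
        then Suc (Suc e) else st e i j)"
      using L2[OF ij, of e] unfolding b by (auto simp: st_def le_Suc_eq)
    then show ?thesis
      using u W cur frame by (auto simp: c3_def upd_apply eval_exp_bool)
  qed
  have step: "I (Suc e) (den n (LFor ''u'' (LFor ''v'' c3)) s1)"
    if e: "s1 ''e'' 0 0 = e" and W: "s1 ''W'' = s ''W''" "s1 ''adj'' = s ''adj''" and I: "I e s1" for e s1
  proof (rule den_LFor_rule[where I = "\<lambda>k s'. \<forall>i < n. \<forall>j < n.
      s' ''d'' i j = (if i < k then st (Suc e) i j else st e i j)"], goal_cases)
    case 1
    then show ?case using I by (simp add: I_def)
  next
    case (2 k s')
    show ?case
    proof (rule den_LFor_rule[where I = "\<lambda>l s'. \<forall>i < n. \<forall>j < n.
      s' ''d'' i j = (if i < k \<or> i = k \<and> j < l then st (Suc e) i j else st e i j)"], goal_cases)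
      case 1
      then show ?case using 2(2) by (simp add: upd_apply_table)
    next
      case (2 l s'')
      have "den n c3 (upd s'' ''v'' 0 0 l) ''d'' a b =
          (if a = k \<and> b = l then st (Suc e) k l else upd s'' ''v'' 0 0 l ''d'' a b)" for a b
      proof (rule cell)
        show "upd s'' ''v'' 0 0 l ''u'' 0 0 = k" "upd s'' ''v'' 0 0 l ''e'' 0 0 = e"
          "upd s'' ''v'' 0 0 l ''W'' = s ''W''" "upd s'' ''v'' 0 0 l ''adj'' = s ''adj''"
          using 2(3) \<open>\<And>y. y \<notin> insert ''u'' (writes (LFor ''v'' c3)) \<Longrightarrow> s' y = s1 y\<close> e W
          by (simp_all add: upd_apply upd_apply_table w)
      qed (use 2(1,2) \<open>k < n\<close> in \<open>auto simp: upd_apply_table upd_apply\<close>)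
      then show ?case using 2(2) by (auto simp: upd_apply_table less_Suc_eq)
    next
      case (3 s'')
      then show ?case by (auto simp: upd_apply_table less_Suc_eq)
    qed
  next
    case (3 s')
    then show ?case by (simp add: I_def upd_apply_table)
  qed
  have "den n levels_prog s = den n (LFor ''e'' (LFor ''u'' (LFor ''v'' c3))) (den n (LFor ''u'' c0) s)"
    by (simp add: levels_prog_def c0_def c3_def ex_def)
  moreover have "den n (LFor ''e'' (LFor ''u'' (LFor ''v'' c3))) (den n (LFor ''u'' c0) s) ''d'' i j = L i j"
  proof (rule den_LFor_rule[where I = I])
    show "I 0 (den n (LFor ''u'' c0) s)" by (rule init)
  next
    fix k s' assume "I k s'" and frame: "\<And>y. y \<notin> insert ''e'' (writes (LFor ''u'' (LFor ''v'' c3))) \<Longrightarrow>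
      s' y = den n (LFor ''u'' c0) s y"
    then show "I (Suc k) (den n (LFor ''u'' (LFor ''v'' c3)) (upd s' ''e'' 0 0 k))"
      by (intro step) (simp_all add: upd_apply upd_apply_table w frame0 I_def del: den.simps)
  next
    fix s' assume "I n s'"
    then show "upd s' ''e'' 0 0 n ''d'' i j = L i j"
      using ij L3[OF ij] by (simp add: I_def upd_apply_table st_def)
  qed
  ultimately show ?thesis by simp
qed

lemma ends_prog_correct:
  assumes "i < n"
  shows "den n ends_prog s ''E'' i 0 \<noteq> 0 \<longleftrightarrow> s ''W'' i 0 \<noteq> 0 \<and>
    \<not> (\<exists>j < n. \<exists>k < n. s ''d'' i j \<noteq> 0 \<and> s ''d'' i j = s ''d'' i k \<and> j \<noteq> k)"
proof -
  define R where "R i \<longleftrightarrow> (\<exists>j < n. \<exists>k < n. s ''d'' i j \<noteq> 0 \<and> s ''d'' i j = s ''d'' i k \<and> j \<noteq> k)" for i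
  define ex where "ex = Exists ''h'' ''w''
    (And_e (Mat ''d'' ''u'' ''v'') (And_e (Eq_e (Mat ''d'' ''u'' ''v'') (Mat ''d'' ''u'' ''w''))
      (Not_e (Eq_e (Var ''v'') (Var ''w'')))))"
  define c1 where "c1 = LSeq ex (LCond (Var ''h'') (Set_var ''b'' (Lit 1)) LSkip)"
  have w: "writes ex = {''h'', ''w''}" "writes c1 = {''h'', ''w'', ''b''}"
    by (auto simp: c1_def ex_def writes_Exists)
  have flag: "den n (LFor ''v'' c1) s1 ''b'' 0 0 \<noteq> 0 \<longleftrightarrow> s1 ''b'' 0 0 \<noteq> 0 \<or> R u"
    if d: "s1 ''d'' = s ''d''" and u: "s1 ''u'' 0 0 = u" for s1 u
    unfolding R_def
  proof (rule den_LFor_flag)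
    fix j s' assume j: "s' ''v'' 0 0 = j" and frame: "\<And>y. y \<notin> insert ''v'' (writes c1) \<Longrightarrow> s' y = s1 y"
    have "den n ex s' ''h'' 0 0 = 0 \<longleftrightarrow> (\<forall>k < n. \<not> (s ''d'' u j \<noteq> 0 \<and> s ''d'' u j = s ''d'' u k \<and> j \<noteq> k))"
      unfolding ex_def using d u j frame by (intro den_Exists) (auto simp: eval_exp_bool w)
    moreover have "den n ex s' ''b'' = s' ''b''"
      by (intro den_unchanged) (simp add: w)
    ultimately show "den n c1 s' ''b'' 0 0 \<noteq> 0 \<longleftrightarrow> s' ''b'' 0 0 \<noteq> 0 \<or>
        (\<exists>k < n. s ''d'' u j \<noteq> 0 \<and> s ''d'' u j = s ''d'' u k \<and> j \<noteq> k)"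
      by (auto simp: c1_def upd_apply)
  qed simp
  have frame1: "den n (LFor ''v'' c1) s1 y = s1 y" if "y \<notin> {''h'', ''w'', ''b'', ''v''}" for s1 y
    using that by (intro den_unchanged) (auto simp: w)
  have "den n ends_prog s ''E'' a b =
      (if a < n \<and> b = 0 then if s ''W'' a 0 \<noteq> 0 \<and> \<not> R a then 1 else 0 else s ''E'' a b)" for a b
    unfolding ends_prog_def c1_def[symmetric, unfolded ex_def]
  proof (rule den_LFor_map)
    fix u s' a b assume u: "s' ''u'' 0 0 = u"
      and frame: "\<And>y. y \<notin> insert ''u'' (writes (LSeq (Set_var ''b'' (Lit 0)) (LSeq (LFor ''v'' c1)
        (LAsg ''E'' (Var ''u'') (Lit 0) (And_e (Vec ''W'' ''u'') (Not_e (Var ''b''))))))) \<Longrightarrow> s' y = s y"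
    let ?s1 = "upd s' ''b'' 0 0 0"
    define s2 where "s2 = den n (LFor ''v'' c1) ?s1"
    have s2: "s2 ''b'' 0 0 \<noteq> 0 \<longleftrightarrow> R u" "s2 ''W'' = s ''W''" "s2 ''u'' 0 0 = u" "s2 ''E'' = s' ''E''"
      unfolding s2_def using flag[of ?s1 u] frame1[of _ ?s1] frame u
      by (simp_all add: upd_apply upd_apply_table w del: den.simps)
    have "den n (LSeq (Set_var ''b'' (Lit 0)) (LSeq (LFor ''v'' c1)
        (LAsg ''E'' (Var ''u'') (Lit 0) (And_e (Vec ''W'' ''u'') (Not_e (Var ''b'')))))) s' =
        upd s2 ''E'' u 0 (eval_exp (And_e (Vec ''W'' ''u'') (Not_e (Var ''b''))) s2)"
      using s2(3) by (simp add: s2_def del: den.simps(5))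
    then show "den n (LSeq (Set_var ''b'' (Lit 0)) (LSeq (LFor ''v'' c1)
        (LAsg ''E'' (Var ''u'') (Lit 0) (And_e (Vec ''W'' ''u'') (Not_e (Var ''b'')))))) s' ''E'' a b =
        (if a = u \<and> b = 0 then if s ''W'' u 0 \<noteq> 0 \<and> \<not> R u then 1 else 0 else s' ''E'' a b)"
      using s2 by (auto simp: upd_apply eval_exp_bool simp del: den.simps)
  qed simp
  then show ?thesis using assms by (simp add: R_def)
qed

lemma mod3_prog_correct:
  assumes "s ''M'' 0 0 = 0" "j \<le> n"
  shows "den n mod3_prog s ''M'' j 0 = j mod 3"
  unfolding mod3_prog_def
proof (rule den_LFor_rule[where I = "\<lambda>i s'. \<forall>j \<le> i. s' ''M'' j 0 = j mod 3"], goal_cases)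
  case (2 i s')
  have "i mod 3 < 3" by simp
  then show ?case using 2(2)
    by (auto simp: upd_apply upd_apply_table eval_exp_bool le_Suc_eq mod_Suc)
qed (use assms in \<open>auto simp: upd_apply_table\<close>)

lemma max_prog_correct:
  assumes "s ''u'' 0 0 = u" "u < n"
  defines "m \<equiv> den n max_prog s ''m'' 0 0"
  shows "j < n \<Longrightarrow> s ''d'' u j \<le> m" "\<exists>j < n. s ''d'' u j = m"
proof -
  have "(\<forall>j < n. s ''d'' u j \<le> m) \<and> (n = 0 \<and> m = 0 \<or> (\<exists>j < n. s ''d'' u j = m))"
    unfolding m_def max_prog_def den.simps(3)
  proof (rule den_LFor_rule[where I = "\<lambda>i s'. (\<forall>j < i. s ''d'' u j \<le> s' ''m'' 0 0) \<and>
      (i = 0 \<and> s' ''m'' 0 0 = 0 \<or> (\<exists>j < i. s ''d'' u j = s' ''m'' 0 0))"], goal_cases)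
    case (2 i s')
    have "s' ''u'' 0 0 = u" "s' ''d'' = s ''d''"
      using 2(3) assms(1) by (auto simp: upd_apply_table)
    then show ?case using 2(2)
      by (auto simp: upd_apply upd_apply_table eval_exp_bool less_Suc_eq intro: le_trans)
  qed (auto simp: upd_apply upd_apply_table)
  then show "j < n \<Longrightarrow> s ''d'' u j \<le> m" "\<exists>j < n. s ''d'' u j = m"
    using assms(2) by auto
qed

lemma mark_prog_correct:
  assumes "s ''u'' 0 0 = u" "s ''m'' 0 0 = m"
  shows "den n mark_prog s ''P'' a b = (if a < n \<and> b = 0 then
      (if s ''d'' u a \<noteq> 0
       then (if s ''M'' (s ''d'' u a) 0 = (if s ''M'' m 0 = 1 then 1 else 2) then 1 else 0)
       else s ''P'' a 0) else s ''P'' a b)"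
    and "den n mark_prog s ''W'' a b = (if a < n \<and> b = 0 then
      (if s ''d'' u a \<noteq> 0 then 0 else s ''W'' a 0) else s ''W'' a b)"
  unfolding mark_prog_def
proof (rule den_LFor_map, simp, goal_cases)
  case (1 i s' a b)
  then show ?case using assms by (auto simp: upd_apply upd_apply_table eval_exp_bool)
next
  case 2
  show ?case
  proof (rule den_LFor_map, simp, goal_cases)
    case (1 i s' a b)
    then show ?case using assms by (auto simp: upd_apply upd_apply_table eval_exp_bool)
  qed
qed

lemma color_prog_correct:
  assumes "x \<notin> {''v'', ''color''}"
  shows "den n (color_prog x) s ''color'' a b =
    (if a < n \<and> b = 0 then if s x a 0 \<noteq> 0 then s ''i'' 0 0 else s ''color'' a 0 else s ''color'' a b)"
  unfolding color_prog_def
proof (rule den_LFor_map, simp, goal_cases)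
  case (1 i s' a b)
  then show ?case using assms by (auto simp: upd_apply upd_apply_table)
qed

lemma remove_prog_correct:
  "den n remove_prog s ''W'' a b =
    (if a < n \<and> b = 0
     then if \<exists>u < n. s ''D'' u 0 \<noteq> 0 \<and> 0 < s ''d'' u a \<and> s ''d'' u a \<le> 2 then 0 else s ''W'' a 0
     else s ''W'' a b)"
proof -
  define R where "R i \<longleftrightarrow> (\<exists>u < n. s ''D'' u 0 \<noteq> 0 \<and> 0 < s ''d'' u i \<and> s ''d'' u i \<le> 2)" for i
  define ex where "ex = Exists ''b'' ''u''
    (And_e (Vec ''D'' ''u'') (And_e (Mat ''d'' ''u'' ''v'') (Le_e (Mat ''d'' ''u'' ''v'') (Lit 2))))"
  have w: "writes ex = {''b'', ''u''}"
    by (simp add: ex_def writes_Exists)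
  show ?thesis
    unfolding remove_prog_def ex_def[symmetric] R_def[symmetric]
  proof (rule den_LFor_map, simp, goal_cases)
    case (1 i s' a b)
    define s2 where "s2 = den n ex s'"
    have "s2 ''b'' 0 0 = 0 \<longleftrightarrow>
        (\<forall>u < n. \<not> (s ''D'' u 0 \<noteq> 0 \<and> 0 < s ''d'' u i \<and> s ''d'' u i \<le> 2))"
      unfolding ex_def s2_def using 1 by (intro den_Exists) (auto simp: eval_exp_bool w)
    then have "s2 ''b'' 0 0 = 0 \<longleftrightarrow> \<not> R i"
      by (auto simp: R_def)
    moreover have "s2 ''W'' = s' ''W''" "s2 ''v'' = s' ''v''"
      unfolding s2_def by (intro den_unchanged; simp add: w)+
    moreover have "s' ''W'' i 0 = s ''W'' i 0" "s' ''v'' 0 0 = i"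
      using 1 by simp_all
    ultimately show ?case
      by (auto simp: upd_apply s2_def[symmetric])
  qed
qed

section \<open>Correctness of the program\<close>

context graph
begin

text \<open>That is, \<open>C \<inter> S\<close> is a perfect code, or efficient dominating set, of
  the subgraph induced by \<open>S\<close>; it is the condition which \<open>elim_coloring\<close>
  imposes on the removed paths.\<close>

definition perfectly_dominates :: "'a set \<Rightarrow> 'a set \<Rightarrow> bool" where
  "perfectly_dominates C S \<longleftrightarrow> (\<forall>v \<in> S. \<exists>!w. w \<in> closed_nbhd (G \<restriction> S) v \<inter> C)"

lemma perfectly_dominates_cong:
  assumes "\<And>v. v \<in> S \<Longrightarrow> v \<in> C \<longleftrightarrow> v \<in> C'"
  shows "perfectly_dominates C S \<longleftrightarrow> perfectly_dominates C' S"
proof -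
  have "w \<in> closed_nbhd (G \<restriction> S) v \<inter> C \<longleftrightarrow> w \<in> closed_nbhd (G \<restriction> S) v \<inter> C'" if "v \<in> S" for v w
    using assms that by (auto simp: closed_nbhd_induce edges_on_def)
  then show ?thesis
    unfolding perfectly_dominates_def by simp
qed

definition far_from :: "'a set \<Rightarrow> 'a set \<Rightarrow> 'a \<Rightarrow> bool" where
  "far_from W D v \<longleftrightarrow> v \<in> W \<and> (\<forall>u \<in> D. \<not> (0 < level W u v \<and> level W u v \<le> 3))"

definition addable :: "'a set \<Rightarrow> 'a set \<Rightarrow> 'a \<Rightarrow> bool" where
  "addable W D v \<longleftrightarrow> far_from W D v \<and> (\<exists>u \<in> D. level W u v = 4)"

lemma dist3_partial_insert:
  assumes "W \<subseteq> verts G" "dist3_partial (G \<restriction> W) D" "addable W D v"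
  shows "dist3_partial (G \<restriction> W) (insert v D)"
proof (rule dist3_partial.add[OF assms(2)])
  have "D \<subseteq> W" using dist3_partial_props(1)[OF assms(2,1)] .
  then show "v \<in> verts (G \<restriction> W)" "\<forall>u \<in> D. 3 \<le> gdist (G \<restriction> W) u v" "\<exists>u \<in> D. gdist (G \<restriction> W) u v = 3"
    using assms(3) gdist_ge_3_level[OF assms(1)] gdist_eq_3_level[OF assms(1)]
    unfolding addable_def far_from_def by (simp, blast+)
qed

text \<open>Of all far vertices take one with minimal distance to \<open>D\<close>. If that distance exceeds 3, its
  predecessor on a shortest path is not far, which bounds the distance by 3.\<close>

lemma dist3_setI:
  assumes W: "W \<subseteq> verts G" and D: "dist3_partial (G \<restriction> W) D" and stable: "\<And>v. \<not> addable W D v"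
  shows "dist3_set (G \<restriction> W) D"
proof -
  note props = dist3_partial_props[OF D W]
  have "\<not> far_from W D v" for v
  proof
    assume far: "far_from W D v"
    let ?Q = "\<lambda>m. \<exists>u v. u \<in> D \<and> far_from W D v \<and> level W u v = m \<and> 0 < m"
    obtain u where "u \<in> D" "v \<in> comp_of W u"
      using props(3) far unfolding far_from_def by blast
    then have "?Q (level W u v)"
      using far level_pos props(1) by blast
    then have Q: "?Q (LEAST m. ?Q m)" by (rule LeastI)
    define m where "m = (LEAST m. ?Q m)"
    obtain u v where uv: "u \<in> D" "far_from W D v" "level W u v = m" "0 < m"
      using Q unfolding m_def by blast
    have least: "m \<le> level W u' v'" if "u' \<in> D" "far_from W D v'" "0 < level W u' v'" for u' v'
      unfolding m_def using that by (intro Least_le) blast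
    have "4 \<le> m"
      using uv unfolding far_from_def by fastforce
    moreover have "m \<noteq> 4"
      using uv stable unfolding addable_def by blast
    ultimately have l: "m = Suc (Suc (m - 2))" "4 < m" by simp_all
    define l where "l = m - 2"
    note l = l[folded l_def]
    obtain w where w: "(w, v) \<in> edges_on W" "level W u w = Suc l"
      using level_pred uv(3) l by metis
    have "\<not> far_from W D w"
      using least[of u w] uv w l by auto
    moreover have "w \<in> W" using w by (simp add: edges_on_def)
    ultimately obtain u' where u': "u' \<in> D" "0 < level W u' w" "level W u' w \<le> 3"
      unfolding far_from_def by blast
    then have "0 < level W u' v" "level W u' v \<le> 4"
      using level_step[OF w(1), of u'] by auto
    then show False
      using least[OF u'(1) uv(2)] l by simp
  qed
  then show ?thesis
    using D props(1) gdist_ge_3_level[OF W] unfolding dist3_set_def far_from_def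
    by (metis induce_subgraph_verts subsetD)
qed

end

section \<open>Numbered graphs and their representation in tables\<close>

locale numbered_graph = graph G for G :: "('a, 'b) pre_digraph" +
  fixes f :: "'a \<Rightarrow> nat"
  assumes bij: "bij_betw f (verts G) {..<card (verts G)}"
begin

abbreviation "n \<equiv> card (verts G)"

definition "g = inv_into (verts G) f"

lemma f_less: "v \<in> verts G \<Longrightarrow> f v < n"
  using bij by (auto simp: bij_betw_def)

lemma g_f: "v \<in> verts G \<Longrightarrow> g (f v) = v"
  using bij unfolding g_def by (simp add: bij_betw_def)

lemma g_in: "i < n \<Longrightarrow> g i \<in> verts G"
  using bij unfolding g_def by (auto simp: bij_betw_def intro!: inv_into_into)

lemma f_g: "i < n \<Longrightarrow> f (g i) = i"
  using bij unfolding g_def by (auto simp: bij_betw_def intro!: f_inv_into_f)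

lemma f_eq: "u \<in> verts G \<Longrightarrow> v \<in> verts G \<Longrightarrow> f u = f v \<longleftrightarrow> u = v"
  by (metis g_f)

lemma ex_index: "(\<exists>i < n. R i) \<longleftrightarrow> (\<exists>v \<in> verts G. R (f v))"
  using f_less f_g g_in by metis

lemma all_index: "(\<forall>i < n. R i) \<longleftrightarrow> (\<forall>v \<in> verts G. R (f v))"
  using f_less f_g g_in by metis

definition vset :: "memory \<Rightarrow> string \<Rightarrow> 'a set" where
  "vset s x = {v \<in> verts G. s x (f v) 0 \<noteq> 0}"

lemma vset_subset: "vset s x \<subseteq> verts G"
  by (auto simp: vset_def)

lemma vset_cong: "s x = s' x \<Longrightarrow> vset s x = vset s' x"
  by (simp add: vset_def)

definition adj_ok :: "memory \<Rightarrow> bool" where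
  "adj_ok s \<longleftrightarrow> (\<forall>u \<in> verts G. \<forall>v \<in> verts G. s ''adj'' (f u) (f v) \<noteq> 0 \<longleftrightarrow> u \<rightarrow>\<^bsub>G\<^esub> v)"

definition levels_ok :: "memory \<Rightarrow> 'a set \<Rightarrow> bool" where
  "levels_ok s W \<longleftrightarrow> (\<forall>u \<in> verts G. \<forall>v \<in> verts G. s ''d'' (f u) (f v) = level W u v)"

lemma levels_ok_den:
  assumes "adj_ok s" "vset s ''W'' = W"
  shows "levels_ok (den n levels_prog s) W"
proof -
  have W: "W \<subseteq> verts G" using assms(2) vset_subset by auto
  have in_W: "s ''W'' i 0 \<noteq> 0 \<longleftrightarrow> g i \<in> W" if "i < n" for i
    using that g_in f_g assms(2) by (auto simp: vset_def)
  have adj: "s ''adj'' i j \<noteq> 0 \<longleftrightarrow> g i \<rightarrow>\<^bsub>G\<^esub> g j" if "i < n" "j < n" for i j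
    using that g_in f_g assms(1) unfolding adj_ok_def by metis
  have "den n levels_prog s ''d'' i j = level W (g i) (g j)" if "i < n" "j < n" for i j
    using _ _ _ that
  proof (rule levels_prog_correct)
    fix i j assume ij: "i < n" "j < n"
    show "level W (g i) (g j) = 1 \<longleftrightarrow> s ''W'' i 0 \<noteq> 0 \<and> i = j"
      unfolding level_eq_1_iff in_W[OF ij(1)] using ij f_g by metis
    show "level W (g i) (g j) \<le> n"
      by (rule level_le_card[OF W])
    show "level W (g i) (g j) = Suc (Suc e) \<longleftrightarrow>
        \<not> (0 < level W (g i) (g j) \<and> level W (g i) (g j) \<le> Suc e) \<and> s ''W'' j 0 \<noteq> 0 \<and>
        (\<exists>k < n. level W (g i) (g k) = Suc e \<and> s ''adj'' k j \<noteq> 0)" for e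
    proof -
      have "(\<exists>w. level W (g i) w = Suc e \<and> (w, g j) \<in> edges_on W) \<longleftrightarrow>
          s ''W'' j 0 \<noteq> 0 \<and> (\<exists>w \<in> verts G. level W (g i) w = Suc e \<and> w \<rightarrow>\<^bsub>G\<^esub> g j)"
        unfolding in_W[OF ij(2)] using W level_zero_if_notin(1)[of _ W "g i"]
        by (auto simp: edges_on_def) (metis nat.distinct(1))
      also have "\<dots> \<longleftrightarrow> s ''W'' j 0 \<noteq> 0 \<and> (\<exists>k < n. level W (g i) (g k) = Suc e \<and> s ''adj'' k j \<noteq> 0)"
        unfolding ex_index using adj[OF f_less ij(2)] g_f by auto
      finally show ?thesis
        unfolding level_Suc_Suc_iff[of W "g i" "g j"] by simp
    qed
  qed
  then show ?thesis
    unfolding levels_ok_def using f_less g_f by metis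
qed

lemma level_nonzero_iff: "u \<in> W \<Longrightarrow> level W u v \<noteq> 0 \<longleftrightarrow> v \<in> comp_of W u"
  using level_eq_0_iff by auto

lemma vset_ends:
  assumes "levels_ok s W" "vset s ''W'' = W"
  shows "vset (den n ends_prog s) ''E'' = {u \<in> W. inj_on (level W u) (comp_of W u)}"
proof -
  have "u \<in> vset (den n ends_prog s) ''E'' \<longleftrightarrow> u \<in> W \<and> inj_on (level W u) (comp_of W u)"
    if u: "u \<in> verts G" for u
  proof -
    have "u \<in> vset (den n ends_prog s) ''E'' \<longleftrightarrow> u \<in> W \<and>
        \<not> (\<exists>x \<in> verts G. \<exists>y \<in> verts G. level W u x \<noteq> 0 \<and> level W u x = level W u y \<and> x \<noteq> y)"
      using u assms ends_prog_correct[OF f_less[OF u], of s]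
      unfolding ex_index levels_ok_def by (auto simp: vset_def f_eq)
    also have "\<dots> \<longleftrightarrow> u \<in> W \<and> inj_on (level W u) (comp_of W u)"
    proof -
      have "comp_of W u \<subseteq> verts G" if "u \<in> W"
        using comp_of_subset[OF that] assms(2) vset_subset by blast
      then show ?thesis
        using level_nonzero_iff[of u W] unfolding inj_on_def by (metis subsetD)
    qed
    finally show ?thesis .
  qed
  then show ?thesis
    using vset_subset assms(2) by blast
qed

text \<open>Entries of row \<open>f u\<close> are nonzero precisely on the component of
  \<open>u\<close>, so the two subprograms change \<open>W\<close> and \<open>P\<close> only
  there.\<close>

lemma path_body:
  assumes L: "levels_ok s W" and W: "W \<subseteq> verts G" and M: "\<And>j. j \<le> n \<Longrightarrow> s ''M'' j 0 = j mod 3"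
    and u: "u \<in> W" "s ''u'' 0 0 = f u" and inj: "inj_on (level W u) (comp_of W u)"
  defines "s' \<equiv> den n (LSeq max_prog mark_prog) s"
  shows "vset s' ''W'' = vset s ''W'' - comp_of W u"
    and "vset s' ''P'' - comp_of W u = vset s ''P'' - comp_of W u"
    and "perfectly_dominates (vset s' ''P'') (comp_of W u)"
proof -
  have uG: "u \<in> verts G" using u W by blast
  let ?s1 = "den n max_prog s"
  define m where "m = ?s1 ''m'' 0 0"
  have S: "comp_of W u \<subseteq> verts G" using comp_of_subset[OF u(1)] W by blast
  have frame: "?s1 y = s y" if "y \<notin> {''m'', ''v''}" for y
    using that by (intro den_unchanged) (simp add: writes_progs)
  have d: "s ''d'' (f u) (f v) = level W u v" if "v \<in> verts G" for v
    using L uG that by (simp add: levels_ok_def)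
  note max = max_prog_correct[of s "f u" n, OF u(2) f_less[OF uG], folded m_def]
  obtain t where t: "t \<in> verts G" "level W u t = m"
    using max(2) d unfolding ex_index by auto
  have le: "level W u v \<le> m" for v
  proof (cases "v \<in> verts G")
    case True
    then show ?thesis using max(1)[OF f_less] d by metis
  next
    case False
    then show ?thesis using level_zero_if_notin(1)[of v W u] W by (metis le0 subsetD)
  qed
  \<comment> \<open>Levels and their maximum \<open>m\<close> are used as indices into
    \<open>M\<close>, which contains residues only up to \<open>n\<close>.\<close>
  have "m \<le> n" using t level_le_card[OF W] by blast
  have s1: "?s1 ''u'' 0 0 = f u" "?s1 ''m'' 0 0 = m" "?s1 ''d'' = s ''d''" "?s1 ''M'' = s ''M''"
    "?s1 ''P'' = s ''P''" "?s1 ''W'' = s ''W''"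
    using u frame by (simp_all add: m_def)
  have s': "s' = den n mark_prog ?s1" by (simp add: s'_def)
  note mark = mark_prog_correct[of ?s1 "f u" m, OF s1(1,2), of n, folded s', unfolded s1]
  have W': "s' ''W'' (f v) 0 = (if v \<in> comp_of W u then 0 else s ''W'' (f v) 0)"
    if v: "v \<in> verts G" for v
    unfolding mark(2) using f_less[OF v] d[OF v] level_nonzero_iff[OF u(1), of v] by auto
  have P': "s' ''P'' (f v) 0 \<noteq> 0 \<longleftrightarrow> (if v \<in> comp_of W u
      then level W u v mod 3 = (if m mod 3 = 1 then 1 else 2) else s ''P'' (f v) 0 \<noteq> 0)"
    if v: "v \<in> verts G" for v
    unfolding mark(1) using f_less[OF v] d[OF v] level_nonzero_iff[OF u(1), of v]
      M[OF \<open>m \<le> n\<close>] M[OF level_le_card[OF W, of u v]] by auto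
  show "vset s' ''W'' = vset s ''W'' - comp_of W u"
    using W' by (auto simp: vset_def split: if_splits)
  show "vset s' ''P'' - comp_of W u = vset s ''P'' - comp_of W u"
    using P' by (auto simp: vset_def split: if_splits)
  show "perfectly_dominates (vset s' ''P'') (comp_of W u)"
    unfolding perfectly_dominates_def
  proof
    fix v assume "v \<in> comp_of W u"
    then show "\<exists>!w. w \<in> closed_nbhd (G \<restriction> comp_of W u) v \<inter> vset s' ''P''"
      using P' S by (intro path_component_selection[OF u(1) inj le t(2)]) (auto simp: vset_def)
  qed
qed

lemma paths_prog_correct:
  assumes L: "levels_ok s W" and W: "vset s ''W'' = W" and M: "\<And>j. j \<le> n \<Longrightarrow> s ''M'' j 0 = j mod 3"
    and E: "vset s ''E'' = {u \<in> W. inj_on (level W u) (comp_of W u)}"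
  defines "s' \<equiv> den n paths_prog s" and "Q \<equiv> path_components (G \<restriction> W)"
  shows "vset s' ''W'' = W - \<Union>Q"
    and "vset s' ''P'' - \<Union>Q = vset s ''P'' - \<Union>Q"
    and "\<forall>S \<in> Q. perfectly_dominates (vset s' ''P'') S"
proof -
  have WG: "W \<subseteq> verts G" using W vset_subset by auto
  \<comment> \<open>The path components that have an end numbered below \<open>i\<close>: those
    already treated when the loop arrives at \<open>i\<close>.\<close>
  define R where "R i = comp_of W ` {u \<in> vset s ''E''. f u < i}" for i
  have RQ: "R n = Q"
    unfolding R_def Q_def path_components_induce[OF WG] E using f_less WG by auto
  define c where "c = LCond (And_e (Vec ''E'' ''u'') (Vec ''W'' ''u'')) (LSeq max_prog mark_prog) LSkip"
  define I where "I i s' \<longleftrightarrow> vset s' ''W'' = W - \<Union> (R i) \<and>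
    vset s' ''P'' - \<Union> (R i) = vset s ''P'' - \<Union> (R i) \<and>
    (\<forall>S \<in> R i. perfectly_dominates (vset s' ''P'') S)" for i and s' :: memory
  have "I n (den n (LFor ''u'' c) s)"
  proof (rule den_LFor_rule[where I = I])
    show "I 0 s" by (simp add: I_def R_def W)
  next
    fix i s1 assume i: "i < n" and IH: "I i s1"
      and frame: "\<And>y. y \<notin> insert ''u'' (writes c) \<Longrightarrow> s1 y = s y"
    define u where "u = g i"
    have u: "u \<in> verts G" "f u = i" using i g_in f_g by (auto simp: u_def)
    let ?s1 = "upd s1 ''u'' 0 0 i"
    have s1: "?s1 ''E'' = s ''E''" "?s1 ''d'' = s ''d''" "?s1 ''M'' = s ''M''" "?s1 ''u'' 0 0 = i"
      "vset ?s1 ''W'' = vset s1 ''W''" "vset ?s1 ''P'' = vset s1 ''P''"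
      using frame by (simp_all add: c_def writes_progs upd_apply_table upd_apply vset_def)
    have IH': "vset ?s1 ''W'' = W - \<Union> (R i)"
      "vset ?s1 ''P'' - \<Union> (R i) = vset s ''P'' - \<Union> (R i)"
      "\<And>S. S \<in> R i \<Longrightarrow> perfectly_dominates (vset ?s1 ''P'') S"
      using IH unfolding I_def by (simp_all add: s1)
    have R_Suc: "R (Suc i) = (if u \<in> vset s ''E'' then insert (comp_of W u) (R i) else R i)"
    proof -
      have "{v \<in> vset s ''E''. f v < Suc i} =
          (if u \<in> vset s ''E'' then insert u {v \<in> vset s ''E''. f v < i} else {v \<in> vset s ''E''. f v < i})"
        using u f_eq vset_subset by (auto simp: less_Suc_eq vset_def)
      then show ?thesis unfolding R_def by simp
    qed
    have cond: "eval_exp (And_e (Vec ''E'' ''u'') (Vec ''W'' ''u'')) ?s1 \<noteq> 0 \<longleftrightarrow>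
        u \<in> vset s ''E'' \<and> u \<in> vset ?s1 ''W''"
      using u s1(1,4) by (auto simp: vset_def eval_exp_bool)
    show "I (Suc i) (den n c ?s1)"
    proof (cases "u \<in> vset s ''E'' \<and> u \<in> vset ?s1 ''W''")
      case True
      have uW: "u \<in> W" "inj_on (level W u) (comp_of W u)"
        using True E by auto
      let ?s2 = "den n (LSeq max_prog mark_prog) ?s1"
      have "levels_ok ?s1 W" using L s1(2) by (simp add: levels_ok_def)
      then have body: "vset ?s2 ''W'' = vset ?s1 ''W'' - comp_of W u"
        "vset ?s2 ''P'' - comp_of W u = vset ?s1 ''P'' - comp_of W u"
        "perfectly_dominates (vset ?s2 ''P'') (comp_of W u)"
        using path_body[of ?s1 W u] WG M uW s1 u by auto
      \<comment> \<open>Components are equal or disjoint, and \<open>u\<close>, being still in the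
        current \<open>W\<close>, lies in none of those treated before. So their marks
        survive.\<close>
      have disj: "S \<inter> comp_of W u = {}" if S: "S \<in> R i" for S
      proof -
        obtain v where v: "S = comp_of W v" using S by (auto simp: R_def)
        have "u \<notin> S" using True IH'(1) S by blast
        then show ?thesis using v comp_of_eqI comp_of_refl by (metis disjoint_iff)
      qed
      have "perfectly_dominates (vset ?s2 ''P'') S" if "S \<in> R i" for S
      proof -
        have "v \<in> vset ?s2 ''P'' \<longleftrightarrow> v \<in> vset ?s1 ''P''" if "v \<in> S" for v
          using body(2) disj[OF \<open>S \<in> R i\<close>] that by blast
        then show ?thesis
          using IH'(3)[OF that] perfectly_dominates_cong by blast
      qed
      then have "I (Suc i) ?s2"
        unfolding I_def R_Suc using True body IH'(1,2) by auto
      then show ?thesis using cond True by (simp add: c_def)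
    next
      case False
      \<comment> \<open>Either \<open>u\<close> is not an end, or its component was treated from the
        other end; in both cases no component is new.\<close>
      have "\<Union> (R (Suc i)) = \<Union> (R i) \<and> (\<forall>S \<in> R (Suc i). S \<in> R i)"
      proof (cases "u \<in> vset s ''E''")
        case True
        then have "u \<in> W" "u \<notin> vset ?s1 ''W''" using E False by auto
        then obtain v where "v \<in> vset s ''E''" "f v < i" "u \<in> comp_of W v"
          unfolding IH'(1) R_def by auto
        then have "comp_of W u \<in> R i"
          using comp_of_eqI unfolding R_def by blast
        then show ?thesis unfolding R_Suc by auto
      next
        case False
        then show ?thesis unfolding R_Suc by simp
      qed
      then have "I (Suc i) ?s1"
        unfolding I_def using IH' by auto
      then show ?thesis using cond False by (simp add: c_def)
    qed
  next
    fix s1 assume "I n s1"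
    moreover have "vset (upd s1 ''u'' 0 0 n) x = vset s1 x" if "x \<noteq> ''u''" for x
      using that by (intro vset_cong) (simp add: upd_apply_table)
    ultimately show "I n (upd s1 ''u'' 0 0 n)" by (simp add: I_def)
  qed
  then have "I n s'" by (simp add: s'_def paths_prog_def c_def)
  then show "vset s' ''W'' = W - \<Union>Q" "vset s' ''P'' - \<Union>Q = vset s ''P'' - \<Union>Q"
    "\<forall>S \<in> Q. perfectly_dominates (vset s' ''P'') S"
    unfolding I_def RQ by blast+
qed

lemma dist3_init_correct:
  assumes L: "levels_ok s W" and W: "vset s ''W'' = W"
  shows "dist3_partial (G \<restriction> W) (vset (den n dist3_init_prog s) ''D'')"
proof -
  have WG: "W \<subseteq> verts G" using W vset_subset by auto
  let ?ex = "Exists ''b'' ''u'' (And_e (Vec ''D'' ''u'') (Mat ''d'' ''u'' ''v''))"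
  define ex where "ex = ?ex"
  define c where "c = LSeq ex
    (LCond (And_e (Vec ''W'' ''v'') (Not_e (Var ''b''))) (LAsg ''D'' (Var ''v'') (Lit 0) (Lit 1)) LSkip)"
  have w: "writes ex = {''b'', ''u''}" "writes c = {''b'', ''u'', ''D''}"
    by (auto simp: ex_def c_def writes_Exists)
  define s0 where "s0 = den n (LFor ''v'' (LAsg ''D'' (Var ''v'') (Lit 0) (Lit 0))) s"
  have D0: "vset s0 ''D'' = {}"
  proof -
    have "s0 ''D'' a b = (if a < n \<and> b = 0 then 0 else s ''D'' a b)" for a b
      unfolding s0_def by (rule den_LFor_map) (auto simp: upd_apply)
    then show ?thesis using f_less by (auto simp: vset_def)
  qed
  have s0: "s0 y = s y" if "y \<notin> {''v'', ''D''}" for y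
    unfolding s0_def using that by (intro den_unchanged) auto
  define I where "I i s' \<longleftrightarrow> vset s' ''D'' \<subseteq> {w \<in> W. f w < i} \<and>
    (\<forall>u \<in> vset s' ''D''. \<forall>v \<in> vset s' ''D''. v \<in> comp_of W u \<longrightarrow> u = v) \<and>
    (\<forall>w \<in> W. f w < i \<longrightarrow> (\<exists>u \<in> vset s' ''D''. w \<in> comp_of W u))" for i and s' :: memory
  have "I n (den n (LFor ''v'' c) s0)"
  proof (rule den_LFor_rule[where I = I])
    show "I 0 s0" by (simp add: I_def D0)
  next
    fix i s1 assume i: "i < n" and IH: "I i s1"
      and frame: "\<And>y. y \<notin> insert ''v'' (writes c) \<Longrightarrow> s1 y = s0 y"
    define v where "v = g i"
    have v: "v \<in> verts G" "f v = i" using i g_in f_g by (auto simp: v_def)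
    let ?s1 = "upd s1 ''v'' 0 0 i"
    define D where "D = vset s1 ''D''"
    have s1: "?s1 ''d'' = s ''d''" "?s1 ''W'' = s ''W''" "?s1 ''v'' 0 0 = i" "?s1 ''D'' = s1 ''D''"
      using frame s0 by (auto simp: w upd_apply_table upd_apply)
    define s2 where "s2 = den n ex ?s1"
    have "s2 ''b'' 0 0 = 0 \<longleftrightarrow> (\<forall>k < n. \<not> (s1 ''D'' k 0 \<noteq> 0 \<and> s ''d'' k i \<noteq> 0))"
      unfolding s2_def ex_def using s1 by (intro den_Exists) (auto simp: eval_exp_bool)
    also have "\<dots> \<longleftrightarrow> (\<forall>u \<in> D. v \<notin> comp_of W u)"
    proof -
      have "s ''d'' (f u) i \<noteq> 0 \<longleftrightarrow> v \<in> comp_of W u" if "u \<in> D" for u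
      proof -
        have "u \<in> W" using IH that unfolding I_def D_def by blast
        then show ?thesis
          using L v WG level_nonzero_iff[of u W v] unfolding levels_ok_def by (metis subsetD)
      qed
      moreover have "u \<in> D \<longleftrightarrow> u \<in> verts G \<and> s1 ''D'' (f u) 0 \<noteq> 0" for u
        by (simp add: D_def vset_def)
      ultimately show ?thesis
        unfolding all_index by blast
    qed
    finally have b: "s2 ''b'' 0 0 = 0 \<longleftrightarrow> (\<forall>u \<in> D. v \<notin> comp_of W u)" .
    have s2: "s2 ''W'' = s ''W''" "s2 ''v'' 0 0 = i" "s2 ''D'' = s1 ''D''"
      using s1 unfolding s2_def by (auto simp: den_unchanged w)
    have vW: "s ''W'' i 0 \<noteq> 0 \<longleftrightarrow> v \<in> W"
      using W v by (auto simp: vset_def)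
    have den: "den n c ?s1 = (if v \<in> W \<and> (\<forall>u \<in> D. v \<notin> comp_of W u) then upd s2 ''D'' i 0 1 else s2)"
      using s2 b vW by (auto simp: c_def s2_def[symmetric] eval_exp_bool)
    have D': "vset (den n c ?s1) ''D'' =
        (if v \<in> W \<and> (\<forall>u \<in> D. v \<notin> comp_of W u) then insert v D else D)"
      unfolding den D_def vset_def using s2(3) v f_eq[OF _ v(1)] by (auto simp: upd_apply)
    have IH': "D \<subseteq> {w \<in> W. f w < i}"
      "\<And>u v. u \<in> D \<Longrightarrow> v \<in> D \<Longrightarrow> v \<in> comp_of W u \<Longrightarrow> u = v"
      "\<And>w. w \<in> W \<Longrightarrow> f w < i \<Longrightarrow> \<exists>u \<in> D. w \<in> comp_of W u"
      using IH unfolding I_def D_def by blast+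
    have last: "w = v" if "w \<in> W" "f w < Suc i" "\<not> f w < i" for w
      using that v f_eq[of w v] WG by auto
    show "I (Suc i) (den n c ?s1)"
    proof (cases "v \<in> W \<and> (\<forall>u \<in> D. v \<notin> comp_of W u)")
      case True
      have "u \<notin> comp_of W v" if "u \<in> D" for u
        using True that comp_of_eqI comp_of_refl by metis
      then have "\<forall>u \<in> insert v D. \<forall>w \<in> insert v D. w \<in> comp_of W u \<longrightarrow> u = w"
        using True IH'(2) by blast
      moreover have "\<forall>w \<in> W. f w < Suc i \<longrightarrow> (\<exists>u \<in> insert v D. w \<in> comp_of W u)"
        using last IH'(3) comp_of_refl by (metis insertCI)
      ultimately show ?thesis
        unfolding I_def D' using True IH'(1) v by auto
    next
      case False
      have "\<forall>w \<in> W. f w < Suc i \<longrightarrow> (\<exists>u \<in> D. w \<in> comp_of W u)"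
        using last IH'(3) False by metis
      then show ?thesis
        unfolding I_def D' if_not_P[OF False] using IH'(1,2) by auto
    qed
  next
    fix s1 assume "I n s1"
    moreover have "vset (upd s1 ''v'' 0 0 n) ''D'' = vset s1 ''D''"
      by (intro vset_cong) (simp add: upd_apply_table)
    ultimately show "I n (upd s1 ''v'' 0 0 n)" by (simp add: I_def)
  qed
  then have I: "I n (den n dist3_init_prog s)"
    by (simp add: dist3_init_prog_def c_def ex_def s0_def)
  define D where "D = vset (den n dist3_init_prog s) ''D''"
  have D: "D \<subseteq> W" "\<And>u v. u \<in> D \<Longrightarrow> v \<in> D \<Longrightarrow> v \<in> comp_of W u \<Longrightarrow> u = v"
    "\<And>w. w \<in> W \<Longrightarrow> \<exists>u \<in> D. w \<in> comp_of W u"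
    using I f_less WG unfolding I_def D_def by blast+
  have "\<exists>!v. v \<in> D \<inter> comp_of W a" if a: "a \<in> W" for a
  proof -
    obtain u where u: "u \<in> D" "a \<in> comp_of W u" using D(3)[OF a] by blast
    then have "comp_of W a = comp_of W u" using comp_of_eqI by blast
    then show ?thesis using u D(2) comp_of_refl by (metis Int_iff)
  qed
  then show ?thesis
    unfolding D_def[symmetric] using D(1) sccs_verts_induce[OF WG] by (intro dist3_partial.init) auto
qed

text \<open>The third conclusion makes an idle pass a certificate of maximality: \<open>D\<close>
  stays the same until the first vertex addable to the original \<open>D\<close> is met, and that
  vertex is then added.\<close>

lemma dist3_pass_correct:
  assumes L: "levels_ok s W" and W: "vset s ''W'' = W" and D: "dist3_partial (G \<restriction> W) (vset s ''D'')"
  defines "D' \<equiv> vset (den n dist3_pass_prog s) ''D''"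
  shows "dist3_partial (G \<restriction> W) D'" "vset s ''D'' \<subseteq> D'"
    "D' = vset s ''D'' \<longleftrightarrow> (\<forall>v. \<not> addable W (vset s ''D'') v)"
proof -
  have WG: "W \<subseteq> verts G" using W vset_subset by auto
  define D\<^sub>0 where "D\<^sub>0 = vset s ''D''"
  define ex1 where "ex1 = Exists ''b'' ''u''
    (And_e (Vec ''D'' ''u'') (And_e (Mat ''d'' ''u'' ''v'') (Le_e (Mat ''d'' ''u'' ''v'') (Lit 3))))"
  define ex2 where "ex2 = Exists ''h'' ''u'' (And_e (Vec ''D'' ''u'') (Eq_e (Mat ''d'' ''u'' ''v'') (Lit 4)))"
  define c where "c = LSeq ex1 (LSeq ex2
    (LCond (And_e (Vec ''W'' ''v'') (And_e (Not_e (Var ''b'')) (Var ''h'')))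
      (LAsg ''D'' (Var ''v'') (Lit 0) (Lit 1)) LSkip))"
  have w: "writes ex1 = {''b'', ''u''}" "writes ex2 = {''h'', ''u''}" "writes c = {''b'', ''h'', ''u'', ''D''}"
    by (auto simp: ex1_def ex2_def c_def writes_Exists)
  define I where "I i s' \<longleftrightarrow> dist3_partial (G \<restriction> W) (vset s' ''D'') \<and> D\<^sub>0 \<subseteq> vset s' ''D'' \<and>
    (vset s' ''D'' = D\<^sub>0 \<longleftrightarrow> (\<forall>v. addable W D\<^sub>0 v \<longrightarrow> i \<le> f v))" for i and s' :: memory
  have "I n (den n (LFor ''v'' c) s)"
  proof (rule den_LFor_rule[where I = I])
    show "I 0 s" using D by (simp add: I_def D\<^sub>0_def)
  next
    fix i s1 assume i: "i < n" and IH: "I i s1"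
      and frame: "\<And>y. y \<notin> insert ''v'' (writes c) \<Longrightarrow> s1 y = s y"
    define v where "v = g i"
    have v: "v \<in> verts G" "f v = i" using i g_in f_g by (auto simp: v_def)
    let ?s1 = "upd s1 ''v'' 0 0 i"
    define D\<^sub>1 where "D\<^sub>1 = vset s1 ''D''"
    have IH': "dist3_partial (G \<restriction> W) D\<^sub>1" "D\<^sub>0 \<subseteq> D\<^sub>1"
      "D\<^sub>1 = D\<^sub>0 \<longleftrightarrow> (\<forall>v. addable W D\<^sub>0 v \<longrightarrow> i \<le> f v)"
      using IH unfolding I_def D\<^sub>1_def by blast+
    have D1W: "D\<^sub>1 \<subseteq> W" using dist3_partial_props(1)[OF IH'(1) WG] .
    have s1: "?s1 ''d'' = s ''d''" "?s1 ''W'' = s ''W''" "?s1 ''v'' 0 0 = i" "?s1 ''D'' = s1 ''D''"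
      using frame by (auto simp: w upd_apply_table upd_apply)
    have d: "s ''d'' (f u) i = level W u v" if "u \<in> verts G" for u
      using L that v by (auto simp: levels_ok_def)
    define s2 where "s2 = den n ex1 ?s1"
    have s2: "s2 ''W'' = s ''W''" "s2 ''v'' 0 0 = i" "s2 ''D'' = s1 ''D''" "s2 ''d'' = s ''d''"
      using s1 unfolding s2_def by (auto simp: den_unchanged w)
    have b: "s2 ''b'' 0 0 = 0 \<longleftrightarrow> (\<forall>u \<in> D\<^sub>1. \<not> (0 < level W u v \<and> level W u v \<le> 3))"
    proof -
      have "s2 ''b'' 0 0 = 0 \<longleftrightarrow> (\<forall>k < n. \<not> (s1 ''D'' k 0 \<noteq> 0 \<and> 0 < s ''d'' k i \<and> s ''d'' k i \<le> 3))"
        unfolding s2_def ex1_def using s1 by (intro den_Exists) (auto simp: eval_exp_bool)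
      also have "\<dots> \<longleftrightarrow> (\<forall>u \<in> D\<^sub>1. \<not> (0 < level W u v \<and> level W u v \<le> 3))"
        unfolding all_index D\<^sub>1_def vset_def using d by auto
      finally show ?thesis .
    qed
    define s3 where "s3 = den n ex2 s2"
    have s3: "s3 ''W'' = s ''W''" "s3 ''v'' 0 0 = i" "s3 ''D'' = s1 ''D''" "s3 ''b'' = s2 ''b''"
      using s2 unfolding s3_def by (auto simp: den_unchanged w)
    have h: "s3 ''h'' 0 0 = 0 \<longleftrightarrow> \<not> (\<exists>u \<in> D\<^sub>1. level W u v = 4)"
    proof -
      have "s3 ''h'' 0 0 = 0 \<longleftrightarrow> (\<forall>k < n. \<not> (s1 ''D'' k 0 \<noteq> 0 \<and> s ''d'' k i = 4))"
        unfolding s3_def ex2_def using s2 by (intro den_Exists) (auto simp: eval_exp_bool)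
      also have "\<dots> \<longleftrightarrow> \<not> (\<exists>u \<in> D\<^sub>1. level W u v = 4)"
        unfolding all_index D\<^sub>1_def vset_def using d by auto
      finally show ?thesis .
    qed
    have vW: "s ''W'' i 0 \<noteq> 0 \<longleftrightarrow> v \<in> W"
      using W v by (auto simp: vset_def)
    have add: "addable W D\<^sub>1 v \<longleftrightarrow> s ''W'' i 0 \<noteq> 0 \<and> s2 ''b'' 0 0 = 0 \<and> s3 ''h'' 0 0 \<noteq> 0"
      unfolding addable_def far_from_def vW b using h by auto
    have den: "den n c ?s1 = (if addable W D\<^sub>1 v then upd s3 ''D'' i 0 1 else s3)"
      unfolding add using s3 by (simp add: c_def s2_def[symmetric] s3_def[symmetric] eval_exp_bool)
    have D2: "vset (den n c ?s1) ''D'' = (if addable W D\<^sub>1 v then insert v D\<^sub>1 else D\<^sub>1)"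
      unfolding den D\<^sub>1_def vset_def using s3(3) v f_eq[OF _ v(1)] by (auto simp: upd_apply)
    have only_v: "w = v" if "addable W D\<^sub>0 w" "f w = i" for w
      using that v f_eq[of w v] WG by (auto simp: addable_def far_from_def)
    show "I (Suc i) (den n c ?s1)"
    proof (cases "addable W D\<^sub>1 v")
      case True
      then have "v \<notin> D\<^sub>1"
        using D1W level_eq_1_iff[of W v v] unfolding addable_def far_from_def by force
      \<comment> \<open>If nothing was added so far, \<open>v\<close> itself is addable to the
        original set; otherwise the invariant supplies a vertex of smaller number.\<close>
      moreover have "\<exists>w. addable W D\<^sub>0 w \<and> \<not> Suc i \<le> f w"
        using True IH'(3) v by (metis not_less_eq_eq le_refl le_SucI)
      ultimately show ?thesis
        unfolding I_def D2 if_P[OF True] using IH'(2) dist3_partial_insert[OF WG IH'(1) True] by blast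
    next
      case False
      have "D\<^sub>1 = D\<^sub>0 \<longleftrightarrow> (\<forall>v. addable W D\<^sub>0 v \<longrightarrow> Suc i \<le> f v)"
        using IH'(3) False only_v by (metis Suc_leD le_neq_implies_less Suc_leI)
      then show ?thesis
        unfolding I_def D2 if_not_P[OF False] using IH'(1,2) by blast
    qed
  next
    fix s1 assume "I n s1"
    moreover have "vset (upd s1 ''v'' 0 0 n) ''D'' = vset s1 ''D''"
      by (intro vset_cong) (simp add: upd_apply_table)
    ultimately show "I n (upd s1 ''v'' 0 0 n)" by (simp add: I_def)
  qed
  then have I: "I n (den n dist3_pass_prog s)"
    by (simp add: dist3_pass_prog_def c_def ex1_def ex2_def)
  moreover have "f v < n" if "addable W D\<^sub>0 v" for v
    using that WG f_less by (auto simp: addable_def far_from_def)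
  ultimately show "dist3_partial (G \<restriction> W) D'" "vset s ''D'' \<subseteq> D'"
    "D' = vset s ''D'' \<longleftrightarrow> (\<forall>v. \<not> addable W (vset s ''D'') v)"
    unfolding I_def D'_def D\<^sub>0_def using leD by blast+
qed

text \<open>Each pass enlarges \<open>D\<close> unless no vertex is addable any more. After
  \<open>n\<close> passes either nothing is addable, or \<open>D\<close> consists of all vertices,
  and then nothing can be addable either.\<close>

lemma dist3_loop_correct:
  assumes L: "levels_ok s W" and W: "vset s ''W'' = W" and D: "dist3_partial (G \<restriction> W) (vset s ''D'')"
  shows "dist3_set (G \<restriction> W) (vset (den n (LFor ''r'' dist3_pass_prog) s) ''D'')"
proof -
  have WG: "W \<subseteq> verts G" using W vset_subset by auto
  define I where "I i s' \<longleftrightarrow> dist3_partial (G \<restriction> W) (vset s' ''D'') \<and>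
    ((\<forall>v. \<not> addable W (vset s' ''D'') v) \<or> i \<le> card (vset s' ''D''))" for i and s' :: memory
  have "I n (den n (LFor ''r'' dist3_pass_prog) s)"
  proof (rule den_LFor_rule[where I = I])
    show "I 0 s" using D by (simp add: I_def)
  next
    fix i s1 assume IH: "I i s1"
      and frame: "\<And>y. y \<notin> insert ''r'' (writes dist3_pass_prog) \<Longrightarrow> s1 y = s y"
    let ?s1 = "upd s1 ''r'' 0 0 i"
    have s1: "levels_ok ?s1 W" "vset ?s1 ''W'' = W" "vset ?s1 ''D'' = vset s1 ''D''"
      using frame L W by (auto simp: writes_progs upd_apply_table levels_ok_def vset_def)
    define D' where "D' = vset (den n dist3_pass_prog ?s1) ''D''"
    have "dist3_partial (G \<restriction> W) (vset ?s1 ''D'')"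
      using IH s1(3) by (simp add: I_def)
    from dist3_pass_correct[OF s1(1,2) this]
    have pass: "dist3_partial (G \<restriction> W) D'" "vset s1 ''D'' \<subseteq> D'"
      "D' = vset s1 ''D'' \<longleftrightarrow> (\<forall>v. \<not> addable W (vset s1 ''D'') v)"
      unfolding D'_def s1(3) by blast+
    show "I (Suc i) (den n dist3_pass_prog ?s1)"
    proof (cases "\<forall>v. \<not> addable W (vset s1 ''D'') v")
      case True
      then have "D' = vset s1 ''D''" using pass(3) by blast
      then show ?thesis using True pass(1) unfolding I_def D'_def[symmetric] by simp
    next
      case False
      have "finite D'"
        using vset_subset finite_verts unfolding D'_def by (meson finite_subset)
      moreover have "vset s1 ''D'' \<subset> D'" using pass(2,3) False by blast
      ultimately have "card (vset s1 ''D'') < card D'" by (rule psubset_card_mono)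
      then show ?thesis
        using pass(1) IH False unfolding I_def D'_def[symmetric] by auto
    qed
  next
    fix s1 assume "I n s1"
    moreover have "vset (upd s1 ''r'' 0 0 n) ''D'' = vset s1 ''D''"
      by (intro vset_cong) (simp add: upd_apply_table)
    ultimately show "I n (upd s1 ''r'' 0 0 n)" by (simp add: I_def)
  qed
  define D' where "D' = vset (den n (LFor ''r'' dist3_pass_prog) s) ''D''"
  have partial: "dist3_partial (G \<restriction> W) D'" and stable: "(\<forall>v. \<not> addable W D' v) \<or> n \<le> card D'"
    using \<open>I n _\<close> unfolding I_def D'_def by blast+
  have "\<not> addable W D' v" for v
  proof (cases "n \<le> card D'")
    case True
    then have "D' = verts G"
      using vset_subset by (intro card_seteq) (auto simp: D'_def)
    then show ?thesis
      using level_eq_1_iff[of W v v] WG unfolding addable_def far_from_def by force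
  qed (use stable in blast)
  then show ?thesis
    unfolding D'_def[symmetric] by (rule dist3_setI[OF WG partial])
qed

lemma coloring_output_cong:
  assumes "s ''color'' = s' ''color''"
  shows "coloring_output G f s = coloring_output G f s'"
  unfolding coloring_output_def assms ..

lemma coloring_output_color_prog:
  assumes "x \<notin> {''v'', ''color''}" "s ''i'' 0 0 \<noteq> 0"
  shows "coloring_output G f (den n (color_prog x) s) =
    (\<lambda>v. if v \<in> vset s x then Some (s ''i'' 0 0) else coloring_output G f s v)"
  using assms(2) f_less by (auto simp: color_prog_correct[OF assms(1)] coloring_output_def vset_def fun_eq_iff)

definition table_ok :: "memory \<Rightarrow> 'a set set \<Rightarrow> bool" where
  "table_ok s P \<longleftrightarrow> adj_ok s \<and> (\<forall>j \<le> n. s ''M'' j 0 = j mod 3) \<and>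
     vset s ''P'' \<subseteq> \<Union>P \<and> (\<forall>S \<in> P. perfectly_dominates (vset s ''P'') S)"

lemma table_ok_cong:
  assumes "table_ok s P" "s' ''adj'' = s ''adj''" "s' ''M'' = s ''M''" "s' ''P'' = s ''P''"
  shows "table_ok s' P"
  using assms unfolding table_ok_def adj_ok_def vset_def by simp

text \<open>The procedure removes path components at the end of a round, the program at the
  beginning of the next one. Hence the memory lags behind: \<open>P\<close> contains the paths
  already treated, and the path components of the stored \<open>W\<close> are still pending although
  the matching configuration of \<open>elim_reach\<close> has removed them.\<close>

definition state_ok :: "memory \<Rightarrow> 'a set set \<Rightarrow> bool" where
  "state_ok s P \<longleftrightarrow> table_ok s P \<and> \<Union>P \<inter> vset s ''W'' = {} \<and>
     elim_reach G (vset s ''W'' - \<Union> (path_components (G \<restriction> vset s ''W''))) (s ''i'' 0 0)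
       (coloring_output G f s) (P \<union> path_components (G \<restriction> vset s ''W''))"

lemma path_components_empty: "path_components (G \<restriction> {}) = {}"
  using path_components_induce[of "{}"] by simp

text \<open>The outer loop always makes \<open>n\<close> passes, so a round on an empty
  \<open>W\<close> has to be harmless. Any other round removes at least the nonempty set
  \<open>D\<close>.\<close>

lemma round_prog_correct:
  assumes tab: "table_ok s P" and reach: "elim_reach G (vset s ''W'') (s ''i'' 0 0) (coloring_output G f s) P"
  defines "s' \<equiv> den n round_prog s"
  shows "state_ok s' P"
    and "vset s ''W'' = {} \<Longrightarrow> vset s' ''W'' = {}"
    and "vset s ''W'' \<noteq> {} \<Longrightarrow> card (vset s' ''W'') < card (vset s ''W'')"
proof -
  define W where "W = vset s ''W''"
  have WG: "W \<subseteq> verts G" using vset_subset by (simp add: W_def)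
  have disj: "\<Union>P \<inter> W = {}" and i: "1 \<le> s ''i'' 0 0"
    using elim_reach_props[OF reach] unfolding W_def by - (elim conjE, assumption)+
  define s1 where "s1 = den n (Exists ''b'' ''v'' (Vec ''W'' ''v'')) s"
  have s1: "s1 y = s y" if "y \<notin> {''b'', ''v''}" for y
    unfolding s1_def using that by (intro den_unchanged) (simp add: writes_Exists)
  have "s1 ''b'' 0 0 = 0 \<longleftrightarrow> (\<forall>k < n. \<not> s ''W'' k 0 \<noteq> 0)"
    unfolding s1_def by (intro den_Exists) auto
  then have b: "s1 ''b'' 0 0 = 0 \<longleftrightarrow> W = {}"
    unfolding all_index W_def vset_def by auto
  have goal: "state_ok s' P \<and> (W = {} \<longrightarrow> vset s' ''W'' = {}) \<and>
    (W \<noteq> {} \<longrightarrow> card (vset s' ''W'') < card W)"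
  proof (cases "W = {}")
    case True
    then have s': "s' = s1"
      using b by (simp add: s'_def round_prog_def s1_def)
    have W': "vset s' ''W'' = {}"
      using True s1[of "''W''"] by (simp add: s' W_def vset_def)
    moreover have "table_ok s' P"
      using tab s1 unfolding s' by (intro table_ok_cong[OF tab]) simp_all
    moreover have "coloring_output G f s' = coloring_output G f s" "s' ''i'' = s ''i''"
      using s1 unfolding s' by (auto intro: coloring_output_cong)
    ultimately show ?thesis
      using reach True disj unfolding state_ok_def W' path_components_empty W_def by simp
  next
    case False
    define s2 where "s2 = den n levels_prog s1"
    define s3 where "s3 = den n dist3_init_prog s2"
    define s4 where "s4 = den n (LFor ''r'' dist3_pass_prog) s3"
    define s5 where "s5 = den n (color_prog ''D'') s4"
    define s6 where "s6 = den n remove_prog s5"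
    define D where "D = vset s4 ''D''"
    have s2: "s2 y = s1 y" if "y \<notin> {''u'', ''v'', ''d'', ''e'', ''b'', ''w''}" for y
      unfolding s2_def using that by (intro den_unchanged) (simp add: writes_progs)
    have s3: "s3 y = s2 y" if "y \<notin> {''D'', ''v'', ''u'', ''b''}" for y
      unfolding s3_def using that by (intro den_unchanged) (simp add: writes_progs)
    have s4: "s4 y = s3 y" if "y \<notin> {''r'', ''D'', ''v'', ''u'', ''b'', ''h''}" for y
      unfolding s4_def using that by (intro den_unchanged) (simp add: writes_progs)
    have s5: "s5 y = s4 y" if "y \<notin> {''v'', ''color''}" for y
      unfolding s5_def using that by (intro den_unchanged) (simp add: writes_progs)
    have s6: "s6 y = s5 y" if "y \<notin> {''v'', ''u'', ''b'', ''W''}" for y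
      unfolding s6_def using that by (intro den_unchanged) (simp add: writes_progs)
    have s': "s' = upd s6 ''i'' 0 0 (s6 ''i'' 0 0 + 1)"
      using b False unfolding s'_def round_prog_def
      by (simp add: s1_def[symmetric] s2_def s3_def s4_def s5_def s6_def del: den.simps(5))
    have "adj_ok s1" using tab s1 by (simp add: table_ok_def adj_ok_def)
    moreover have "vset s1 ''W'' = W" using s1 by (simp add: W_def vset_def)
    ultimately have l2: "levels_ok s2 W" unfolding s2_def by (rule levels_ok_den)
    have W2: "vset s2 ''W'' = W" using s1 s2 by (simp add: W_def vset_def)
    have "levels_ok s3 W" "vset s3 ''W'' = W"
      using l2 W2 s3 by (simp_all add: levels_ok_def vset_def)
    moreover have "dist3_partial (G \<restriction> W) (vset s3 ''D'')"
      unfolding s3_def by (rule dist3_init_correct[OF l2 W2])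
    ultimately have D: "dist3_set (G \<restriction> W) D"
      unfolding D_def s4_def by (rule dist3_loop_correct)
    note props = dist3_partial_props[OF _ WG, of D]
    have partial: "dist3_partial (G \<restriction> W) D" using D by (simp add: dist3_set_def)
    have DW: "D \<subseteq> W" by (rule props(1)[OF partial])
    have i4: "s4 ''i'' = s ''i''" using s1 s2 s3 s4 by simp
    have "coloring_output G f s5 = (\<lambda>v. if v \<in> D then Some (s4 ''i'' 0 0) else coloring_output G f s4 v)"
      unfolding s5_def D_def using i i4 by (intro coloring_output_color_prog) auto
    also have "coloring_output G f s4 = coloring_output G f s"
      using s1 s2 s3 s4 by (intro coloring_output_cong) simp
    also have "coloring_output G f s5 = coloring_output G f s'"
      using s6 unfolding s' by (intro coloring_output_cong) (simp add: upd_apply_table)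
    finally have col: "coloring_output G f s' =
      (\<lambda>v. if v \<in> D then Some (s ''i'' 0 0) else coloring_output G f s v)" by (simp only: i4)
    have i': "s' ''i'' 0 0 = s ''i'' 0 0 + 1"
      using s5 s6 i4 unfolding s' by (simp add: upd_apply)
    have W': "vset s' ''W'' = W - nbhd_of_set W D"
    proof -
      have eq: "s5 ''D'' = s4 ''D''" "s5 ''W'' = s ''W''" "s5 ''d'' = s2 ''d''"
        using s1 s2 s3 s4 s5 by simp_all
      have nb: "(\<exists>u \<in> verts G. s4 ''D'' (f u) 0 \<noteq> 0 \<and> 0 < s2 ''d'' (f u) (f v) \<and> s2 ''d'' (f u) (f v) \<le> 2)
          \<longleftrightarrow> v \<in> nbhd_of_set W D" if v: "v \<in> verts G" for v
      proof -
        have "0 < s2 ''d'' (f u) (f v) \<and> s2 ''d'' (f u) (f v) \<le> 2 \<longleftrightarrow> v \<in> closed_nbhd (G \<restriction> W) u"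
          if u: "u \<in> D" for u
        proof -
          have "u \<in> W" "u \<in> verts G" using u DW WG by blast+
          then show ?thesis using closed_nbhd_level[of u W v] l2 v by (simp add: levels_ok_def)
        qed
        moreover have "u \<in> D \<longleftrightarrow> u \<in> verts G \<and> s4 ''D'' (f u) 0 \<noteq> 0" for u
          by (simp add: D_def vset_def)
        ultimately show ?thesis by blast
      qed
      have "s' ''W'' (f v) 0 = (if v \<in> nbhd_of_set W D then 0 else s ''W'' (f v) 0)"
        if v: "v \<in> verts G" for v
      proof -
        have "s' ''W'' (f v) 0 = s6 ''W'' (f v) 0" by (simp add: s' upd_apply)
        also have "\<dots> = (if v \<in> nbhd_of_set W D then 0 else s ''W'' (f v) 0)"
          unfolding s6_def remove_prog_correct ex_index eq nb[OF v] using f_less[OF v] by simp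
        finally show ?thesis .
      qed
      then show ?thesis unfolding W_def vset_def by (auto split: if_splits)
    qed
    have "table_ok s' P"
      using s1 s2 s3 s4 s5 s6 unfolding s' by (intro table_ok_cong[OF tab]) (simp_all add: upd_apply_table)
    moreover have "\<Union>P \<inter> vset s' ''W'' = {}" using disj W' by blast
    moreover have "elim_reach G (vset s' ''W'' - \<Union> (path_components (G \<restriction> vset s' ''W''))) (s' ''i'' 0 0)
       (coloring_output G f s') (P \<union> path_components (G \<restriction> vset s' ''W''))"
      unfolding col i' using reach False D W' unfolding W_def[symmetric] by (rule elim_reach.round)
    ultimately have "state_ok s' P" unfolding state_ok_def by blast
    moreover have "card (vset s' ''W'') < card W"
    proof (rule psubset_card_mono)
      show "finite W" using WG finite_verts by (rule finite_subset)
      obtain w where w: "w \<in> W" using False by blast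
      then obtain u where u: "u \<in> D" using props(3)[OF partial] by blast
      then have "u \<in> nbhd_of_set W D" by (auto simp: closed_nbhd_def)
      then show "vset s' ''W'' \<subset> W" using u DW W' by blast
    qed
    ultimately show ?thesis using False by simp
  qed
  then show "state_ok s' P"
    and "vset s ''W'' = {} \<Longrightarrow> vset s' ''W'' = {}"
    and "vset s ''W'' \<noteq> {} \<Longrightarrow> card (vset s' ''W'') < card (vset s ''W'')"
    unfolding W_def by blast+
qed

lemma body_prog_correct:
  assumes "state_ok s P"
  defines "s' \<equiv> den n body_prog s"
  shows "\<exists>P. state_ok s' P" and "vset s' ''W'' = {} \<or> card (vset s' ''W'') < card (vset s ''W'')"
proof -
  define W where "W = vset s ''W''"
  define Q where "Q = path_components (G \<restriction> W)"
  have WG: "W \<subseteq> verts G" using vset_subset by (simp add: W_def)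
  have tab: "table_ok s P" and disj: "\<Union>P \<inter> W = {}"
    and reach: "elim_reach G (W - \<Union>Q) (s ''i'' 0 0) (coloring_output G f s) (P \<union> Q)"
    using assms(1) unfolding state_ok_def W_def Q_def by blast+
  have QW: "\<Union>Q \<subseteq> W" using path_components_props(1)[OF WG] unfolding Q_def by blast
  define s1 where "s1 = den n levels_prog s"
  define s2 where "s2 = den n ends_prog s1"
  define s3 where "s3 = den n paths_prog s2"
  have s': "s' = den n round_prog s3"
    by (simp add: s'_def body_prog_def s1_def s2_def s3_def)
  have s1: "s1 y = s y" if "y \<notin> {''u'', ''v'', ''d'', ''e'', ''b'', ''w''}" for y
    unfolding s1_def using that by (intro den_unchanged) (simp add: writes_progs)
  have s2: "s2 y = s1 y" if "y \<notin> {''u'', ''v'', ''E'', ''h'', ''b'', ''w''}" for y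
    unfolding s2_def using that by (intro den_unchanged) (simp add: writes_progs)
  have s3: "s3 y = s2 y" if "y \<notin> {''u'', ''v'', ''P'', ''W'', ''m''}" for y
    unfolding s3_def using that by (intro den_unchanged) (simp add: writes_progs)
  have l1: "levels_ok s1 W"
    unfolding s1_def using tab by (intro levels_ok_den) (simp_all add: table_ok_def W_def)
  have W1: "vset s1 ''W'' = W" using s1 by (simp add: W_def vset_def)
  have E: "vset s2 ''E'' = {u \<in> W. inj_on (level W u) (comp_of W u)}"
    unfolding s2_def by (rule vset_ends[OF l1 W1])
  have l2: "levels_ok s2 W" using l1 s2 by (simp add: levels_ok_def)
  have W2: "vset s2 ''W'' = W" "vset s2 ''P'' = vset s ''P''"
    using s1 s2 W1 by (simp_all add: vset_def)
  have M: "s2 ''M'' j 0 = j mod 3" if "j \<le> n" for j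
    using tab s1 s2 that by (simp add: table_ok_def)
  note paths = paths_prog_correct[OF l2 W2(1) M E, folded s3_def Q_def]
  \<comment> \<open>Paths treated earlier are disjoint from \<open>W\<close>, so marking the
    components of \<open>W\<close> leaves their selection as it was.\<close>
  have dom: "perfectly_dominates (vset s3 ''P'') S" if "S \<in> P" for S
  proof -
    have "v \<in> vset s3 ''P'' \<longleftrightarrow> v \<in> vset s ''P''" if "v \<in> S" for v
    proof -
      have "v \<notin> \<Union>Q" using that \<open>S \<in> P\<close> disj QW by blast
      then show ?thesis using paths(2) W2(2) by blast
    qed
    then show ?thesis
      using tab that perfectly_dominates_cong[of S] unfolding table_ok_def by blast
  qed
  have sub: "vset s3 ''P'' \<subseteq> \<Union> (P \<union> Q)"
  proof -
    have "vset s ''P'' \<subseteq> \<Union>P" using tab by (simp add: table_ok_def)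
    moreover have "vset s3 ''P'' \<subseteq> vset s ''P'' \<union> \<Union>Q" using paths(2) W2(2) by blast
    ultimately show ?thesis by auto
  qed
  have "adj_ok s3" "\<forall>j \<le> n. s3 ''M'' j 0 = j mod 3"
    using tab s1 s2 s3 by (simp_all add: table_ok_def adj_ok_def)
  then have tab3: "table_ok s3 (P \<union> Q)"
    unfolding table_ok_def using sub dom paths(3) by (intro conjI ballI) (assumption, simp, assumption, blast)
  have "s3 ''color'' = s ''color''" "s3 ''i'' = s ''i''"
    using s1 s2 s3 by simp_all
  then have "coloring_output G f s3 = coloring_output G f s" "s3 ''i'' = s ''i''"
    using coloring_output_cong by blast+
  then have reach3: "elim_reach G (vset s3 ''W'') (s3 ''i'' 0 0) (coloring_output G f s3) (P \<union> Q)"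
    using reach paths(1) by simp
  show "\<exists>P. state_ok s' P"
    using round_prog_correct(1)[OF tab3 reach3] s' by blast
  have "finite W" using WG finite_verts by (rule finite_subset)
  then have "card (vset s3 ''W'') \<le> card W"
    using paths(1) by (intro card_mono) auto
  then show "vset s' ''W'' = {} \<or> card (vset s' ''W'') < card (vset s ''W'')"
    using round_prog_correct(2,3)[OF tab3 reach3, folded s'] unfolding W_def
    by (cases "vset s3 ''W'' = {}") (blast, simp)
qed

lemma elimination_prog_correct:
  "elim_coloring G (coloring_output G f (den n elimination_prog (graph_input G f)))"
proof -
  define s where "s = graph_input G f"
  define s1 where "s1 = den n init_prog s"
  define s2 where "s2 = den n (LFor ''q'' body_prog) s1"
  have unfold: "den n elimination_prog s = den n (color_prog ''P'') s2"
    by (simp add: elimination_prog_def s1_def s2_def del: den.simps(5))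
  define t where "t = den n (LFor ''v'' (LAsg ''W'' (Var ''v'') (Lit 0) (Lit 1))) (upd s ''i'' 0 0 1)"
  have s1t: "s1 = den n mod3_prog t"
    by (simp add: s1_def init_prog_def t_def del: den.simps(5))
  have t: "t y = upd s ''i'' 0 0 1 y" if "y \<notin> {''v'', ''W''}" for y
    unfolding t_def using that by (intro den_unchanged) simp
  have s1: "s1 y = t y" if "y \<notin> {''u'', ''M''}" for y
    unfolding s1t using that by (intro den_unchanged) (simp add: writes_progs)
  have "t ''W'' a b = (if a < n \<and> b = 0 then 1 else upd s ''i'' 0 0 1 ''W'' a b)" for a b
    unfolding t_def by (rule den_LFor_map) (auto simp: upd_apply)
  then have W1: "vset s1 ''W'' = verts G"
    using s1 f_less by (auto simp: vset_def)
  have M1: "s1 ''M'' j 0 = j mod 3" if "j \<le> n" for j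
    unfolding s1t using that t by (intro mod3_prog_correct) (simp add: upd_apply s_def graph_input_def)
  have "adj_ok s"
    unfolding adj_ok_def s_def graph_input_def using f_eq adj_in_verts by auto
  then have adj1: "adj_ok s1"
    using s1 t by (simp add: adj_ok_def upd_apply_table)
  have P1: "vset s1 ''P'' = {}"
    using s1 t by (simp add: vset_def upd_apply_table s_def graph_input_def)
  have C1: "coloring_output G f s1 = Map.empty"
    using s1 t by (simp add: coloring_output_def upd_apply_table s_def graph_input_def)
  have i1: "s1 ''i'' 0 0 = 1"
    using s1 t by (simp add: upd_apply)
  have ok1: "state_ok s1 {}"
    unfolding state_ok_def table_ok_def W1 C1 i1 induce_self using adj1 M1 P1 elim_reach.init[of G] by simp
  \<comment> \<open>Every pass empties \<open>W\<close> or makes it smaller, so after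
    \<open>n\<close> passes it is empty in either case.\<close>
  define I where "I i s \<longleftrightarrow> (\<exists>P. state_ok s P) \<and> (vset s ''W'' = {} \<or> card (vset s ''W'') + i \<le> n)"
    for i s
  have vset_upd: "vset (upd s ''q'' 0 0 i) x = vset s x" if "x \<noteq> ''q''" for s i x
    using that by (intro vset_cong) (simp add: upd_apply_table)
  have "coloring_output G f (upd s ''q'' 0 0 i) = coloring_output G f s" for s i
    by (intro coloring_output_cong) (simp add: upd_apply_table)
  then have ok_upd: "state_ok (upd s ''q'' 0 0 i) P \<longleftrightarrow> state_ok s P" for s i P
    unfolding state_ok_def table_ok_def adj_ok_def by (simp add: vset_upd upd_apply_table)
  have "I n s2"
    unfolding s2_def
  proof (rule den_LFor_rule[where I = I])
    show "I 0 s1" using ok1 W1 unfolding I_def by auto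
  next
    fix i s assume IH: "I i s"
    let ?s = "upd s ''q'' 0 0 i"
    obtain P where "state_ok ?s P" using IH ok_upd unfolding I_def by blast
    note body = body_prog_correct[OF this]
    show "I (Suc i) (den n body_prog ?s)"
      unfolding I_def
    proof (intro conjI body(1))
      consider "vset (den n body_prog ?s) ''W'' = {}"
        | "card (vset (den n body_prog ?s) ''W'') < card (vset s ''W'')"
        using body(2) by (auto simp: vset_upd)
      then show "vset (den n body_prog ?s) ''W'' = {} \<or> card (vset (den n body_prog ?s) ''W'') + Suc i \<le> n"
        using IH unfolding I_def by cases auto
    qed
  next
    fix s assume "I n s"
    then show "I n (upd s ''q'' 0 0 n)"
      unfolding I_def ok_upd by (simp add: vset_upd)
  qed
  moreover have "finite (vset s2 ''W'')"
    using vset_subset finite_verts by (rule finite_subset)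
  ultimately have W2: "vset s2 ''W'' = {}" by (auto simp: I_def)
  obtain P where "state_ok s2 P" using \<open>I n s2\<close> unfolding I_def by blast
  then have tab: "table_ok s2 P" and reach: "elim_reach G {} (s2 ''i'' 0 0) (coloring_output G f s2) P"
    unfolding state_ok_def W2 path_components_empty by simp_all
  \<comment> \<open>A positive counter matters because \<open>coloring_output\<close> reads 0 as
    uncolored.\<close>
  have "1 \<le> s2 ''i'' 0 0"
    using elim_reach_props[OF reach] by (elim conjE)
  then have "coloring_output G f (den n elimination_prog s) =
      (\<lambda>v. if v \<in> vset s2 ''P'' then Some (s2 ''i'' 0 0) else coloring_output G f s2 v)"
    unfolding unfold by (intro coloring_output_color_prog) auto
  moreover have "elim_coloring G \<dots>"
    using tab unfolding table_ok_def perfectly_dominates_def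
    by (elim conjE) (rule elim_coloring.intros[OF reach])
  ultimately show ?thesis by (simp add: s_def)
qed

end

text \<open>One program and one polynomial serve all \<open>k\<close> and \<open>G\<close>: the
  procedure does not refer to \<open>k\<close>, which enters only through the bound on the
  colors.\<close>

theorem theorem2:
  shows "\<exists>(prog :: com) (a :: nat) (d :: nat).
    \<forall>(k :: nat) (G :: ('v, 'e) pre_digraph).
      k \<ge> 1 \<and> graph G \<and>
      \<not> is_minor (complete_graph (k + 2)) G \<and>
      \<not> is_minor (complete_graph_minus_triangle (k + 3)) G \<longrightarrow>
      (\<exists>\<chi>. conflict_free_coloring k G \<chi>) \<and>
      (\<forall>\<chi>. elim_coloring G \<chi> \<longrightarrow> conflict_free_coloring k G \<chi>) \<and>
      (\<forall>f. bij_betw f (verts G) {..<card (verts G)} \<longrightarrow>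
        (\<exists>t s. exec prog (graph_input G f) t s \<and>
          t \<le> a * (card (verts G) + 1) ^ d \<and>
          elim_coloring G (coloring_output G f s) \<and>
          conflict_free_coloring k G (coloring_output G f s)))"
proof -
  obtain a d where bound: "\<And>n. time_bound n elimination_prog \<le> a * (n + 1) ^ d"
    using poly_bounded_time_bound unfolding poly_bounded_def by blast
  show ?thesis
  proof (rule exI[of _ "compile elimination_prog"], rule exI[of _ a], rule exI[of _ d], intro allI impI)
    fix k and G :: "('v, 'e) pre_digraph"
    assume asm: "k \<ge> 1 \<and> graph G \<and> \<not> is_minor (complete_graph (k + 2)) G \<and>
      \<not> is_minor (complete_graph_minus_triangle (k + 3)) G"
    then interpret graph G by blast
    have cf: "conflict_free_coloring k G \<chi>" if "elim_coloring G \<chi>" for \<chi>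
      using elim_coloring_conflict_free[OF that] asm by blast
    have run: "\<exists>t s. exec (compile elimination_prog) (graph_input G f) t s \<and>
        t \<le> a * (card (verts G) + 1) ^ d \<and> elim_coloring G (coloring_output G f s)"
      if f: "bij_betw f (verts G) {..<card (verts G)}" for f
    proof -
      interpret numbered_graph G f
        by unfold_locales (fact f)
      have "graph_input G f ''n'' 0 0 = n" by (simp add: graph_input_def)
      then obtain t where "t \<le> time_bound n elimination_prog"
        "exec (compile elimination_prog) (graph_input G f) t (den n elimination_prog (graph_input G f))"
        using exec_compile[OF wf_elimination_prog] by blast
      then show ?thesis
        using elimination_prog_correct bound[of n] le_trans by blast
    qed
    \<comment> \<open>The existence of a coloring is read off from a run of the program under an
      arbitrary numbering.\<close>
    have "\<exists>f. bij_betw f (verts G) {..<card (verts G)}"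
      using ex_bij_betw_finite_nat[OF finite_verts] by (simp add: lessThan_atLeast0)
    then have "\<exists>\<chi>. conflict_free_coloring k G \<chi>"
      using run cf by blast
    then show "(\<exists>\<chi>. conflict_free_coloring k G \<chi>) \<and>
      (\<forall>\<chi>. elim_coloring G \<chi> \<longrightarrow> conflict_free_coloring k G \<chi>) \<and>
      (\<forall>f. bij_betw f (verts G) {..<card (verts G)} \<longrightarrow>
        (\<exists>t s. exec (compile elimination_prog) (graph_input G f) t s \<and>
          t \<le> a * (card (verts G) + 1) ^ d \<and>
          elim_coloring G (coloring_output G f s) \<and>
          conflict_free_coloring k G (coloring_output G f s)))"
      using run cf by blast
  qed
qed

end
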